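(* Let $k$ be any positive integer. On $\mathbb{R}^3$ with coordinates $(x,t,s)$, consider the complex vector fields $$Z_1 = \partial_x - i x\,\partial_t,\qquad Z_2 = x^k\left(\partial_x + i x\,\partial_t\right),\qquad Z_3 = \partial_s .$$ Let $Z_j^*$ denote the formal adjoint of $Z_j$ with respect to $L^2(\mathbb{R}^3)$ with Lebesgue measure $dx\,dt\,ds$, and let $\mathfrak{L} = \sum_{j=1}^3 Z_j^* Z_j$. Then: (1) $Z_1, Z_2, Z_3$ satisfy the bracket condition at each point of $\mathbb{R}^3$; (2) in any bounded open set $V\subset\mathbb{R}^3$, the operator $\mathfrak{L}$ loses at most finitely many derivatives; (3) nonetheless, $\mathfrak{L}$ is not $C^\infty$ hypoelliptic in any neighborhood of the origin.
   Context: Here $\partial_x = \frac{\partial}{\partial x}$, and similarly for $\partial_t,\partial_s$, with no factor of $\sqrt{-1}$. Functions and distributions are complex-valued. $H^r$ denotes the usual $L^2$-based Sobolev space of order $r\in\mathbb{R}$ on $\mathbb{R}^3$. The notation $V\Subset U$ means that $V$ is an open subset of $U$ that is relatively compact in $U$. Bracket condition: a finite collection $\{Z_j\}$ of vector fields with smooth complex-valued coefficients satisfies the bracket condition at a point $p$ if the Lie algebra generated by $\{Z_j\}$ (the $Z_j$ together with all their iterated commutators) spans, over $\mathbb{C}$, the complexified tangent space at $p$. Loss of at most finitely many derivatives: $\mathfrak{L}$ loses at most finitely many derivatives in an open set $U$ if for every $V\Subset U$ there exist real numbers $r>-\infty$, $q<+\infty$, $r'<r$ and a constant $C<\infty$ such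 that for all $u\in C_0^\infty(V)$ (smooth functions compactly supported in $V$), $$\|u\|_{H^{r}} \le C\|\mathfrak{L}u\|_{H^{q}} + C\|u\|_{H^{r'}}.$$ Hypoellipticity: $\mathfrak{L}$ is ($C^\infty$) hypoelliptic in an open set $U$ if for any open subset $V\subset U$ and any distribution $u\in\mathcal{D}'(V)$ such that $\mathfrak{L}u\in C^\infty(V)$, necessarily $u\in C^\infty(V)$. *)

theory Defs
  imports "HOL-Analysis.Analysis"
begin

section \<open>Smooth functions and test functions\<close>

definition partial :: "'n::finite \<Rightarrow> (real^'n \<Rightarrow> complex) \<Rightarrow> real^'n \<Rightarrow> complex"
  where "partial i f p = vector_derivative (\<lambda>h. f (p + h *\<^sub>R axis i 1)) (at 0)"

text \<open>A multi-index is represented by a list of coordinate directions; its order is the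
  length of the list.\<close>

definition partials :: "'n::finite list \<Rightarrow> (real^'n \<Rightarrow> complex) \<Rightarrow> real^'n \<Rightarrow> complex"
  where "partials is f = foldr partial is f"

text \<open>Intended for open \<open>V\<close>; the values of \<open>f\<close> outside \<open>V\<close> are then irrelevant. Differentiability
  is in the sense of Frechet, so all iterated partial derivatives are in particular continuous.\<close>

definition smooth_on :: "(real^'n::finite) set \<Rightarrow> (real^'n \<Rightarrow> complex) \<Rightarrow> bool"
  where "smooth_on V f \<longleftrightarrow> (\<forall>is. \<forall>p\<in>V. partials is f differentiable (at p))"

definition support :: "(real^'n::finite \<Rightarrow> complex) \<Rightarrow> (real^'n) set"
  where "support f = closure {p. f p \<noteq> 0}"

definition test_functions :: "(real^'n::finite) set \<Rightarrow> (real^'n \<Rightarrow> complex) set"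
  where "test_functions V =
    {\<phi>. smooth_on UNIV \<phi> \<and> compact (support \<phi>) \<and> support \<phi> \<subseteq> V}"


section \<open>Distributions\<close>

text \<open>A distribution on \<open>V\<close> is a linear functional on the test functions on \<open>V\<close> satisfying the usual
  seminorm estimates. Only its values on \<open>test_functions V\<close> matter, so two such functionals are
  the same distribution when they agree there.\<close>

definition distribution :: "(real^'n::finite) set \<Rightarrow> ((real^'n \<Rightarrow> complex) \<Rightarrow> complex) \<Rightarrow> bool"
  where "distribution V u \<longleftrightarrow>
    (\<forall>\<phi>\<in>test_functions V. \<forall>\<psi>\<in>test_functions V. u (\<lambda>p. \<phi> p + \<psi> p) = u \<phi> + u \<psi>) \<and>
    (\<forall>c. \<forall>\<phi>\<in>test_functions V. u (\<lambda>p. c * \<phi> p) = c * u \<phi>) \<and>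
    (\<forall>K. compact K \<and> K \<subseteq> V \<longrightarrow>
      (\<exists>C N. \<forall>\<phi>\<in>test_functions V. support \<phi> \<subseteq> K \<longrightarrow>
         norm (u \<phi>) \<le> C * (\<Sum>is | length is \<le> N. SUP p. norm (partials is \<phi> p))))"

definition dist_partial ::
  "'n::finite \<Rightarrow> ((real^'n \<Rightarrow> complex) \<Rightarrow> complex) \<Rightarrow> (real^'n \<Rightarrow> complex) \<Rightarrow> complex"
  where "dist_partial i u \<phi> = - u (partial i \<phi>)"

definition dist_mult ::
  "(real^'n \<Rightarrow> complex) \<Rightarrow> ((real^'n::finite \<Rightarrow> complex) \<Rightarrow> complex) \<Rightarrow> (real^'n \<Rightarrow> complex) \<Rightarrow> complex"
  where "dist_mult a u \<phi> = u (\<lambda>p. a p * \<phi> p)"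

definition dist_of :: "(real^'n::finite \<Rightarrow> complex) \<Rightarrow> (real^'n \<Rightarrow> complex) \<Rightarrow> complex"
  where "dist_of f \<phi> = (LINT p|lborel. f p * \<phi> p)"

text \<open>The distribution \<open>u\<close> on \<open>V\<close> belongs to \<open>C\<^sup>\<infinity>(V)\<close>.\<close>

definition smooth_distribution :: "(real^'n::finite) set \<Rightarrow> ((real^'n \<Rightarrow> complex) \<Rightarrow> complex) \<Rightarrow> bool"
  where "smooth_distribution V u \<longleftrightarrow>
    (\<exists>f. smooth_on V f \<and> (\<forall>\<phi>\<in>test_functions V. u \<phi> = dist_of f \<phi>))"


section \<open>Complex vector fields\<close>

text \<open>The vector field \<open>\<Sum>i. a\<^sub>i \<partial>\<^sub>i\<close> is represented by the function \<open>p \<mapsto> (a\<^sub>i(p))\<^sub>i\<close>, whose value at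
  \<open>p\<close> is an element of the complexified tangent space at \<open>p\<close>.\<close>

type_synonym 'n vfield = "real^'n \<Rightarrow> complex^'n"

definition vf_apply :: "'n::finite vfield \<Rightarrow> (real^'n \<Rightarrow> complex) \<Rightarrow> real^'n \<Rightarrow> complex"
  where "vf_apply Z f p = (\<Sum>i\<in>UNIV. Z p $ i * partial i f p)"

text \<open>\<open>Z\<^sup>* f = - \<Sum>i. \<partial>\<^sub>i(cnj a\<^sub>i f)\<close>; the duality with respect to the inner product of
  \<open>L\<^sup>2\<close> is \<open>vf_adjoint_duality\<close> below.\<close>

definition vf_adjoint :: "'n::finite vfield \<Rightarrow> (real^'n \<Rightarrow> complex) \<Rightarrow> real^'n \<Rightarrow> complex"
  where "vf_adjoint Z f p = - (\<Sum>i\<in>UNIV. partial i (\<lambda>q. cnj (Z q $ i) * f q) p)"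

definition sum_of_squares :: "'n::finite vfield list \<Rightarrow> (real^'n \<Rightarrow> complex) \<Rightarrow> real^'n \<Rightarrow> complex"
  where "sum_of_squares Zs f p = (\<Sum>Z\<leftarrow>Zs. vf_adjoint Z (vf_apply Z f) p)"

text \<open>The same three operators acting on distributions.\<close>

definition dist_vf_apply ::
  "'n::finite vfield \<Rightarrow> ((real^'n \<Rightarrow> complex) \<Rightarrow> complex) \<Rightarrow> (real^'n \<Rightarrow> complex) \<Rightarrow> complex"
  where "dist_vf_apply Z u \<phi> = (\<Sum>i\<in>UNIV. dist_mult (\<lambda>q. Z q $ i) (dist_partial i u) \<phi>)"

definition dist_vf_adjoint ::
  "'n::finite vfield \<Rightarrow> ((real^'n \<Rightarrow> complex) \<Rightarrow> complex) \<Rightarrow> (real^'n \<Rightarrow> complex) \<Rightarrow> complex"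
  where "dist_vf_adjoint Z u \<phi> = - (\<Sum>i\<in>UNIV. dist_partial i (dist_mult (\<lambda>q. cnj (Z q $ i)) u) \<phi>)"

definition dist_sum_of_squares ::
  "'n::finite vfield list \<Rightarrow> ((real^'n \<Rightarrow> complex) \<Rightarrow> complex) \<Rightarrow> (real^'n \<Rightarrow> complex) \<Rightarrow> complex"
  where "dist_sum_of_squares Zs u \<phi> = (\<Sum>Z\<leftarrow>Zs. dist_vf_adjoint Z (dist_vf_apply Z u) \<phi>)"


section \<open>The bracket condition\<close>

definition vf_bracket :: "'n::finite vfield \<Rightarrow> 'n vfield \<Rightarrow> 'n vfield"
  where "vf_bracket X Y p =
    (\<chi> i. vf_apply X (\<lambda>q. Y q $ i) p - vf_apply Y (\<lambda>q. X q $ i) p)"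

inductive_set lie_algebra_generated :: "'n::finite vfield set \<Rightarrow> 'n vfield set"
  for S :: "'n vfield set" where
  generator: "Z \<in> S \<Longrightarrow> Z \<in> lie_algebra_generated S"
| add: "X \<in> lie_algebra_generated S \<Longrightarrow> Y \<in> lie_algebra_generated S \<Longrightarrow>
    (\<lambda>p. X p + Y p) \<in> lie_algebra_generated S"
| scale: "X \<in> lie_algebra_generated S \<Longrightarrow> (\<lambda>p. c *s X p) \<in> lie_algebra_generated S"
| bracket: "X \<in> lie_algebra_generated S \<Longrightarrow> Y \<in> lie_algebra_generated S \<Longrightarrow>
    vf_bracket X Y \<in> lie_algebra_generated S"

text \<open>\<open>vec.span\<close> is the span over the scalar field of the vectors, here the complex numbers.\<close>

definition bracket_condition :: "'n::finite vfield set \<Rightarrow> real^'n \<Rightarrow> bool"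
  where "bracket_condition S p \<longleftrightarrow> vec.span {Z p | Z. Z \<in> lie_algebra_generated S} = UNIV"


section \<open>Sobolev norms and loss of derivatives\<close>

definition fourier :: "(real^'n::finite \<Rightarrow> complex) \<Rightarrow> real^'n \<Rightarrow> complex"
  where "fourier u \<xi> = of_real ((2 * pi) powr (- real CARD('n) / 2)) *
    (LINT p|lborel. exp (- (\<i> * of_real (p \<bullet> \<xi>))) * u p)"

text \<open>Only used for compactly supported smooth \<open>u\<close>, for which both integrals converge.\<close>

definition sobolev_norm :: "real \<Rightarrow> (real^'n::finite \<Rightarrow> complex) \<Rightarrow> real"
  where "sobolev_norm r u =
    sqrt (LINT \<xi>|lborel. (1 + (norm \<xi>)\<^sup>2) powr r * (norm (fourier u \<xi>))\<^sup>2)"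

definition relatively_compact_in :: "'a::topological_space set \<Rightarrow> 'a set \<Rightarrow> bool"
  where "relatively_compact_in V U \<longleftrightarrow> open V \<and> compact (closure V) \<and> closure V \<subseteq> U"

definition loses_finitely_many_derivatives ::
  "((real^'n::finite \<Rightarrow> complex) \<Rightarrow> real^'n \<Rightarrow> complex) \<Rightarrow> (real^'n) set \<Rightarrow> bool"
  where "loses_finitely_many_derivatives L U \<longleftrightarrow>
    (\<forall>V. relatively_compact_in V U \<longrightarrow>
      (\<exists>r q r' C. r' < r \<and>
        (\<forall>u\<in>test_functions V.
          sobolev_norm r u \<le> C * sobolev_norm q (L u) + C * sobolev_norm r' u)))"


section \<open>Hypoellipticity\<close>

text \<open>Here \<open>L\<close> is the action of the operator on distributions.\<close>

definition hypoelliptic ::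
  "(((real^'n::finite \<Rightarrow> complex) \<Rightarrow> complex) \<Rightarrow> (real^'n \<Rightarrow> complex) \<Rightarrow> complex) \<Rightarrow>
    (real^'n) set \<Rightarrow> bool"
  where "hypoelliptic L U \<longleftrightarrow>
    (\<forall>V u. open V \<and> V \<subseteq> U \<and> distribution V u \<and> smooth_distribution V (L u) \<longrightarrow>
      smooth_distribution V u)"


section \<open>The vector fields on three-space\<close>

text \<open>The coordinates \<open>(x,t,s)\<close> of \<open>p\<close> are \<open>(p$1, p$2, p$3)\<close>.\<close>

definition Z1 :: "3 vfield"
  where "Z1 p = vector [1, - \<i> * of_real (p$1), 0]"

definition Z2 :: "nat \<Rightarrow> 3 vfield"
  where "Z2 k p = of_real (p$1) ^ k *s vector [1, \<i> * of_real (p$1), 0]"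

definition Z3 :: "3 vfield"
  where "Z3 p = vector [0, 0, 1]"


section \<open>Duality of the formal adjoint\<close>

lemma differentiable_along_line:
  fixes f :: "real^'n::finite \<Rightarrow> complex"
  assumes "f differentiable (at (p + h *\<^sub>R axis i 1))"
  shows "((\<lambda>h. f (p + h *\<^sub>R axis i 1)) has_vector_derivative partial i f (p + h *\<^sub>R axis i 1)) (at h)"
proof -
  let ?q = "p + h *\<^sub>R axis i 1"
  obtain D where D: "(f has_derivative D) (at ?q)"
    using assms unfolding differentiable_def by blast
  have lin: "linear D"
    using D has_derivative_linear by blast
  have *: "((\<lambda>h. f (r + h *\<^sub>R axis i 1)) has_vector_derivative D (axis i 1)) (at h')"
    if "r + h' *\<^sub>R axis i 1 = ?q" for r h'
  proof -
    have "((\<lambda>h. r + h *\<^sub>R axis i 1) has_derivative (\<lambda>h. h *\<^sub>R axis i 1)) (at h')"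
      by (auto intro!: derivative_eq_intros)
    moreover have "(f has_derivative D) (at (r + h' *\<^sub>R axis i 1))"
      using D that by simp
    ultimately have "((\<lambda>h. f (r + h *\<^sub>R axis i 1)) has_derivative (\<lambda>h. D (h *\<^sub>R axis i 1))) (at h')"
      by (rule has_derivative_compose)
    then show ?thesis
      by (simp add: has_vector_derivative_def linear_cmul[OF lin])
  qed
  have "partial i f ?q = D (axis i 1)"
    unfolding partial_def by (rule vector_derivative_at) (rule *, simp)
  then show ?thesis
    using *[of p h] by simp
qed

lemma partial_mult:
  fixes f g :: "real^'n::finite \<Rightarrow> complex"
  assumes "f differentiable (at p)" "g differentiable (at p)"
  shows "partial i (\<lambda>q. f q * g q) p = f p * partial i g p + partial i f p * g p"
  unfolding partial_def[of i "\<lambda>q. f q * g q"]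
  using has_vector_derivative_mult[OF differentiable_along_line[of f p 0 i]
      differentiable_along_line[of g p 0 i]] assms
  by (auto intro!: vector_derivative_at)

lemma partial_cnj:
  fixes f :: "real^'n::finite \<Rightarrow> complex"
  assumes "f differentiable (at p)"
  shows "partial i (\<lambda>q. cnj (f q)) p = cnj (partial i f p)"
  unfolding partial_def[of i "\<lambda>q. cnj (f q)"]
  using has_vector_derivative_cnj[OF differentiable_along_line[of f p 0 i]] assms
  by (auto intro!: vector_derivative_at)

lemma differentiable_cnj:
  assumes "f differentiable (at p)"
  shows "(\<lambda>q. cnj (f q)) differentiable (at p)"
  using assms has_derivative_cnj unfolding differentiable_def by blast

text \<open>By translation invariance and dominated convergence for the difference quotients.\<close>

lemma integral_partial:
  fixes h :: "real^'n::finite \<Rightarrow> complex"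
  assumes diff: "\<And>p. h differentiable (at p)"
    and cont: "continuous_on UNIV (partial i h)"
    and cpt: "compact K" and zero: "\<And>p. p \<notin> K \<Longrightarrow> h p = 0"
  shows "integrable lborel (partial i h)" "(LINT p|lborel. partial i h p) = 0"
proof -
  let ?e = "axis i 1 :: real^'n"
  have ch: "continuous_on UNIV h"
    using diff by (simp add: continuous_at_imp_continuous_on differentiable_imp_continuous_within)
  have int_of_cont: "integrable lborel g" 
    if "continuous_on UNIV g" "\<And>p. p \<notin> M \<Longrightarrow> g p = 0" "compact M" for g :: "real^'n \<Rightarrow> complex" and M
  proof -
    have "integrable lborel (\<lambda>p. indicator M p *\<^sub>R g p)"
      using borel_integrable_compact[OF that(3), of g] that(1) continuous_on_subset
      by (auto simp: set_integrable_def)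
    also have "(\<lambda>p. indicator M p *\<^sub>R g p) = g"
      using that(2) by (auto simp: indicator_def fun_eq_iff)
    finally show ?thesis .
  qed
  have ih: "integrable lborel h"
    using int_of_cont[OF ch zero cpt] by blast
  define d where "d = (\<lambda>n p. of_nat (Suc n) * (h (p + (1 / real (Suc n)) *\<^sub>R ?e) - h p))"
  have dv: "((\<lambda>t. h (p + t *\<^sub>R ?e)) has_vector_derivative partial i h (p + t *\<^sub>R ?e)) (at t)" for p t
    by (rule differentiable_along_line) (rule diff)
  obtain R where R: "R > 0" "\<And>p. p \<in> K \<Longrightarrow> norm p \<le> R"
    using compact_imp_bounded[OF cpt] unfolding bounded_pos by blast
  define M where "M = cball (0::real^'n) (R + 1)"
  have cM: "compact M" unfolding M_def by simp
  have pz: "partial i h p = 0" if "p \<notin> K" for p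
  proof -
    have "open (- K)" using cpt compact_imp_closed by blast
    with that obtain e where e: "e > 0" "ball p e \<subseteq> - K"
      by (metis openE ComplI)
    have "((\<lambda>t. h (p + t *\<^sub>R ?e)) has_vector_derivative 0) (at 0)"
    proof (rule has_vector_derivative_transform_within_open[where f = "\<lambda>_. 0" and S = "ball 0 e"])
      fix t :: real assume "t \<in> ball 0 e"
      then have "p + t *\<^sub>R ?e \<in> ball p e" by (simp add: dist_norm norm_axis_1)
      then show "0 = h (p + t *\<^sub>R ?e)" using e zero by auto
    qed (use e in auto)
    then show ?thesis
      unfolding partial_def by (rule vector_derivative_at)
  qed
  show ip: "integrable lborel (partial i h)"
    using int_of_cont[OF cont pz cpt] by blast
  obtain B where B: "B > 0" "\<And>p. p \<in> K \<Longrightarrow> norm (partial i h p) \<le> B"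
    using compact_imp_bounded[OF compact_continuous_image[OF continuous_on_subset[OF cont] cpt]]
    unfolding bounded_pos by auto
  have B': "norm (partial i h p) \<le> B" for p
    using B pz by (cases "p \<in> K") auto
  have dbound: "norm (d n p) \<le> indicator M p * B" for n p
  proof (cases "p \<in> M")
    case True
    let ?t = "1 / real (Suc n)"
    have "norm (h (p + ?t *\<^sub>R ?e) - h (p + 0 *\<^sub>R ?e)) \<le> B * norm (?t - 0)"
    proof (rule differentiable_bound[where S = UNIV and f = "\<lambda>t. h (p + t *\<^sub>R ?e)" and f' = "\<lambda>t s. s *\<^sub>R partial i h (p + t *\<^sub>R ?e)"])
      fix t :: real
      show "((\<lambda>t. h (p + t *\<^sub>R ?e)) has_derivative (\<lambda>s. s *\<^sub>R partial i h (p + t *\<^sub>R ?e))) (at t)"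
        using dv unfolding has_vector_derivative_def .
      show "onorm (\<lambda>s. s *\<^sub>R partial i h (p + t *\<^sub>R ?e)) \<le> B"
        using B' by (intro onorm_bound) (simp_all add: mult.commute[of B] mult_left_mono less_imp_le[OF B(1)])
    qed auto
    then have "real (Suc n) * norm (h (p + ?t *\<^sub>R ?e) - h p) \<le> B"
      by (simp add: field_simps)
    then show ?thesis
      using True by (simp only: d_def norm_mult norm_of_nat) simp
  next
    case False
    then have n: "norm p > R + 1" by (simp add: M_def)
    have "norm p \<le> norm (p + (1 / real (Suc n)) *\<^sub>R ?e) + norm ((1 / real (Suc n)) *\<^sub>R ?e)"
      by (metis add_diff_cancel_right' norm_triangle_ineq4)
    also have "norm ((1 / real (Suc n)) *\<^sub>R ?e) \<le> 1"
      by (simp add: norm_axis_1)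
    finally have "norm (p + (1 / real (Suc n)) *\<^sub>R ?e) > R" using n by linarith
    then have "h (p + (1 / real (Suc n)) *\<^sub>R ?e) = 0" "h p = 0"
      using R n zero by (smt (verit))+
    then show ?thesis using False by (simp add: d_def)
  qed
  have dlim: "(\<lambda>n. d n p) \<longlonglongrightarrow> partial i h p" for p
  proof -
    have "((\<lambda>t. (h (p + t *\<^sub>R ?e) - h p) /\<^sub>R t) \<longlongrightarrow> partial i h p) (at 0)"
    proof -
      have "((\<lambda>t. norm (h (p + t *\<^sub>R ?e) - h p - t *\<^sub>R partial i h p) / norm t) \<longlongrightarrow> 0) (at 0)"
        using dv[of p 0] by (simp add: has_vector_derivative_def has_derivative_at)
      moreover have "\<forall>\<^sub>F t in at 0. norm (h (p + t *\<^sub>R ?e) - h p - t *\<^sub>R partial i h p) / norm t =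
          norm ((h (p + t *\<^sub>R ?e) - h p) /\<^sub>R t - partial i h p)"
      proof (rule eventually_at_filter[THEN iffD2, OF always_eventually], intro allI impI)
        fix t :: real assume "t \<noteq> 0"
        then have "(h (p + t *\<^sub>R ?e) - h p) /\<^sub>R t - partial i h p =
            (h (p + t *\<^sub>R ?e) - h p - t *\<^sub>R partial i h p) /\<^sub>R t"
          by (simp add: scaleR_diff_right)
        then show "norm (h (p + t *\<^sub>R ?e) - h p - t *\<^sub>R partial i h p) / norm t =
            norm ((h (p + t *\<^sub>R ?e) - h p) /\<^sub>R t - partial i h p)"
          by (simp only: norm_scaleR) (simp add: divide_inverse mult.commute)
      qed
      ultimately have "((\<lambda>t. norm ((h (p + t *\<^sub>R ?e) - h p) /\<^sub>R t - partial i h p)) \<longlongrightarrow> 0) (at 0)"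
        by (rule Lim_transform_eventually)
      then show ?thesis
        by (simp only: tendsto_norm_zero_iff Lim_null[symmetric])
    qed
    moreover have "filterlim (\<lambda>n. 1 / real (Suc n)) (at 0) sequentially"
      using LIMSEQ_inverse_real_of_nat
      by (auto simp: filterlim_at inverse_eq_divide simp del: of_nat_Suc intro!: always_eventually)
    ultimately have "(\<lambda>n. (h (p + (1 / real (Suc n)) *\<^sub>R ?e) - h p) /\<^sub>R (1 / real (Suc n))) \<longlonglongrightarrow> partial i h p"
      by (rule filterlim_compose)
    then show ?thesis
      by (simp add: d_def scaleR_conv_of_real)
  qed
  have d0: "(LINT p|lborel. d n p) = 0" for n
  proof -
    let ?c = "(1 / real (Suc n)) *\<^sub>R ?e"
    have "integrable (distr lborel borel ((+) ?c)) h"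
      using ih by (simp only: lborel_distr_plus)
    then have i: "integrable lborel (\<lambda>p. h (?c + p))"
      by (rule integrable_distr[rotated]) simp
    have "(LINT p|lborel. h p) = (LINT p|distr lborel borel ((+) ?c). h p)"
      by (simp only: lborel_distr_plus)
    also have "\<dots> = (LINT p|lborel. h (?c + p))"
      using ih by (intro integral_distr) (auto simp: borel_measurable_integrable)
    finally have "(LINT p|lborel. h (?c + p)) = (LINT p|lborel. h p)" ..
    with i have "integrable lborel (\<lambda>p. h (p + ?c))"
      and "(LINT p|lborel. h (p + ?c)) = (LINT p|lborel. h p)"
      by (simp_all only: add.commute)
    then show ?thesis
      unfolding d_def using ih by simp
  qed
  have "(\<lambda>n. LINT p|lborel. d n p) \<longlonglongrightarrow> (LINT p|lborel. partial i h p)"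
  proof (rule integral_dominated_convergence[where w = "\<lambda>p. indicator M p * B"])
    show "integrable lborel (\<lambda>p. indicator M p * B)"
      using borel_integrable_compact[OF cM, of "\<lambda>_. B"] by simp
    show "d n \<in> borel_measurable lborel" for n
    proof -
      have "continuous_on UNIV (\<lambda>p. h (p + (1 / real (Suc n)) *\<^sub>R ?e))"
        by (rule continuous_on_compose2[OF ch]) (auto intro!: continuous_intros)
      then have "continuous_on UNIV (d n)"
        unfolding d_def by (intro continuous_intros ch)
      then show ?thesis
        by (simp add: borel_measurable_continuous_onI)
    qed
  qed (use ip dlim dbound in auto)
  then show "(LINT p|lborel. partial i h p) = 0"
    using d0 by (simp add: LIMSEQ_const_iff)
qed

lemma smooth_on_imp:
  assumes "smooth_on V f" "p \<in> V"
  shows "f differentiable (at p)" "partial i f differentiable (at p)"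
proof -
  show "f differentiable (at p)"
    using assms unfolding smooth_on_def partials_def by (metis foldr_Nil id_apply)
  have "partials [i] f differentiable (at p)"
    using assms unfolding smooth_on_def by blast
  then show "partial i f differentiable (at p)"
    by (simp add: partials_def)
qed

lemma vf_adjoint_duality:
  fixes Z :: "'n::finite vfield"
  assumes Z: "\<And>i. smooth_on UNIV (\<lambda>p. Z p $ i)"
    and f: "f \<in> test_functions UNIV" and g: "g \<in> test_functions UNIV"
  shows "(LINT p|lborel. vf_apply Z f p * cnj (g p)) = (LINT p|lborel. f p * cnj (vf_adjoint Z g p))"
proof -
  have sf: "smooth_on UNIV f" and sg: "smooth_on UNIV g" and cf: "compact (support f)"
    using f g by (auto simp: test_functions_def)
  let ?h = "\<lambda>i q. f q * cnj (cnj (Z q $ i) * g q)"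
  note df = smooth_on_imp[OF sf UNIV_I] and dg = smooth_on_imp[OF sg UNIV_I]
    and dZ = smooth_on_imp[OF Z UNIV_I]
  have dZg: "(\<lambda>q. cnj (Z q $ i) * g q) differentiable (at p)" for i p
    by (intro differentiable_mult differentiable_cnj dg dZ)
  have cont: "continuous_on UNIV F" if "\<And>p. F differentiable (at p)" for F :: "real^'n \<Rightarrow> complex"
    using that by (simp add: continuous_at_imp_continuous_on differentiable_imp_continuous_within)
  note conts = cont[OF df(1)] cont[OF dg(1)] cont[OF dZ(1)] cont[OF df(2)] cont[OF dg(2)] cont[OF dZ(2)]
  have dh: "partial i (?h i) = (\<lambda>p. f p * cnj (partial i (\<lambda>q. cnj (Z q $ i) * g q) p)
      + partial i f p * (Z p $ i * cnj (g p)))" for i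
  proof
    fix p
    have "partial i (?h i) p = f p * partial i (\<lambda>q. cnj (cnj (Z q $ i) * g q)) p
        + partial i f p * cnj (cnj (Z p $ i) * g p)"
      by (rule partial_mult[OF df(1) differentiable_cnj[OF dZg]])
    then show "partial i (?h i) p = f p * cnj (partial i (\<lambda>q. cnj (Z q $ i) * g q) p)
        + partial i f p * (Z p $ i * cnj (g p))"
      by (simp only: partial_cnj[OF dZg]) simp
  qed
  have pZg: "partial i (\<lambda>q. cnj (Z q $ i) * g q) =
     (\<lambda>p. cnj (Z p $ i) * partial i g p + cnj (partial i (\<lambda>q. Z q $ i) p) * g p)" for i
    by (rule ext) (simp only: partial_mult[OF differentiable_cnj[OF dZ(1)] dg(1)] partial_cnj[OF dZ(1)])
  have supp: "f p = 0" if "p \<notin> support f" for p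
    using that closure_subset[of "{p. f p \<noteq> 0}"] by (auto simp: support_def)
  have cpd: "continuous_on UNIV (partial i (?h i))" for i
    unfolding dh pZg by (intro continuous_intros conts)
  have ip: "integrable lborel (partial i (?h i))" "(LINT p|lborel. partial i (?h i) p) = 0" for i
    by (rule integral_partial[where h = "?h i" and K = "support f"];
        auto intro!: differentiable_mult differentiable_cnj df dZg cf cpd simp: supp
          simp del: complex_cnj_mult)+
  have i1: "integrable lborel (\<lambda>p. f p * cnj (partial i (\<lambda>q. cnj (Z q $ i) * g q) p))" for i
  proof -
    have "continuous_on UNIV (\<lambda>p. f p * cnj (partial i (\<lambda>q. cnj (Z q $ i) * g q) p))"
      unfolding pZg by (intro continuous_intros conts)
    then have "integrable lborel (\<lambda>p. indicator (support f) p *\<^sub>R (f p * cnj (partial i (\<lambda>q. cnj (Z q $ i) * g q) p)))"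
      by (intro borel_integrable_compact[OF cf]) (rule continuous_on_subset, auto)
    also have "(\<lambda>p. indicator (support f) p *\<^sub>R (f p * cnj (partial i (\<lambda>q. cnj (Z q $ i) * g q) p)))
        = (\<lambda>p. f p * cnj (partial i (\<lambda>q. cnj (Z q $ i) * g q) p))"
      using supp by (auto simp: indicator_def fun_eq_iff)
    finally show ?thesis .
  qed
  have i2: "integrable lborel (\<lambda>p. partial i f p * (Z p $ i * cnj (g p)))" for i
    using Bochner_Integration.integrable_diff[OF ip(1)[of i] i1[of i]] by (simp only: dh) simp
  have e: "(LINT p|lborel. partial i f p * (Z p $ i * cnj (g p))) =
      - (LINT p|lborel. f p * cnj (partial i (\<lambda>q. cnj (Z q $ i) * g q) p))" for i
    using ip(2)[of i] Bochner_Integration.integral_add[OF i1[of i] i2[of i]]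
    by (simp only: dh) (simp add: eq_neg_iff_add_eq_0 add.commute)
  have "(LINT p|lborel. vf_apply Z f p * cnj (g p)) =
      (LINT p|lborel. (\<Sum>i\<in>UNIV. partial i f p * (Z p $ i * cnj (g p))))"
    by (simp add: vf_apply_def sum_distrib_left mult_ac)
  also have "\<dots> = (\<Sum>i\<in>UNIV. (LINT p|lborel. partial i f p * (Z p $ i * cnj (g p))))"
    by (rule Bochner_Integration.integral_sum) (rule i2)
  also have "\<dots> = - (\<Sum>i\<in>UNIV. (LINT p|lborel. f p * cnj (partial i (\<lambda>q. cnj (Z q $ i) * g q) p)))"
    by (simp only: e sum_negf)
  also have "\<dots> = - (LINT p|lborel. (\<Sum>i\<in>UNIV. f p * cnj (partial i (\<lambda>q. cnj (Z q $ i) * g q) p)))"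
    by (subst Bochner_Integration.integral_sum) (auto intro: i1 simp del: complex_cnj_mult)
  also have "\<dots> = (LINT p|lborel. f p * cnj (vf_adjoint Z g p))"
    by (simp add: vf_adjoint_def sum_distrib_left del: complex_cnj_mult)
  finally show ?thesis .
qed

end

theory Submission
  imports Defs "HOL-Probability.Characteristic_Functions"
begin

text \<open>
  The bracket condition is a computation: bracketing \<open>Z2\<close> repeatedly with \<open>Z1\<close> lowers the power
  of \<open>x\<close>, and after \<open>k + 1\<close> steps a non-zero constant multiple of \<open>\<partial>\<^sub>t\<close> remains
  (\<open>bracket_condition_Z\<close>).

  The a priori estimate rests on \<open>Z3 = \<partial>\<^sub>s\<close> alone. On a bounded set Poincare's inequality bounds the
  \<open>L\<^sup>2\<close> norm of \<open>u\<close> by that of \<open>\<partial>\<^sub>s u\<close>, and the energy identity \<open>\<Sum>j. \<parallel>Zj u\<parallel>\<^sup>2 = \<langle>u, L u\<rangle>\<close> bounds the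
  latter, so that \<open>\<parallel>u\<parallel> \<le> C \<parallel>L u\<parallel>\<close> in \<open>L\<^sup>2\<close>
  (\<open>loses_finitely_many_derivatives_sum_of_squares\<close>). As Sobolev norms are defined by the
  Fourier transform, this needs Plancherel's identity (\<open>plancherel\<close>), which is proved by Gaussian
  regularization.

  The failure of hypoellipticity comes from solutions \<open>exp (\<i> \<tau> t + \<mu> s) f(x)\<close> of \<open>L U = 0\<close>. The
  profile \<open>f\<close> has to be an eigenfunction, with eigenvalue \<open>\<Lambda> = \<mu>\<^sup>2\<close>, of an ordinary differential
  operator that perturbs the harmonic oscillator \<open>- f'' + (\<tau>\<^sup>2 x\<^sup>2 - \<tau>) f\<close>. The ground state
  \<open>exp (- \<tau> x\<^sup>2 / 2)\<close> of the oscillator has energy \<open>0\<close>, and it lives where \<open>x\<^sup>2\<close> is of order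
  \<open>1 / \<tau>\<close>; there the factor \<open>x\<^sup>k\<close> in \<open>Z2\<close> makes the perturbation bounded. Hence \<open>\<Lambda>\<close> is bounded
  above as \<open>\<tau>\<close> grows (\<open>positive_solution_bound\<close>): the factor \<open>exp (\<mu> s)\<close>, which would have to
  outgrow every power of \<open>\<tau>\<close> to enforce regularity, stays bounded near the origin. Solutions are
  required only near the origin, so the eigenvalue problem may be posed on \<open>[-1, 1]\<close> with Dirichlet
  conditions and solved by shooting, which also yields \<open>0 \<le> f \<le> f 0 = 1\<close>
  (\<open>bounded_ground_state\<close>). A lacunary superposition of these solutions is a continuous function
  annihilated by \<open>L\<close> that is not differentiable along the \<open>t\<close>-axis (\<open>not_hypoelliptic\<close>).
\<close>


section \<open>Smooth functions and test functions\<close>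

lemma partials_simps [simp]:
  "partials [] f = f" "partials (is @ [i]) f = partials is (partial i f)"
  by (simp_all add: partials_def)

lemma partial_eqI:
  assumes "(f has_derivative D) (at p)"
  shows "partial i f p = D (axis i 1)"
proof -
  have "((\<lambda>h. p + h *\<^sub>R axis i 1) has_derivative (\<lambda>h. h *\<^sub>R axis i 1)) (at 0)"
    by (auto intro!: derivative_eq_intros)
  then have "((\<lambda>h. f (p + h *\<^sub>R axis i 1)) has_derivative (\<lambda>h. D (h *\<^sub>R axis i 1))) (at 0)"
    by (rule has_derivative_compose) (use assms in simp)
  moreover have "D (h *\<^sub>R axis i 1) = h *\<^sub>R D (axis i 1)" for h
    using assms has_derivative_linear linear_cmul by blast
  ultimately show ?thesis
    unfolding partial_def by (intro vector_derivative_at) (simp add: has_vector_derivative_def)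
qed

lemma partial_add:
  assumes "f differentiable (at p)" "g differentiable (at p)"
  shows "partial i (\<lambda>q. f q + g q) p = partial i f p + partial i g p"
  unfolding partial_def[of i "\<lambda>q. f q + g q"]
  using has_vector_derivative_add[OF differentiable_along_line[of f p 0 i]
      differentiable_along_line[of g p 0 i]] assms
  by (auto intro!: vector_derivative_at)

lemma has_derivative_coordinate:
  fixes g :: "real \<Rightarrow> complex" and p :: "real^'n::finite"
  assumes "(g has_vector_derivative g') (at (p $ j))"
  shows "((\<lambda>q. g (q $ j)) has_derivative (\<lambda>h. (h $ j) *\<^sub>R g')) (at p)"
proof -
  have "((\<lambda>q::real^'n. q $ j) has_derivative (\<lambda>h. h $ j)) (at p)"
    by (intro bounded_linear_imp_has_derivative bounded_linear_vec_nth)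
  then show ?thesis
    by (rule has_derivative_compose) (use assms in \<open>simp add: has_vector_derivative_def\<close>)
qed

lemma partial_coordinate:
  fixes g :: "real \<Rightarrow> complex"
  assumes "(g has_vector_derivative g') (at (p $ j))"
  shows "partial i (\<lambda>q. g (q $ j)) p = (if i = j then g' else 0)"
    "(\<lambda>q. g (q $ j)) differentiable (at p)"
  using partial_eqI[OF has_derivative_coordinate[OF assms], of i]
    has_derivative_coordinate[OF assms]
  by (auto simp: axis_def differentiable_def)

lemma partial_monomial:
  "partial i (\<lambda>q::real^'n::finite. c * of_real (q $ j) ^ n) p =
    (if i = j then c * of_nat n * of_real (p $ j) ^ (n - 1) else 0)"
proof (rule partial_coordinate(1))
  have "((\<lambda>x::complex. c * x ^ n) has_field_derivative c * of_nat n * of_real (p $ j) ^ (n - 1))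
      (at (of_real (p $ j)))"
    by (auto intro!: derivative_eq_intros)
  then show "((\<lambda>x. c * of_real x ^ n) has_vector_derivative
      c * of_nat n * of_real (p $ j) ^ (n - 1)) (at (p $ j))"
    by (rule has_vector_derivative_real_field)
qed

text \<open>Smoothness of concrete functions is checked by exhibiting an algebra of differentiable
  functions that is stable under all partial derivatives; by the product rule it is enough to
  look at the generators.\<close>

inductive_set generated_algebra ::
  "(real^'n::finite \<Rightarrow> complex) set \<Rightarrow> (real^'n \<Rightarrow> complex) set" for B where
  base: "f \<in> B \<Longrightarrow> f \<in> generated_algebra B"
| add: "f \<in> generated_algebra B \<Longrightarrow> g \<in> generated_algebra B \<Longrightarrow>
    (\<lambda>p. f p + g p) \<in> generated_algebra B"
| mult: "f \<in> generated_algebra B \<Longrightarrow> g \<in> generated_algebra B \<Longrightarrow>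
    (\<lambda>p. f p * g p) \<in> generated_algebra B"

lemma smooth_on_generated_algebra:
  assumes diff: "\<And>f p. f \<in> B \<Longrightarrow> f differentiable (at p)"
    and partial: "\<And>f i. f \<in> B \<Longrightarrow> partial i f \<in> generated_algebra B"
    and f: "f \<in> generated_algebra B"
  shows "smooth_on UNIV f"
proof -
  have step: "(\<forall>p. h differentiable (at p)) \<and> (\<forall>i. partial i h \<in> generated_algebra B)"
    if "h \<in> generated_algebra B" for h
    using that
  proof induction
    case (base f)
    then show ?case using diff partial by blast
  next
    case (add f g)
    then have "partial i (\<lambda>p. f p + g p) = (\<lambda>p. partial i f p + partial i g p)" for i
      by (auto simp: partial_add)
    with add show ?case
      by (auto intro: generated_algebra.add)
  next
    case (mult f g)
    then have "partial i (\<lambda>p. f p * g p) = (\<lambda>p. f p * partial i g p + partial i f p * g p)" for i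
      by (auto simp: partial_mult)
    with mult show ?case
      by (auto intro!: generated_algebra.intros(2,3) differentiable_mult)
  qed
  have "partials is h \<in> generated_algebra B" if "h \<in> generated_algebra B" for "is" h
    using that by (induction "is" arbitrary: h rule: rev_induct) (use step in auto)
  with f step show ?thesis
    unfolding smooth_on_def by blast
qed

lemma smooth_on_partial: "smooth_on V f \<Longrightarrow> smooth_on V (partial i f)"
  unfolding smooth_on_def by (metis partials_simps(2))

lemma generated_algebra_smooth:
  "f \<in> generated_algebra {f. smooth_on UNIV f} \<Longrightarrow> smooth_on UNIV f"
  by (rule smooth_on_generated_algebra[where B = "{f. smooth_on UNIV f}"])
     (auto intro: generated_algebra.base smooth_on_partial dest: smooth_on_imp)

lemma smooth_on_add:
  "smooth_on UNIV f \<Longrightarrow> smooth_on UNIV g \<Longrightarrow> smooth_on UNIV (\<lambda>p. f p + g p)"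
  and smooth_on_mult:
  "smooth_on UNIV f \<Longrightarrow> smooth_on UNIV g \<Longrightarrow> smooth_on UNIV (\<lambda>p. f p * g p)"
  by (rule generated_algebra_smooth, rule generated_algebra.intros(2,3);
      simp add: generated_algebra.base)+

lemma smooth_on_const [simp]: "smooth_on UNIV (\<lambda>p. c)"
proof (rule smooth_on_generated_algebra)
  have "partial i (\<lambda>p. c) = (\<lambda>p. 0)" for i c
    by (rule ext, rule partial_eqI) auto
  then show "partial i f \<in> generated_algebra (range (\<lambda>c p. c))"
    if "f \<in> range (\<lambda>c p. c)" for f i
    using that by (auto intro: generated_algebra.base)
qed (auto intro: generated_algebra.base)

lemma smooth_on_minus: "smooth_on UNIV f \<Longrightarrow> smooth_on UNIV (\<lambda>p. - f p)"
  using smooth_on_mult[OF smooth_on_const[of "-1"], of f] by simp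

lemma smooth_on_cnj:
  assumes "smooth_on UNIV f"
  shows "smooth_on UNIV (\<lambda>p. cnj (f p))"
proof (rule smooth_on_generated_algebra)
  let ?B = "{\<lambda>p. cnj (f p) | f. smooth_on UNIV f}"
  show "(\<lambda>p. cnj (f p)) \<in> generated_algebra ?B"
    using assms by (auto intro: generated_algebra.base)
  fix g assume "g \<in> ?B"
  then obtain h where h: "g = (\<lambda>p. cnj (h p))" "smooth_on UNIV h" by auto
  note d = smooth_on_imp(1)[OF h(2) UNIV_I]
  show "g differentiable (at p)" for p
    unfolding h(1) by (intro differentiable_cnj d)
  show "partial i g \<in> generated_algebra ?B" for i
  proof (rule generated_algebra.base)
    have "partial i g = (\<lambda>p. cnj (partial i h p))"
      unfolding h(1) by (simp add: fun_eq_iff partial_cnj[OF d])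
    then show "partial i g \<in> ?B"
      using smooth_on_partial[OF h(2)] by blast
  qed
qed

lemma smooth_on_sum:
  "(\<And>i. i \<in> I \<Longrightarrow> smooth_on UNIV (f i)) \<Longrightarrow> smooth_on UNIV (\<lambda>p. \<Sum>i\<in>I. f i p)"
  by (induction I rule: infinite_finite_induct) (auto intro: smooth_on_add)

lemma smooth_on_prod:
  "(\<And>i. i \<in> I \<Longrightarrow> smooth_on UNIV (f i)) \<Longrightarrow> smooth_on UNIV (\<lambda>p. \<Prod>i\<in>I. f i p)"
  by (induction I rule: infinite_finite_induct) (auto intro: smooth_on_mult)

lemma smooth_on_power:
  "smooth_on UNIV f \<Longrightarrow> smooth_on UNIV (\<lambda>p. f p ^ n)"
  by (induction n) (auto intro: smooth_on_mult)

lemma smooth_on_coordinate: "smooth_on UNIV (\<lambda>p. of_real (p $ j))"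
proof (rule smooth_on_generated_algebra)
  let ?B = "{\<lambda>p. of_real (p $ j), \<lambda>p. 1, \<lambda>p. 0} :: (real^'a \<Rightarrow> complex) set"
  have d: "((\<lambda>x. of_real x :: complex) has_vector_derivative 1) (at x)" for x
    by (auto intro!: derivative_eq_intros)
  have c: "partial i (\<lambda>p. c) = (\<lambda>p. 0)" for i c
    by (rule ext, rule partial_eqI) auto
  have e: "partial i (\<lambda>p. of_real (p $ j)) = (if i = j then (\<lambda>p. 1) else (\<lambda>p. 0))" for i
    by (auto simp: partial_coordinate(1)[OF d])
  show "f differentiable (at p)" if "f \<in> ?B" for f p
    using that partial_coordinate(2)[OF d] by auto
  show "partial i f \<in> generated_algebra ?B" if "f \<in> ?B" for f i
    using that c e by (auto intro: generated_algebra.base)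
qed (auto intro: generated_algebra.base)

lemma smooth_on_continuous_on:
  "smooth_on V f \<Longrightarrow> continuous_on V f"
  using smooth_on_imp(1)
  by (metis continuous_at_imp_continuous_on differentiable_imp_continuous_within)

lemma not_in_support: "p \<notin> support f \<Longrightarrow> f p = 0"
  using closure_subset[of "{p. f p \<noteq> 0}"] by (auto simp: support_def)

lemma support_minimal:
  assumes "\<And>p. p \<notin> K \<Longrightarrow> f p = 0" "closed K"
  shows "support f \<subseteq> K"
  unfolding support_def by (rule closure_minimal) (use assms in auto)

lemma partial_cong:
  assumes "open V" "p \<in> V" "\<And>q. q \<in> V \<Longrightarrow> f q = g q"
  shows "partial i f p = partial i g p"
proof -
  let ?S = "(\<lambda>h. p + h *\<^sub>R axis i 1) -` V"
  have "open ?S"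
    using assms(1) by (intro open_vimage continuous_intros)
  moreover have "0 \<in> ?S" using assms(2) by simp
  ultimately have "((\<lambda>h. f (p + h *\<^sub>R axis i 1)) has_vector_derivative D) (at 0) \<longleftrightarrow>
      ((\<lambda>h. g (p + h *\<^sub>R axis i 1)) has_vector_derivative D) (at 0)" for D
    using assms(3)
    by (auto intro: has_vector_derivative_transform_within_open[of _ _ _ ?S])
  then show ?thesis
    by (simp add: partial_def vector_derivative_def)
qed

lemma partial_not_in_support: "p \<notin> support f \<Longrightarrow> partial i f p = 0"
proof -
  assume p: "p \<notin> support f"
  have "partial i f p = partial i (\<lambda>q. 0) p"
    by (rule partial_cong[of "- support f"]) (use p not_in_support in \<open>auto simp: support_def\<close>)
  also have "\<dots> = 0" by (rule partial_eqI) auto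
  finally show ?thesis .
qed

lemma test_functions_subset:
  assumes "\<phi> \<in> test_functions V" "smooth_on UNIV \<psi>" "\<And>p. p \<notin> support \<phi> \<Longrightarrow> \<psi> p = 0"
  shows "\<psi> \<in> test_functions V" "support \<psi> \<subseteq> support \<phi>"
proof -
  show s: "support \<psi> \<subseteq> support \<phi>"
    by (rule support_minimal) (use assms in \<open>auto simp: support_def[of \<phi>]\<close>)
  have "compact (support \<phi> \<inter> support \<psi>)"
    using assms by (intro compact_Int_closed) (auto simp: test_functions_def support_def[of \<psi>])
  with s have "compact (support \<psi>)" by (simp add: Int_absorb1)
  with s assms show "\<psi> \<in> test_functions V"
    by (auto simp: test_functions_def)
qed

lemma test_functions_partial:
  "\<phi> \<in> test_functions V \<Longrightarrow> partial i \<phi> \<in> test_functions V"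
  by (rule test_functions_subset)
     (auto simp: partial_not_in_support test_functions_def intro: smooth_on_partial)

lemma test_functions_mult:
  "\<phi> \<in> test_functions V \<Longrightarrow> smooth_on UNIV a \<Longrightarrow> (\<lambda>p. a p * \<phi> p) \<in> test_functions V"
  by (rule test_functions_subset)
     (auto simp: not_in_support test_functions_def intro: smooth_on_mult)

lemma test_functions_mono: "V \<subseteq> W \<Longrightarrow> test_functions V \<subseteq> test_functions W"
  by (auto simp: test_functions_def)

lemma test_functions_sum:
  assumes "\<And>i. i \<in> I \<Longrightarrow> f i \<in> test_functions V" "finite I"
  shows "(\<lambda>p. \<Sum>i\<in>I. f i p) \<in> test_functions V"
proof -
  let ?K = "\<Union>i\<in>I. support (f i)"
  have K: "compact ?K" "?K \<subseteq> V"
    using assms by (auto simp: test_functions_def)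
  have "f i p = 0" if "i \<in> I" "p \<notin> ?K" for i p
    using that not_in_support by blast
  then have s: "support (\<lambda>p. \<Sum>i\<in>I. f i p) \<subseteq> ?K"
    by (intro support_minimal) (use K in \<open>auto intro: compact_imp_closed\<close>)
  have "compact (?K \<inter> support (\<lambda>p. \<Sum>i\<in>I. f i p))"
    by (intro compact_Int_closed K) (simp add: support_def)
  with s have "compact (support (\<lambda>p. \<Sum>i\<in>I. f i p))" by (simp add: Int_absorb1)
  with s K assms show ?thesis
    by (auto simp: test_functions_def intro: smooth_on_sum)
qed

lemma integrable_compact_support:
  fixes f :: "'a::euclidean_space \<Rightarrow> 'b::{banach, second_countable_topology}"
  assumes "compact K" "continuous_on K f" "\<And>p. p \<notin> K \<Longrightarrow> f p = 0"
  shows "integrable lborel f"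
proof -
  have "integrable lborel (\<lambda>p. indicator K p *\<^sub>R f p)"
    using borel_integrable_compact[OF assms(1,2)] by (simp add: set_integrable_def)
  also have "(\<lambda>p. indicator K p *\<^sub>R f p) = f"
    using assms(3) by (auto simp: indicator_def fun_eq_iff)
  finally show ?thesis .
qed


section \<open>Bump functions\<close>

text \<open>The family is indexed by a power of \<open>1 / x\<close> because differentiation leads from \<open>flat n\<close> to
  \<open>flat (n + 1)\<close> and \<open>flat (n + 2)\<close>.\<close>

definition flat :: "nat \<Rightarrow> real \<Rightarrow> real"
  where "flat n x = (if x > 0 then exp (- 1 / x) / x ^ n else 0)"

lemma flat_tendsto_0: "(flat n \<longlongrightarrow> 0) (at 0)"
proof -
  have "((\<lambda>x::real. inverse x ^ n / exp (inverse x)) \<longlongrightarrow> 0) (at_right 0)"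
    by (rule filterlim_compose[OF tendsto_power_div_exp_0 filterlim_inverse_at_top_right])
  then have "(flat n \<longlongrightarrow> 0) (at_right 0)"
    by (rule Lim_transform_eventually)
       (auto simp: eventually_at_filter flat_def divide_simps exp_minus)
  moreover have "(flat n \<longlongrightarrow> 0) (at_left 0)"
    by (rule tendsto_eventually) (auto simp: eventually_at_filter flat_def)
  ultimately show ?thesis
    by (simp add: filterlim_at_split)
qed

lemma flat_has_derivative:
  "(flat n has_real_derivative flat (n + 2) x - of_nat n * flat (n + 1) x) (at x)"
proof -
  consider "x > 0" | "x = 0" | "x < 0" by linarith
  then show ?thesis
  proof cases
    case 1
    have "((\<lambda>x. exp (- 1 / x) / x ^ n) has_real_derivative
        flat (n + 2) x - of_nat n * flat (n + 1) x) (at x)"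
      using 1 by (auto intro!: derivative_eq_intros simp: flat_def)
        (cases n; simp add: field_simps power2_eq_square)
    then show ?thesis
      by (rule has_field_derivative_transform_within_open[where S = "{0<..}"])
        (use 1 in \<open>auto simp: flat_def\<close>)
  next
    case 2
    have "((\<lambda>h. (flat n h - flat n 0) / (h - 0)) \<longlongrightarrow> 0) (at 0)"
      using flat_tendsto_0[of "Suc n"]
      by (rule Lim_transform_eventually) (auto simp: eventually_at_filter flat_def)
    then show ?thesis
      unfolding has_field_derivative_iff 2 by (simp add: flat_def)
  next
    case 3
    have "((\<lambda>x. 0) has_real_derivative flat (n + 2) x - of_nat n * flat (n + 1) x) (at x)"
      using 3 by (simp add: flat_def)
    then show ?thesis
      by (rule has_field_derivative_transform_within_open[where S = "{..<0}"])
        (use 3 in \<open>auto simp: flat_def\<close>)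
  qed
qed

lemma smooth_on_flat:
  "smooth_on UNIV (\<lambda>p::real^'n::finite. complex_of_real (flat n (a * p $ j + b)))"
proof (rule smooth_on_generated_algebra)
  let ?F = "\<lambda>n (p::real^'n). complex_of_real (flat n (a * p $ j + b))"
  let ?B = "range ?F \<union> range (\<lambda>c p. c)"
  have "((\<lambda>x. a * x + b) has_real_derivative a) (at x)" for x
    by (auto intro!: derivative_eq_intros)
  then have "((\<lambda>x. flat n (a * x + b)) has_real_derivative
      (flat (n + 2) (a * x + b) - of_nat n * flat (n + 1) (a * x + b)) * a) (at x)" for n x
    by (rule DERIV_chain2[OF flat_has_derivative])
  then have d: "((\<lambda>x. complex_of_real (flat n (a * x + b))) has_vector_derivative
      of_real ((flat (n + 2) (a * x + b) - of_nat n * flat (n + 1) (a * x + b)) * a)) (at x)" for n x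
    using has_vector_derivative_of_real has_real_derivative_iff_has_vector_derivative by blast
  have c: "partial i (\<lambda>p::real^'n. c) = (\<lambda>p. 0)" for i c
    by (rule ext, rule partial_eqI) auto
  have A: "?F n \<in> generated_algebra ?B" "(\<lambda>p. c) \<in> generated_algebra ?B" for n c
    by (auto intro: generated_algebra.base)
  have "(\<lambda>p. (?F (n + 2) p + (- of_nat n) * ?F (n + 1) p) * of_real a) \<in> generated_algebra ?B" for n
    by (intro A generated_algebra.intros(2,3))
  moreover have "partial j (?F n) = (\<lambda>p. (?F (n + 2) p + (- of_nat n) * ?F (n + 1) p) * of_real a)" for n
    by (rule ext) (simp add: partial_coordinate(1)[OF d])
  ultimately have "partial j (?F n) \<in> generated_algebra ?B" for n
    by (simp only:)
  moreover have "partial i (?F n) = (\<lambda>p. 0)" if "i \<noteq> j" for n i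
    using that by (simp add: fun_eq_iff partial_coordinate(1)[OF d])
  ultimately have "partial i (?F n) \<in> generated_algebra ?B" for n i
    using A(2)[of 0] by (cases "i = j") simp_all
  then show "partial i f \<in> generated_algebra ?B" if "f \<in> ?B" for f i
    using that A(2) c by auto
  show "f differentiable (at p)" if "f \<in> ?B" for f p
    using that partial_coordinate(2)[OF d] by auto
  show "?F n \<in> generated_algebra ?B" by (rule A)
qed

lemma exists_bump:
  fixes c :: "real^'n::finite"
  assumes "open V" "c \<in> V"
  obtains \<phi> :: "real^'n \<Rightarrow> real"
  where "(\<lambda>p. complex_of_real (\<phi> p)) \<in> test_functions V" "\<And>p. \<phi> p \<ge> 0" "\<phi> c > 0"
proof -
  obtain e where e: "e > 0" "cball c e \<subseteq> V"
    using assms open_contains_cball by blast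
  define d where "d = e / real CARD('n)"
  have d: "d > 0" using e by (simp add: d_def)
  define \<phi> where "\<phi> p = (\<Prod>i\<in>UNIV. flat 0 (1 * p $ i + (d - c $ i)) * flat 0 (- 1 * p $ i + (d + c $ i)))"
    for p :: "real^'n"
  have nn: "flat 0 x \<ge> 0" for x by (simp add: flat_def)
  have z: "\<phi> p = 0" if "p \<notin> cball c e" for p
  proof (rule ccontr)
    assume "\<phi> p \<noteq> 0"
    then have "flat 0 (1 * p $ i + (d - c $ i)) \<noteq> 0 \<and> flat 0 (- 1 * p $ i + (d + c $ i)) \<noteq> 0" for i
      by (auto simp: \<phi>_def)
    then have "1 * p $ i + (d - c $ i) > 0 \<and> - 1 * p $ i + (d + c $ i) > 0" for i
      unfolding flat_def by presburger
    then have "\<bar>(p - c) $ i\<bar> \<le> d" for i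
      by (simp add: abs_le_iff) (metis add_diff_eq add_uminus_conv_diff diff_gt_0_iff_gt less_eq_real_def diff_less_eq add.commute uminus_add_conv_diff)
    then have "norm (p - c) \<le> (\<Sum>i\<in>(UNIV::'n set). d)"
      by (intro order.trans[OF norm_le_l1_cart] sum_mono)
    with that show False
      by (simp add: d_def dist_norm norm_minus_commute)
  qed
  have s: "smooth_on UNIV (\<lambda>p. complex_of_real (\<phi> p))"
    unfolding \<phi>_def of_real_prod of_real_mult
    by (intro smooth_on_prod smooth_on_mult smooth_on_flat)
  have supp: "support (\<lambda>p. complex_of_real (\<phi> p)) \<subseteq> cball c e"
    using z by (intro support_minimal) auto
  then have "compact (cball c e \<inter> support (\<lambda>p. complex_of_real (\<phi> p)))"
    by (intro compact_Int_closed) (auto simp: support_def)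
  then have "compact (support (\<lambda>p. complex_of_real (\<phi> p)))"
    using supp by (simp add: Int_absorb1)
  then have "(\<lambda>p. complex_of_real (\<phi> p)) \<in> test_functions V"
    using s supp e by (auto simp: test_functions_def)
  moreover have "\<phi> p \<ge> 0" for p
    unfolding \<phi>_def by (intro prod_nonneg ballI mult_nonneg_nonneg nn)
  moreover have "\<phi> c > 0"
    unfolding \<phi>_def using d by (intro prod_pos) (auto simp: flat_def)
  ultimately show ?thesis using that by blast
qed

text \<open>Around a point \<open>c\<close> where \<open>f\<close> and \<open>g\<close> differ, the product of \<open>f - g\<close> with the conjugate of
  \<open>f c - g c\<close> has positive real part, and a bump function supported there detects it.\<close>

lemma fundamental_lemma:
  fixes f g :: "real^'n::finite \<Rightarrow> complex"
  assumes V: "open V" and f: "continuous_on V f" and g: "continuous_on V g"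
    and eq: "\<And>\<phi>. \<phi> \<in> test_functions V \<Longrightarrow> dist_of f \<phi> = dist_of g \<phi>"
    and c: "c \<in> V"
  shows "f c = g c"
proof (rule ccontr)
  assume ne: "f c \<noteq> g c"
  define r where "r p = Re (cnj (f c - g c) * (f p - g p))" for p
  have cr: "continuous_on V r"
    unfolding r_def by (intro continuous_intros f g)
  have rc: "r c > 0"
  proof -
    have "r c = Re (complex_of_real ((norm (f c - g c))\<^sup>2))"
      unfolding complex_norm_square r_def by (simp only: mult.commute)
    then show ?thesis using ne by simp
  qed
  define W where "W = {p \<in> V. r p > 0}"
  have "W = r -` {0<..} \<inter> V" by (auto simp: W_def)
  moreover have "open (r -` {0<..} \<inter> V)"
    using continuous_on_open_vimage[OF V, of r] cr open_greaterThan by blast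
  ultimately have W: "open W" "c \<in> W" "W \<subseteq> V"
    using rc c by (auto simp: W_def)
  obtain \<phi> where \<phi>: "(\<lambda>p. complex_of_real (\<phi> p)) \<in> test_functions W" "\<And>p. \<phi> p \<ge> 0" "\<phi> c > 0"
    using exists_bump[OF W(1,2)] by blast
  let ?\<phi> = "\<lambda>p. complex_of_real (\<phi> p)" and ?K = "support (\<lambda>p. complex_of_real (\<phi> p))"
  have K: "compact ?K" "?K \<subseteq> W"
    using \<phi>(1) by (auto simp: test_functions_def)
  have c\<phi>: "continuous_on UNIV \<phi>"
    using \<phi>(1) smooth_on_continuous_on[of UNIV ?\<phi>] by (simp add: test_functions_def)
  have KV: "?K \<subseteq> V" using K W by blast
  have i: "integrable lborel (\<lambda>p. h p * ?\<phi> p)" if "continuous_on V h" for h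
    by (rule integrable_compact_support[OF K(1)])
       (use that KV c\<phi> not_in_support[of _ ?\<phi>] in \<open>auto intro!: continuous_intros elim: continuous_on_subset\<close>)
  have "dist_of f ?\<phi> = dist_of g ?\<phi>"
    using eq \<phi>(1) test_functions_mono[OF W(3)] by blast
  then have "(LINT p|lborel. cnj (f c - g c) * (f p * ?\<phi> p - g p * ?\<phi> p)) = 0"
    unfolding dist_of_def using i[OF f] i[OF g]
    by (simp only: integral_mult_right_zero Bochner_Integration.integral_diff diff_self mult_zero_right)
  then have "Re (LINT p|lborel. cnj (f c - g c) * (f p * ?\<phi> p - g p * ?\<phi> p)) = 0"
    by (simp only: zero_complex.sel)
  moreover have ic: "integrable lborel (\<lambda>p. cnj (f c - g c) * (f p * ?\<phi> p - g p * ?\<phi> p))"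
    using i[OF f] i[OF g] by (intro integrable_mult_right Bochner_Integration.integrable_diff)
  moreover have e: "Re (cnj (f c - g c) * (f p * ?\<phi> p - g p * ?\<phi> p)) = r p * \<phi> p" for p
    by (simp add: r_def algebra_simps)
  ultimately have 0: "(LINT p|lborel. r p * \<phi> p) = 0" "integrable lborel (\<lambda>p. r p * \<phi> p)"
    using integral_Re[OF ic] integrable_Re[OF ic] by (simp_all only: e)
  have nn: "r p * \<phi> p \<ge> 0" for p
    using \<phi>(2)[of p] K(2) not_in_support[of p ?\<phi>]
    by (cases "p \<in> ?K") (auto simp: W_def subset_eq intro!: mult_nonneg_nonneg intro: less_imp_le)
  have "AE p in lborel. r p * \<phi> p = 0"
    using 0 nn by (subst (asm) integral_nonneg_eq_0_iff_AE) auto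
  moreover
  define O' where "O' = {p \<in> W. \<phi> p > 0}"
  have "continuous_on W \<phi>"
    using continuous_on_subset[OF c\<phi>] by blast
  then have "open (\<phi> -` {0<..} \<inter> W)"
    using continuous_on_open_vimage[OF W(1), of \<phi>] open_greaterThan by blast
  moreover have "\<phi> -` {0<..} \<inter> W = O'" by (auto simp: O'_def)
  ultimately have "open O'" "AE p in lborel. p \<notin> O'"
    by (auto simp: O'_def W_def elim!: eventually_mono)
  then have "O' \<in> null_sets lborel"
    by (subst AE_iff_null_sets) auto
  moreover have "O' \<noteq> {}" using W(2) \<phi>(3) by (auto simp: O'_def)
  ultimately show False
    using \<open>open O'\<close> open_not_negligible
    by (metis completion.null_sets_outer negligible_iff_null_sets null_sets_completionI)
qed


section \<open>The bracket condition\<close>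

declare vector_3 [simp]

text \<open>Bracketing with \<open>Z1\<close> differentiates the coefficients in \<open>x\<close> and feeds the first component
  into the second.\<close>

lemma bracket_Z1:
  "vf_bracket Z1 (\<lambda>p. vector [a * of_real (p $ 1) ^ m, \<i> * b * of_real (p $ 1) ^ n, 0]) =
    (\<lambda>p. vector [a * of_nat m * of_real (p $ 1) ^ (m - 1),
       \<i> * (b * of_nat n * of_real (p $ 1) ^ (n - 1) + a * of_real (p $ 1) ^ m), 0])"
proof -
  have z: "partial i (\<lambda>q. c) p = 0" for i c and p :: "real^3"
    by (rule partial_eqI) auto
  have l: "partial i (\<lambda>q::real^3. - (\<i> * of_real (q $ 1))) p = (if i = 1 then - \<i> else 0)" for i p
    using partial_monomial[of i "- \<i>" 1 1 p] by simp
  show ?thesis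
    unfolding vf_bracket_def vf_apply_def Z1_def
    by (auto simp: fun_eq_iff vec_eq_iff forall_3 sum_3 z l partial_monomial)
      (simp_all add: algebra_simps)
qed

text \<open>The inequalities between the coefficients record that all contributions to the
  \<open>\<partial>\<^sub>t\<close>-component have the same sign, so that they cannot cancel in the last bracket.\<close>

lemma bracket_Z1_iterate:
  assumes "j \<le> k"
  shows "\<exists>a b :: nat. 1 \<le> a \<and> a \<le> b \<and>
    (\<lambda>p. vector [of_nat a * of_real (p $ 1) ^ (k - j),
       \<i> * of_nat b * of_real (p $ 1) ^ (k - j + 1), 0]) \<in> lie_algebra_generated {Z1, Z2 k, Z3}"
  using assms
proof (induction j)
  case 0
  have "Z2 k = (\<lambda>p. vector [of_nat 1 * of_real (p $ 1) ^ (k - 0),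
       \<i> * of_nat 1 * of_real (p $ 1) ^ (k - 0 + 1), 0])"
    by (auto simp: fun_eq_iff vec_eq_iff forall_3 Z2_def vector_scalar_mult_def)
  moreover have "Z2 k \<in> lie_algebra_generated {Z1, Z2 k, Z3}"
    by (intro lie_algebra_generated.generator) auto
  ultimately show ?case by (intro exI[of _ 1]) simp
next
  case (Suc j)
  then obtain a b :: nat where ab: "1 \<le> a" "a \<le> b" and
    mem: "(\<lambda>p. vector [of_nat a * of_real (p $ 1) ^ (k - j),
       \<i> * of_nat b * of_real (p $ 1) ^ (k - j + 1), 0]) \<in> lie_algebra_generated {Z1, Z2 k, Z3}"
    by auto
  define m where "m = k - Suc j"
  have m: "k - j = Suc m" using Suc.prems by (simp add: m_def)
  have "vf_bracket Z1 (\<lambda>p. vector [of_nat a * of_real (p $ 1) ^ (k - j),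
       \<i> * of_nat b * of_real (p $ 1) ^ (k - j + 1), 0]) \<in> lie_algebra_generated {Z1, Z2 k, Z3}"
    by (intro lie_algebra_generated.bracket mem lie_algebra_generated.generator) auto
  also have "vf_bracket Z1 (\<lambda>p. vector [of_nat a * of_real (p $ 1) ^ (k - j),
       \<i> * of_nat b * of_real (p $ 1) ^ (k - j + 1), 0]) =
     (\<lambda>p. vector [of_nat (a * Suc m) * of_real (p $ 1) ^ m,
       \<i> * of_nat (b * (m + 2) + a) * of_real (p $ 1) ^ (m + 1), 0])"
    unfolding bracket_Z1 m by (simp add: algebra_simps)
  finally have "(\<lambda>p. vector [of_nat (a * Suc m) * of_real (p $ 1) ^ m,
       \<i> * of_nat (b * (m + 2) + a) * of_real (p $ 1) ^ (m + 1), 0]) \<in> lie_algebra_generated {Z1, Z2 k, Z3}" .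
  moreover have "1 \<le> a * Suc m" using ab by simp
  moreover have "a * Suc m \<le> b * (m + 2) + a"
    using mult_mono[of a b "Suc m" "m + 2"] ab by linarith
  ultimately show ?case unfolding m_def by blast
qed

text \<open>The constant field \<open>\<partial>\<^sub>t\<close>, obtained from \<open>k + 1\<close> brackets, completes \<open>Z1\<close> and \<open>Z3\<close> to a
  frame at every point, on and off the plane \<open>x = 0\<close> alike.\<close>

lemma bracket_condition_Z: "bracket_condition {Z1, Z2 k, Z3} p"
proof -
  let ?L = "lie_algebra_generated {Z1, Z2 k, Z3}"
  obtain a b :: nat where ab: "1 \<le> a" "a \<le> b" and
    mem: "(\<lambda>p. vector [of_nat a * of_real (p $ 1) ^ (k - k),
       \<i> * of_nat b * of_real (p $ 1) ^ (k - k + 1), 0]) \<in> ?L"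
    using bracket_Z1_iterate[of k k] by auto
  have "vf_bracket Z1 (\<lambda>p. vector [of_nat a * of_real (p $ 1) ^ (k - k),
       \<i> * of_nat b * of_real (p $ 1) ^ (k - k + 1), 0]) \<in> ?L"
    by (intro lie_algebra_generated.bracket mem lie_algebra_generated.generator) auto
  then have T: "(\<lambda>p. vector [0, \<i> * of_nat (a + b), 0]) \<in> ?L"
    unfolding bracket_Z1 by (simp add: algebra_simps)
  let ?S = "{Z p | Z. Z \<in> ?L}"
  have S: "Z1 p \<in> vec.span ?S" "Z3 p \<in> vec.span ?S" "vector [0, \<i> * of_nat (a + b), 0] \<in> vec.span ?S"
    using T by (auto intro!: vec.span_base intro: lie_algebra_generated.generator)
  have "v \<in> vec.span ?S" for v :: "complex^3"
  proof -
    let ?c = "(v $ 2 + v $ 1 * \<i> * of_real (p $ 1)) / (\<i> * of_nat (a + b))"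
    have "v $ 1 *s Z1 p + ?c *s vector [0, \<i> * of_nat (a + b), 0] + v $ 3 *s Z3 p \<in> vec.span ?S"
      by (intro vec.span_add vec.span_scale S)
    also have "v $ 1 *s Z1 p + ?c *s vector [0, \<i> * of_nat (a + b), 0] + v $ 3 *s Z3 p = v"
      using ab by (auto simp: vec_eq_iff forall_3 Z1_def Z3_def simp flip: of_nat_add)
    finally show ?thesis .
  qed
  then show ?thesis
    unfolding bracket_condition_def by blast
qed


section \<open>Plancherel's identity\<close>

lemma lborel_integral_affine:
  fixes g :: "'a::euclidean_space \<Rightarrow> 'b::{banach, second_countable_topology}"
  assumes c: "c \<noteq> 0" and g: "integrable lborel g"
  shows "integrable lborel (\<lambda>x. g (t + c *\<^sub>R x))"
    "(LINT x|lborel. g x) = \<bar>c\<bar> ^ DIM('a) *\<^sub>R (LINT x|lborel. g (t + c *\<^sub>R x))"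
proof -
  have m: "g \<in> borel_measurable borel" using g by auto
  let ?D = "distr lborel borel (\<lambda>x::'a. t + c *\<^sub>R x)"
  have L: "(lborel :: 'a measure) = density ?D (\<lambda>_. ennreal (\<bar>c\<bar> ^ DIM('a)))"
    using lborel_affine[OF c, of t] by simp
  have "integrable (density ?D (\<lambda>_. ennreal (\<bar>c\<bar> ^ DIM('a)))) g"
    using g L by simp
  then have "integrable ?D (\<lambda>x. \<bar>c\<bar> ^ DIM('a) *\<^sub>R g x)"
    using m by (subst (asm) integrable_density) auto
  then have "integrable ?D (\<lambda>x. (1 / \<bar>c\<bar> ^ DIM('a)) *\<^sub>R \<bar>c\<bar> ^ DIM('a) *\<^sub>R g x)"
    by (rule integrable_scaleR_right)
  moreover have "(\<lambda>x. (1 / \<bar>c\<bar> ^ DIM('a)) *\<^sub>R \<bar>c\<bar> ^ DIM('a) *\<^sub>R g x) = g"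
    using c by (simp add: fun_eq_iff)
  ultimately have "integrable ?D g" by (simp only:)
  then show "integrable lborel (\<lambda>x. g (t + c *\<^sub>R x))"
    by (rule integrable_distr[rotated]) measurable
  have "(LINT x|lborel. g x) = (LINT x|density ?D (\<lambda>_. ennreal (\<bar>c\<bar> ^ DIM('a))). g x)"
    using L by simp
  also have "\<dots> = (LINT x|?D. \<bar>c\<bar> ^ DIM('a) *\<^sub>R g x)"
    using m by (subst integral_density) auto
  also have "\<dots> = (LINT x|lborel. \<bar>c\<bar> ^ DIM('a) *\<^sub>R g (t + c *\<^sub>R x))"
    using m by (subst integral_distr) auto
  finally show "(LINT x|lborel. g x) = \<bar>c\<bar> ^ DIM('a) *\<^sub>R (LINT x|lborel. g (t + c *\<^sub>R x))"
    by simp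
qed

lemma lborel_integral_prod_Basis:
  fixes g :: "'a::euclidean_space \<Rightarrow> real \<Rightarrow> complex"
  assumes g: "\<And>b. b \<in> Basis \<Longrightarrow> integrable lborel (g b)"
  shows "integrable lborel (\<lambda>x. \<Prod>b\<in>Basis. g b (x \<bullet> b))"
    "(LINT x|lborel. (\<Prod>b\<in>Basis. g b (x \<bullet> b))) = (\<Prod>b\<in>Basis. (LINT t|lborel. g b t))"
proof -
  interpret product_sigma_finite "\<lambda>b::'a. lborel :: real measure" ..
  let ?P = "\<Pi>\<^sub>M b\<in>(Basis::'a set). (lborel::real measure)"
  let ?s = "\<lambda>f. \<Sum>b\<in>(Basis::'a set). f b *\<^sub>R b"
  have m [measurable]: "g b \<in> borel_measurable borel" if "b \<in> Basis" for b
    using g[OF that] by auto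
  have s [measurable]: "?s \<in> measurable ?P borel"
    by measurable
  have G: "(\<lambda>x. \<Prod>b\<in>Basis. g b (x \<bullet> b)) \<in> borel_measurable borel"
    by measurable
  have e: "(\<Prod>b\<in>Basis. g b (?s f \<bullet> b)) = (\<Prod>b\<in>Basis. g b (f b))" for f
    by (intro prod.cong refl) simp
  show "integrable lborel (\<lambda>x. \<Prod>b\<in>Basis. g b (x \<bullet> b))"
    unfolding lborel_eq[where 'a='a] using product_integrable_prod[OF finite_Basis g]
    by (subst integrable_distr_eq[OF s G]) (simp only: e)
  show "(LINT x|lborel. (\<Prod>b\<in>Basis. g b (x \<bullet> b))) = (\<Prod>b\<in>Basis. (LINT t|lborel. g b t))"
    unfolding lborel_eq[where 'a='a] using product_integral_prod[OF finite_Basis g]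
    by (subst integral_distr[OF s G]) (simp only: e)
qed

definition gaussian :: "'a::euclidean_space \<Rightarrow> real"
  where "gaussian z = (1 / sqrt (2 * pi)) ^ DIM('a) * exp (- (norm z)\<^sup>2 / 2)"

lemma exp_norm_square_prod:
  fixes z :: "'a::euclidean_space"
  shows "exp (- (norm z)\<^sup>2 / 2) = (\<Prod>b\<in>Basis. exp (- (z \<bullet> b)\<^sup>2 / 2))"
proof -
  have "(norm z)\<^sup>2 = (\<Sum>b\<in>Basis. (z \<bullet> b)\<^sup>2)"
    unfolding power2_norm_eq_inner by (subst euclidean_inner) (simp add: power2_eq_square)
  then have "- (norm z)\<^sup>2 / 2 = (\<Sum>b\<in>Basis. - (z \<bullet> b)\<^sup>2 / 2)"
    by (simp add: sum_negf sum_divide_distrib)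
  then show ?thesis
    by (simp only: exp_sum finite_Basis)
qed

lemma gaussian_prod: "gaussian z = (\<Prod>b\<in>Basis. std_normal_density (z \<bullet> b))"
  unfolding gaussian_def exp_norm_square_prod std_normal_density_def prod.distrib prod_constant ..

lemma gaussian_fourier:
  fixes w :: "'a::euclidean_space"
  shows "integrable lborel (\<lambda>z::'a. exp (- (\<i> * of_real (w \<bullet> z))) * of_real (gaussian z))"
    "(LINT z|lborel. exp (- (\<i> * of_real (w \<bullet> z))) * of_real (gaussian z)) =
      of_real (exp (- (norm w)\<^sup>2 / 2))"
proof -
  let ?g = "\<lambda>b t. exp (- (\<i> * of_real (w \<bullet> b * t))) * complex_of_real (std_normal_density t)"
  have i: "integrable lborel (?g b)" for b
  proof (rule Bochner_Integration.integrable_bound)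
    show "integrable lborel (\<lambda>t. std_normal_density t)" by auto
    show "AE t in lborel. norm (?g b t) \<le> norm (std_normal_density t)"
      by (simp add: norm_mult)
  qed measurable
  have v: "(LINT t|lborel. ?g b t) = of_real (exp (- (w \<bullet> b)\<^sup>2 / 2))" for b
  proof -
    have "char std_normal_distribution (- (w \<bullet> b)) =
        (LINT t|lborel. std_normal_density t *\<^sub>R iexp (- (w \<bullet> b) * t))"
      unfolding char_def by (subst integral_density) auto
    also have "\<dots> = (LINT t|lborel. ?g b t)"
      by (simp add: scaleR_conv_of_real mult.commute)
    finally show ?thesis
      by (simp add: char_std_normal_distribution)
  qed
  have "exp (- (\<i> * of_real (w \<bullet> z))) * of_real (gaussian z) = (\<Prod>b\<in>Basis. ?g b (z \<bullet> b))" for z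
  proof -
    have "- (\<i> * complex_of_real (w \<bullet> z)) = (\<Sum>b\<in>Basis. - (\<i> * of_real (w \<bullet> b * (z \<bullet> b))))"
      by (subst euclidean_inner) (simp add: sum_distrib_left sum_negf)
    then show ?thesis
      by (simp add: exp_sum gaussian_prod prod.distrib)
  qed
  moreover have "(\<Prod>b\<in>Basis. complex_of_real (exp (- (w \<bullet> b)\<^sup>2 / 2))) = of_real (exp (- (norm w)\<^sup>2 / 2))"
    by (simp only: exp_norm_square_prod of_real_prod)
  ultimately show "integrable lborel (\<lambda>z::'a. exp (- (\<i> * of_real (w \<bullet> z))) * of_real (gaussian z))"
    "(LINT z|lborel. exp (- (\<i> * of_real (w \<bullet> z))) * of_real (gaussian z)) =
      of_real (exp (- (norm w)\<^sup>2 / 2))"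
    using lborel_integral_prod_Basis[of ?g, OF i] v by simp_all
qed

lemma integrable_gaussian: "integrable lborel (gaussian :: 'a::euclidean_space \<Rightarrow> real)"
  and integral_gaussian: "(LINT z|lborel. gaussian (z::'a)) = 1"
proof -
  have i: "integrable lborel (\<lambda>z::'a. complex_of_real (gaussian z))"
    and v: "(LINT z|lborel. complex_of_real (gaussian (z::'a))) = 1"
    using gaussian_fourier[of "0::'a"] by simp_all
  show "integrable lborel (gaussian :: 'a \<Rightarrow> real)"
    using integrable_Re[OF i] by simp
  show "(LINT z|lborel. gaussian (z::'a)) = 1"
    using v by (metis integral_complex_of_real of_real_eq_1_iff)
qed

lemma scaled_gaussian_fourier:
  fixes w :: "'a::euclidean_space"
  assumes e: "e > 0"
  shows "integrable lborel (\<lambda>\<xi>::'a. exp (- (\<i> * of_real (w \<bullet> \<xi>))) * of_real (exp (- (norm (e *\<^sub>R \<xi>))\<^sup>2 / 2)))"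
    "(LINT \<xi>|lborel. exp (- (\<i> * of_real (w \<bullet> \<xi>))) * of_real (exp (- (norm (e *\<^sub>R \<xi>))\<^sup>2 / 2))) =
      of_real ((2 * pi / e) ^ DIM('a) * gaussian (w /\<^sub>R e))"
proof -
  let ?c = "sqrt (2 * pi) ^ DIM('a)"
  have c: "?c \<noteq> 0" by simp
  let ?f = "\<lambda>z::'a. exp (- (\<i> * of_real ((w /\<^sub>R e) \<bullet> z))) * of_real (gaussian z)"
  have i: "(w /\<^sub>R e) \<bullet> (0 + e *\<^sub>R \<xi>) = w \<bullet> \<xi>" for \<xi>
    using e by simp
  have eq: "?f (0 + e *\<^sub>R \<xi>) * of_real ?c =
      exp (- (\<i> * of_real (w \<bullet> \<xi>))) * of_real (exp (- (norm (e *\<^sub>R \<xi>))\<^sup>2 / 2))" for \<xi>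
    unfolding i using c by (simp add: gaussian_def power_divide)
  note * = lborel_integral_affine[of e, OF _ gaussian_fourier(1)[of "w /\<^sub>R e"], of 0]
  show "integrable lborel (\<lambda>\<xi>::'a. exp (- (\<i> * of_real (w \<bullet> \<xi>))) * of_real (exp (- (norm (e *\<^sub>R \<xi>))\<^sup>2 / 2)))"
    unfolding eq[symmetric] using *(1) e by (intro integrable_mult_left) auto
  let ?G = "exp (- (norm (w /\<^sub>R e))\<^sup>2 / 2)"
  have "of_real ?G = e ^ DIM('a) *\<^sub>R (LINT \<xi>|lborel. ?f (0 + e *\<^sub>R \<xi>))"
    using *(2) e unfolding gaussian_fourier(2) by simp
  then have I: "(LINT \<xi>|lborel. ?f (0 + e *\<^sub>R \<xi>)) = of_real (?G / e ^ DIM('a))"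
    using e by (simp add: scaleR_conv_of_real eq_divide_eq mult.commute)
  have "(2 * pi) ^ DIM('a) = ?c * ?c"
    by (subst power_mult_distrib[symmetric]) simp
  then have "(2 * pi / e) ^ DIM('a) * gaussian (w /\<^sub>R e) = ?c * ?c / e ^ DIM('a) * (1 / ?c * ?G)"
    unfolding gaussian_def power_divide power_one by simp
  also have "\<dots> = ?G / e ^ DIM('a) * ?c"
    using c by simp
  finally show "(LINT \<xi>|lborel. exp (- (\<i> * of_real (w \<bullet> \<xi>))) * of_real (exp (- (norm (e *\<^sub>R \<xi>))\<^sup>2 / 2))) =
      of_real ((2 * pi / e) ^ DIM('a) * gaussian (w /\<^sub>R e))"
    unfolding eq[symmetric] integral_mult_left_zero I by simp
qed


text \<open>The Fourier transform of the autocorrelation of \<open>f\<close> is \<open>\<bar>f^\<bar>\<^sup>2\<close>, while its value at the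
  origin is the squared \<open>L\<^sup>2\<close> norm of \<open>f\<close>. Plancherel's identity thus becomes Fourier inversion at a
  single point.\<close>

definition autocorrelation :: "('a::euclidean_space \<Rightarrow> complex) \<Rightarrow> 'a \<Rightarrow> complex"
  where "autocorrelation f w = (LINT x|lborel. f x * cnj (f (x - w)))"

context
  fixes f :: "'a::euclidean_space \<Rightarrow> complex" and K :: "'a set"
  assumes cont: "continuous_on UNIV f" and K: "compact K" and zero: "\<And>x. x \<notin> K \<Longrightarrow> f x = 0"
begin

lemma integrable_twisted_product:
  assumes h: "continuous_on UNIV h"
  shows "integrable (lborel \<Otimes>\<^sub>M lborel) (\<lambda>(x, w). h w * (f x * cnj (f (x - w))))"
    "integrable lborel (\<lambda>x. h x * f x)"
proof -
  let ?M = "K \<times> (\<lambda>(x, y). x - y) ` (K \<times> K)"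
  have "compact ?M"
    by (intro compact_Times K compact_continuous_image) (auto intro!: continuous_intros simp: split_beta)
  moreover have "continuous_on UNIV (\<lambda>z::'a \<times> 'a. h (snd z) * (f (fst z) * cnj (f (fst z - snd z))))"
    by (intro continuous_intros continuous_on_compose2[OF cont] continuous_on_compose2[OF h]) auto
  moreover have "h (snd z) * (f (fst z) * cnj (f (fst z - snd z))) = 0" if "z \<notin> ?M" for z :: "'a \<times> 'a"
  proof (rule ccontr)
    assume "h (snd z) * (f (fst z) * cnj (f (fst z - snd z))) \<noteq> 0"
    then have *: "fst z \<in> K" "fst z - snd z \<in> K" using zero by auto
    then have "fst z - (fst z - snd z) \<in> (\<lambda>(x, y). x - y) ` (K \<times> K)"
      by (intro image_eqI[of _ _ "(fst z, fst z - snd z)"]) auto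
    with * that show False by (simp add: mem_Times_iff)
  qed
  ultimately have "integrable lborel (\<lambda>z::'a \<times> 'a. h (snd z) * (f (fst z) * cnj (f (fst z - snd z))))"
    by (intro integrable_compact_support[of ?M]) (auto intro: continuous_on_subset)
  then show "integrable (lborel \<Otimes>\<^sub>M lborel) (\<lambda>(x, w). h w * (f x * cnj (f (x - w))))"
    by (simp only: lborel_prod case_prod_unfold)
  show "integrable lborel (\<lambda>x. h x * f x)"
    by (rule integrable_compact_support[OF K])
       (auto intro!: continuous_intros simp: zero intro: continuous_on_subset[OF h] continuous_on_subset[OF cont])
qed

lemma autocorrelation_facts:
  shows "integrable lborel (autocorrelation f)" "autocorrelation f \<in> borel_measurable borel"
    "bounded (range (autocorrelation f))" "isCont (autocorrelation f) 0"
    "autocorrelation f 0 = of_real (LINT x|lborel. (norm (f x))\<^sup>2)"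
proof -
  have p: "integrable (lborel \<Otimes>\<^sub>M lborel) (\<lambda>(x, w). f x * cnj (f (x - w)))"
    using integrable_twisted_product(1)[of "\<lambda>_. 1"] by simp
  have i: "integrable lborel f"
    using integrable_twisted_product(2)[of "\<lambda>_. 1"] by simp
  have [measurable]: "f \<in> borel_measurable borel"
    using i by auto
  obtain B where B: "\<And>x. norm (f x) \<le> B"
  proof -
    have "bounded (f ` K)"
      by (intro compact_imp_bounded compact_continuous_image K continuous_on_subset[OF cont]) auto
    then obtain B where B: "\<And>x. x \<in> K \<Longrightarrow> norm (f x) \<le> B" "B > 0"
      unfolding bounded_pos by auto
    have "norm (f x) \<le> B" for x using B zero[of x] by (cases "x \<in> K") auto
    then show ?thesis by (rule that)
  qed
  have le: "norm (f x * cnj (f (x - w))) \<le> norm (f x) * B" for x w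
    unfolding norm_mult complex_mod_cnj by (intro mult_left_mono B norm_ge_zero)
  have iB: "integrable lborel (\<lambda>x. norm (f x) * B)"
    using i by (intro integrable_mult_left integrable_norm)
  show 1: "integrable lborel (autocorrelation f)"
    using lborel_pair.integrable_snd[of "\<lambda>x w. f x * cnj (f (x - w))"] p
    unfolding autocorrelation_def by simp
  then show "autocorrelation f \<in> borel_measurable borel" by auto
  have "norm (autocorrelation f w) \<le> (LINT x|lborel. norm (f x) * B)" for w
    unfolding autocorrelation_def
    by (rule order.trans[OF integral_norm_bound integral_mono'[OF iB le]]) (rule order.trans[OF norm_ge_zero le])
  then show "bounded (range (autocorrelation f))"
    by (auto intro!: boundedI)
  show "isCont (autocorrelation f) 0"
    unfolding continuous_at_sequentially
  proof (intro allI impI)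
    fix w assume w: "w \<longlonglongrightarrow> (0::'a)"
    have "(\<lambda>n. LINT x|lborel. f x * cnj (f (x - w n))) \<longlonglongrightarrow> (LINT x|lborel. f x * cnj (f (x - 0)))"
    proof (rule integral_dominated_convergence[OF _ _ iB])
      have "(\<lambda>n. f (x - w n)) \<longlonglongrightarrow> f (x - 0)" for x
        using cont w by (intro isCont_tendsto_compose[of _ f] tendsto_intros)
          (auto simp: continuous_on_eq_continuous_at)
      then show "AE x in lborel. (\<lambda>n. f x * cnj (f (x - w n))) \<longlonglongrightarrow> f x * cnj (f (x - 0))"
        by (intro AE_I2 tendsto_intros)
      show "AE x in lborel. norm (f x * cnj (f (x - w n))) \<le> norm (f x) * B" for n
        using le by simp
      have m: "(\<lambda>x. f x * cnj (f (x - c))) \<in> borel_measurable lborel" for c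
      proof -
        have "continuous_on UNIV (\<lambda>x. f x * cnj (f (x - c)))"
          by (intro continuous_intros cont continuous_on_compose2[OF cont]) auto
        then show ?thesis by (simp add: borel_measurable_continuous_onI)
      qed
      show "(\<lambda>x. f x * cnj (f (x - 0))) \<in> borel_measurable lborel"
        "(\<lambda>x. f x * cnj (f (x - w n))) \<in> borel_measurable lborel" for n
        by (rule m)+
    qed
    then show "(autocorrelation f \<circ> w) \<longlonglongrightarrow> autocorrelation f 0"
      by (simp add: autocorrelation_def o_def)
  qed
  show "autocorrelation f 0 = of_real (LINT x|lborel. (norm (f x))\<^sup>2)"
    unfolding autocorrelation_def integral_complex_of_real[symmetric] complex_norm_square by simp
qed

lemma norm_fourier_squared:
  "complex_of_real ((norm (LINT x|lborel. exp (- (\<i> * of_real (x \<bullet> \<xi>))) * f x))\<^sup>2) =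
    (LINT w|lborel. exp (- (\<i> * of_real (w \<bullet> \<xi>))) * autocorrelation f w)"
proof -
  let ?e = "\<lambda>x. exp (- (\<i> * of_real (x \<bullet> \<xi>)))"
  let ?F = "LINT x|lborel. ?e x * f x"
  have ce: "continuous_on UNIV ?e" by (intro continuous_intros)
  have i: "integrable lborel (\<lambda>x. ?e x * f x)"
    by (rule integrable_twisted_product(2)[OF ce])
  have e: "?e x * cnj (?e (x - w)) = ?e w" for x w
  proof -
    have "cnj (?e (x - w)) = exp (\<i> * of_real ((x - w) \<bullet> \<xi>))"
      unfolding exp_cnj by simp
    then show ?thesis
      by (simp add: exp_add[symmetric] inner_diff_left algebra_simps)
  qed
  have F: "cnj ?F = (LINT w|lborel. cnj (?e (x - w) * f (x - w)))" for x
  proof -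
    have "?F = (LINT w|lborel. ?e (x - w) * f (x - w))"
      using lborel_integral_affine(2)[OF _ i, of "-1" x] by simp
    then show ?thesis
      by (simp only: Bochner_Integration.integral_cnj)
  qed
  have "complex_of_real ((norm ?F)\<^sup>2) = (LINT x|lborel. ?e x * f x * cnj ?F)"
    unfolding complex_norm_square by simp
  also have "\<dots> = (LINT x|lborel. (LINT w|lborel. ?e x * f x * cnj (?e (x - w) * f (x - w))))"
    unfolding F[of x for x] by (simp only: integral_mult_right_zero F[symmetric])
  also have "\<dots> = (LINT x|lborel. (LINT w|lborel. ?e w * (f x * cnj (f (x - w)))))"
  proof -
    have "?e x * f x * cnj (?e (x - w) * f (x - w)) = ?e w * (f x * cnj (f (x - w)))" for x w
      unfolding e[of x w, symmetric] by (simp only: complex_cnj_mult mult_ac)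
    then show ?thesis by (simp only:)
  qed
  also have "\<dots> = (LINT w|lborel. (LINT x|lborel. ?e w * (f x * cnj (f (x - w)))))"
    using integrable_twisted_product(1)[OF ce] by (rule lborel_pair.Fubini_integral[symmetric])
  also have "\<dots> = (LINT w|lborel. ?e w * autocorrelation f w)"
    by (simp only: autocorrelation_def integral_mult_right_zero)
  finally show ?thesis .
qed

text \<open>A Gaussian weight makes the inversion integral absolutely convergent. By Fubini's theorem it
  turns into an average of the autocorrelation against a Gaussian of width \<open>e\<close>.\<close>

lemma gaussian_mean_fourier_squared:
  assumes e: "e > 0"
  defines "h \<equiv> \<lambda>\<xi>. exp (- (norm (e *\<^sub>R \<xi>))\<^sup>2 / 2) *
      (norm (LINT x|lborel. exp (- (\<i> * of_real (x \<bullet> \<xi>))) * f x))\<^sup>2"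
  shows "integrable lborel h"
    "of_real (LINT \<xi>|lborel. h \<xi>) =
      of_real ((2 * pi) ^ DIM('a)) * (LINT z|lborel. of_real (gaussian z) * autocorrelation f (e *\<^sub>R z))"
proof -
  let ?E = "\<lambda>\<xi>::'a. exp (- (norm (e *\<^sub>R \<xi>))\<^sup>2 / 2)"
  let ?R = "autocorrelation f"
  let ?g = "\<lambda>\<xi> w. exp (- (\<i> * of_real (w \<bullet> \<xi>))) * complex_of_real (?E \<xi>) * ?R w"
  note R = autocorrelation_facts
  have [measurable]: "?R \<in> borel_measurable borel" by (rule R)
  have iE: "integrable lborel (\<lambda>\<xi>. complex_of_real (?E \<xi>))"
    using scaled_gaussian_fourier(1)[OF e, of 0] by simp
  have n: "norm (?g \<xi> w) = ?E \<xi> * norm (?R w)" for \<xi> w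
    by (simp add: norm_mult)
  have ip: "integrable (lborel \<Otimes>\<^sub>M lborel) (\<lambda>(\<xi>, w). ?g \<xi> w)"
  proof (rule lborel_pair.Fubini_integrable)
    show "(\<lambda>(\<xi>, w). ?g \<xi> w) \<in> borel_measurable (lborel \<Otimes>\<^sub>M lborel)" by measurable
    have "integrable lborel (\<lambda>\<xi>. ?E \<xi> * (LINT w|lborel. norm (?R w)))"
      using integrable_Re[OF iE] by (intro integrable_mult_left) simp
    then show "integrable lborel (\<lambda>\<xi>. LINT w|lborel. norm (case (\<xi>, w) of (\<xi>, w) \<Rightarrow> ?g \<xi> w))"
      by (simp only: prod.case n integral_mult_right_zero)
    have "integrable lborel (?g \<xi>)" for \<xi>
    proof (rule Bochner_Integration.integrable_bound)
      show "integrable lborel (\<lambda>w. ?E \<xi> * norm (?R w))"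
        using R(1) by (intro integrable_mult_right integrable_norm)
    qed (auto simp only: n, auto)
    then show "AE \<xi> in lborel. integrable lborel (\<lambda>w. case (\<xi>, w) of (\<xi>, w) \<Rightarrow> ?g \<xi> w)"
      by simp
  qed
  have h: "complex_of_real (h \<xi>) = (LINT w|lborel. ?g \<xi> w)" for \<xi>
  proof -
    have "complex_of_real (h \<xi>) = of_real (?E \<xi>) * (LINT w|lborel. exp (- (\<i> * of_real (w \<bullet> \<xi>))) * ?R w)"
      unfolding h_def of_real_mult norm_fourier_squared ..
    also have "\<dots> = (LINT w|lborel. of_real (?E \<xi>) * (exp (- (\<i> * of_real (w \<bullet> \<xi>))) * ?R w))"
      by (simp only: integral_mult_right_zero)
    finally show ?thesis by (simp only: mult_ac)
  qed
  have ih: "integrable lborel (\<lambda>\<xi>. complex_of_real (h \<xi>))"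
    unfolding h using lborel_pair.integrable_fst[OF ip] by simp
  show "integrable lborel h" using integrable_Re[OF ih] by simp
  let ?k = "\<lambda>w. of_real ((2 * pi / e) ^ DIM('a) * gaussian (w /\<^sub>R e)) * ?R w"
  have "complex_of_real (LINT \<xi>|lborel. h \<xi>) = (LINT \<xi>|lborel. (LINT w|lborel. ?g \<xi> w))"
    unfolding integral_complex_of_real[symmetric] h ..
  also have "\<dots> = (LINT w|lborel. (LINT \<xi>|lborel. ?g \<xi> w))"
    using ip by (rule lborel_pair.Fubini_integral[symmetric])
  also have k: "(\<lambda>w. LINT \<xi>|lborel. ?g \<xi> w) = ?k"
    by (simp only: integral_mult_left_zero scaled_gaussian_fourier(2)[OF e])
  also have "(LINT w|lborel. ?k w) = e ^ DIM('a) *\<^sub>R (LINT z|lborel. ?k (0 + e *\<^sub>R z))"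
  proof -
    have "integrable lborel ?k"
      unfolding k[symmetric] using lborel_pair.integrable_snd[of ?g] ip by simp
    then show ?thesis
      using lborel_integral_affine(2)[of e ?k 0] e by simp
  qed
  also have "\<dots> = of_real (e ^ DIM('a)) * (LINT z|lborel. of_real ((2 * pi / e) ^ DIM('a)) * (of_real (gaussian z) * ?R (e *\<^sub>R z)))"
    using e by (simp add: scaleR_conv_of_real mult.assoc)
  also have "\<dots> = of_real (e ^ DIM('a) * (2 * pi / e) ^ DIM('a)) * (LINT z|lborel. of_real (gaussian z) * ?R (e *\<^sub>R z))"
    by (simp only: integral_mult_right_zero of_real_mult mult.assoc)
  also have "e ^ DIM('a) * (2 * pi / e) ^ DIM('a) = (2 * pi) ^ DIM('a)"
    using e by (simp add: power_divide)
  finally show "of_real (LINT \<xi>|lborel. h \<xi>) =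
      of_real ((2 * pi) ^ DIM('a)) * (LINT z|lborel. of_real (gaussian z) * autocorrelation f (e *\<^sub>R z))" .
qed

text \<open>As \<open>e\<close> tends to \<open>0\<close> the weights increase to \<open>1\<close>. Monotone convergence therefore gives the
  integrability of \<open>\<bar>f^\<bar>\<^sup>2\<close> together with the value of the integral.\<close>

lemma integral_fourier_squared:
  defines "N \<equiv> \<lambda>\<xi>. (norm (LINT x|lborel. exp (- (\<i> * of_real (x \<bullet> \<xi>))) * f x))\<^sup>2"
  shows "integrable lborel N"
    "(LINT \<xi>|lborel. N \<xi>) = (2 * pi) ^ DIM('a) * (LINT x|lborel. (norm (f x))\<^sup>2)"
proof -
  let ?e = "\<lambda>n. 1 / real (Suc n)"
  let ?h = "\<lambda>n \<xi>. exp (- (norm (?e n *\<^sub>R \<xi>))\<^sup>2 / 2) * N \<xi>"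
  let ?R = "autocorrelation f" and ?c = "(2 * pi) ^ DIM('a)"
  let ?S = "LINT x|lborel. (norm (f x))\<^sup>2"
  have e: "?e n > 0" for n by simp
  have h: "integrable lborel (?h n)"
    "complex_of_real (LINT \<xi>|lborel. ?h n \<xi>) =
      of_real ?c * (LINT z|lborel. of_real (gaussian z) * ?R (?e n *\<^sub>R z))" for n
    unfolding N_def by (rule gaussian_mean_fourier_squared[OF e])+
  note R = autocorrelation_facts
  have [measurable]: "?R \<in> borel_measurable borel" by (rule R)
  have [measurable]: "(gaussian :: 'a \<Rightarrow> real) \<in> borel_measurable borel"
    using integrable_gaussian by auto
  have e0: "?e \<longlonglongrightarrow> 0"
    using LIMSEQ_inverse_real_of_nat by (simp add: inverse_eq_divide del: of_nat_Suc)
  obtain B where B: "\<And>w. norm (?R w) \<le> B"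
    using R(3) unfolding bounded_iff by auto
  have "(\<lambda>n. LINT z|lborel. of_real (gaussian z) * ?R (?e n *\<^sub>R z)) \<longlonglongrightarrow>
      (LINT z::'a|lborel. of_real (gaussian z) * ?R 0)"
  proof (rule integral_dominated_convergence)
    show "integrable lborel (\<lambda>z::'a. gaussian z * B)"
      by (intro integrable_mult_left integrable_gaussian)
    have "(\<lambda>n. ?R (?e n *\<^sub>R z)) \<longlonglongrightarrow> ?R 0" for z
      using tendsto_scaleR[OF e0 tendsto_const[of z]] by (intro isCont_tendsto_compose[OF R(4)]) simp
    then show "AE z in lborel. (\<lambda>n. of_real (gaussian z) * ?R (?e n *\<^sub>R z)) \<longlonglongrightarrow> of_real (gaussian z) * ?R 0"
      by (intro AE_I2 tendsto_intros)
    have "gaussian z \<ge> 0" for z :: 'a by (simp add: gaussian_def)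
    then show "AE z in lborel. norm (of_real (gaussian z) * ?R (?e n *\<^sub>R z)) \<le> gaussian z * B" for n
      using B by (auto simp: norm_mult intro!: AE_I2 mult_left_mono)
  qed measurable
  moreover have "(LINT z::'a|lborel. of_real (gaussian z) * ?R 0) = of_real ?S"
    unfolding R(5) integral_mult_left_zero integral_complex_of_real integral_gaussian by simp
  ultimately have "(\<lambda>n. LINT z|lborel. of_real (gaussian z) * ?R (?e n *\<^sub>R z)) \<longlonglongrightarrow> of_real ?S"
    by (simp only:)
  then have "(\<lambda>n. complex_of_real (LINT \<xi>|lborel. ?h n \<xi>)) \<longlonglongrightarrow> of_real (?c * ?S)"
    unfolding h(2) of_real_mult[of ?c ?S] by (rule tendsto_mult[OF tendsto_const])
  then have lim: "(\<lambda>n. LINT \<xi>|lborel. ?h n \<xi>) \<longlonglongrightarrow> ?c * ?S"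
    by (simp only: tendsto_of_real_iff)
  have i: "integrable lborel (?h n)" for n
    by (rule h(1))
  have N0: "N \<xi> \<ge> 0" for \<xi> by (simp add: N_def)
  have mono: "mono (\<lambda>n. ?h n \<xi>)" for \<xi>
  proof (rule monoI)
    fix m n :: nat assume "m \<le> n"
    then have "norm (?e n *\<^sub>R \<xi>) \<le> norm (?e m *\<^sub>R \<xi>)"
      by (auto intro!: mult_right_mono divide_left_mono)
    then show "?h m \<xi> \<le> ?h n \<xi>"
      by (intro mult_right_mono N0) (simp add: power_mono)
  qed
  have ptw: "(\<lambda>n. ?h n \<xi>) \<longlonglongrightarrow> N \<xi>" for \<xi>
  proof -
    have "(\<lambda>n. exp (- (norm (?e n *\<^sub>R \<xi>))\<^sup>2 / 2) * N \<xi>) \<longlonglongrightarrow> exp (- (norm (0 *\<^sub>R \<xi>))\<^sup>2 / 2) * N \<xi>"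
      by (intro tendsto_intros e0) auto
    then show ?thesis by simp
  qed
  have m: "N \<in> borel_measurable lborel"
    by (rule borel_measurable_LIMSEQ_real[OF ptw]) (use i in auto)
  show "integrable lborel N" "(LINT \<xi>|lborel. N \<xi>) = ?c * ?S"
    using integrable_monotone_convergence[OF i _ _ lim m] integral_monotone_convergence[OF i _ _ lim m] mono ptw
    by auto
qed

end

lemma plancherel:
  fixes u :: "real^'n::finite \<Rightarrow> complex"
  assumes "continuous_on UNIV u" "compact K" "\<And>p. p \<notin> K \<Longrightarrow> u p = 0"
  shows "(sobolev_norm 0 u)\<^sup>2 = (LINT p|lborel. (norm (u p))\<^sup>2)"
proof -
  let ?N = "\<lambda>\<xi>::real^'n. (norm (LINT x|lborel. exp (- (\<i> * of_real (x \<bullet> \<xi>))) * u x))\<^sup>2"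
  let ?c = "(2 * pi) powr (- real CARD('n) / 2)"
  have "?c\<^sup>2 = (2 * pi) powr (- real CARD('n))"
    by (simp add: power2_eq_square powr_add[symmetric])
  also have "\<dots> = inverse ((2 * pi) ^ CARD('n))"
    by (simp add: powr_minus powr_realpow)
  finally have c: "?c\<^sup>2 = inverse ((2 * pi) ^ CARD('n))" .
  have p: "(LINT \<xi>|lborel. ?N \<xi>) = (2 * pi) ^ CARD('n) * (LINT p|lborel. (norm (u p))\<^sup>2)"
    using integral_fourier_squared(2)[OF assms] by simp
  have "1 + (norm \<xi>)\<^sup>2 \<noteq> 0" for \<xi> :: "real^'n"
    using zero_le_power2[of "norm \<xi>"] by linarith
  then have "(1 + (norm \<xi>)\<^sup>2) powr 0 * (norm (fourier u \<xi>))\<^sup>2 = ?c\<^sup>2 * ?N \<xi>" for \<xi>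
    by (simp add: fourier_def norm_mult power_mult_distrib)
  then have "(LINT \<xi>|lborel. (1 + (norm \<xi>)\<^sup>2) powr 0 * (norm (fourier u \<xi>))\<^sup>2) = ?c\<^sup>2 * (LINT \<xi>|lborel. ?N \<xi>)"
    by simp
  also have "\<dots> = (LINT p|lborel. (norm (u p))\<^sup>2)"
    unfolding p c mult.assoc[symmetric] by (subst left_inverse) auto
  finally show ?thesis
    unfolding sobolev_norm_def by simp
qed


section \<open>The energy estimate\<close>

lemma test_functions_vf_apply:
  assumes "\<And>i. smooth_on UNIV (\<lambda>p. Z p $ i)" "f \<in> test_functions V"
  shows "vf_apply Z f \<in> test_functions V"
proof -
  have "(\<lambda>p. \<Sum>i\<in>UNIV. Z p $ i * partial i f p) \<in> test_functions V"
    by (intro test_functions_sum test_functions_mult test_functions_partial assms) auto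
  then show ?thesis by (simp only: vf_apply_def[abs_def])
qed

lemma test_functions_vf_adjoint:
  assumes "\<And>i. smooth_on UNIV (\<lambda>p. Z p $ i)" "f \<in> test_functions V"
  shows "vf_adjoint Z f \<in> test_functions V"
proof -
  have "(\<lambda>p. - 1 * (\<Sum>i\<in>UNIV. partial i (\<lambda>q. cnj (Z q $ i) * f q) p)) \<in> test_functions V"
    by (intro test_functions_sum test_functions_mult test_functions_partial smooth_on_const
        smooth_on_cnj assms) auto
  then show ?thesis by (simp add: vf_adjoint_def[abs_def])
qed

lemma test_functions_sum_of_squares:
  assumes "\<And>Z i. Z \<in> set Zs \<Longrightarrow> smooth_on UNIV (\<lambda>p. Z p $ i)" "f \<in> test_functions V"
  shows "sum_of_squares Zs f \<in> test_functions V"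
proof -
  have "(\<lambda>p. \<Sum>j\<in>{..<length Zs}. vf_adjoint (Zs ! j) (vf_apply (Zs ! j) f) p) \<in> test_functions V"
    by (intro test_functions_sum test_functions_vf_adjoint test_functions_vf_apply assms) auto
  then show ?thesis
    by (simp add: sum_of_squares_def[abs_def] sum_list_sum_nth lessThan_atLeast0)
qed

lemma test_functions_continuous_on:
  "f \<in> test_functions V \<Longrightarrow> continuous_on S f"
  by (auto simp: test_functions_def intro: continuous_on_subset[OF smooth_on_continuous_on])

lemma integrable_mult_test_function:
  assumes "continuous_on V g" "f \<in> test_functions V"
  shows "integrable lborel (\<lambda>p. g p * f p)"
proof (rule integrable_compact_support[of "support f"])
  show "continuous_on (support f) (\<lambda>p. g p * f p)"
    using assms by (intro continuous_on_mult test_functions_continuous_on[OF assms(2)])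
      (auto simp: test_functions_def intro: continuous_on_subset)
qed (use assms not_in_support in \<open>auto simp: test_functions_def\<close>)

lemma integrable_test_function_mult:
  assumes "f \<in> test_functions V" "continuous_on V g"
  shows "integrable lborel (\<lambda>p. f p * g p)"
  using integrable_mult_test_function[OF assms(2,1)] by (simp only: mult.commute)

lemma integrable_norm_squared:
  assumes "f \<in> test_functions V"
  shows "integrable lborel (\<lambda>p. (norm (f p))\<^sup>2)"
proof -
  have "integrable lborel (\<lambda>p. f p * cnj (f p))"
    by (intro integrable_test_function_mult[OF assms] continuous_intros test_functions_continuous_on[OF assms])
  then have "integrable lborel (\<lambda>p. Re (f p * cnj (f p)))" by (rule integrable_Re)
  moreover have "Re (f p * cnj (f p)) = (norm (f p))\<^sup>2" for p
    by (simp add: complex_norm_square[symmetric] del: of_real_power)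
  ultimately show ?thesis by simp
qed

text \<open>The integral of \<open>\<partial>\<^sub>i (x\<^sub>i \<bar>u\<bar>\<^sup>2) = \<bar>u\<bar>\<^sup>2 + 2 x\<^sub>i Re (\<partial>\<^sub>i u cnj u)\<close> vanishes, and half of
  \<open>\<bar>u\<bar>\<^sup>2\<close> absorbs the factor \<open>u\<close> of the second term.\<close>

lemma poincare:
  assumes u: "u \<in> test_functions V" and V: "\<And>p. p \<in> V \<Longrightarrow> \<bar>p $ i\<bar> \<le> R"
  shows "(LINT p|lborel. (norm (u p))\<^sup>2) \<le> 4 * R\<^sup>2 * (LINT p|lborel. (norm (partial i u p))\<^sup>2)"
proof -
  let ?x = "\<lambda>p. complex_of_real (p $ i)" and ?d = "partial i u"
  let ?h = "\<lambda>p. (?x p * cnj (u p)) * u p"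
  have su: "smooth_on UNIV u" using u by (simp add: test_functions_def)
  have th: "?h \<in> test_functions V"
    by (intro test_functions_mult[OF u] smooth_on_mult smooth_on_coordinate smooth_on_cnj su)
  have td: "?d \<in> test_functions V" by (rule test_functions_partial[OF u])
  note du = smooth_on_imp(1)[OF su UNIV_I]
  have dx: "?x differentiable (at p)" for p :: "real^'a"
    by (rule smooth_on_imp(1)[OF smooth_on_coordinate UNIV_I])
  have px: "partial i ?x p = 1" for p
    using partial_monomial[of i 1 i 1 p] by simp
  have ph: "partial i ?h p = of_real ((norm (u p))\<^sup>2 + p $ i * (2 * Re (?d p * cnj (u p))))" for p
  proof -
    have "partial i ?h p = (?x p * cnj (u p)) * ?d p + (?x p * cnj (?d p) + 1 * cnj (u p)) * u p"
      by (simp only: partial_mult[OF differentiable_mult[OF dx differentiable_cnj[OF du]] du]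
          partial_mult[OF dx differentiable_cnj[OF du]] partial_cnj[OF du] px)
    also have "\<dots> = u p * cnj (u p) + ?x p * (?d p * cnj (u p) + cnj (?d p * cnj (u p)))"
      by (simp add: algebra_simps)
    also have "\<dots> = of_real ((norm (u p))\<^sup>2 + p $ i * (2 * Re (?d p * cnj (u p))))"
      unfolding complex_add_cnj complex_norm_square[symmetric] by (simp only: of_real_add of_real_mult)
    finally show ?thesis .
  qed
  have 0: "(LINT p|lborel. partial i ?h p) = 0" "integrable lborel (partial i ?h)"
  proof -
    have "compact (support ?h)" using th by (simp add: test_functions_def)
    moreover have "?h differentiable (at p)" for p
      using th by (auto simp: test_functions_def dest: smooth_on_imp)
    ultimately show "(LINT p|lborel. partial i ?h p) = 0" "integrable lborel (partial i ?h)"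
      using integral_partial[of ?h i "support ?h"] not_in_support[of _ ?h]
        test_functions_continuous_on[OF test_functions_partial[OF th]] by blast+
  qed
  have I0: "(LINT p|lborel. (norm (u p))\<^sup>2 + p $ i * (2 * Re (?d p * cnj (u p)))) = 0"
    using 0(1) unfolding ph integral_complex_of_real by simp
  have le: "(norm (u p))\<^sup>2 + p $ i * (2 * Re (?d p * cnj (u p))) \<ge>
      1 / 2 * (norm (u p))\<^sup>2 - 2 * R\<^sup>2 * (norm (?d p))\<^sup>2" for p
  proof (cases "p \<in> V")
    case True
    have "\<bar>p $ i * (2 * Re (?d p * cnj (u p)))\<bar> \<le> R * (2 * (norm (?d p) * norm (u p)))"
      unfolding abs_mult using V[OF True] abs_Re_le_cmod[of "?d p * cnj (u p)"]
      by (intro mult_mono) (auto simp: norm_mult)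
    also have "R * (2 * (norm (?d p) * norm (u p))) \<le> 1 / 2 * (norm (u p))\<^sup>2 + 2 * R\<^sup>2 * (norm (?d p))\<^sup>2"
      using zero_le_power2[of "norm (u p) - 2 * R * norm (?d p)"]
      by (simp add: power2_eq_square algebra_simps)
    finally show ?thesis by linarith
  next
    case False
    then have "u p = 0" using u not_in_support[of p u] by (auto simp: test_functions_def)
    then show ?thesis by simp
  qed
  have I1: "integrable lborel (\<lambda>p. (norm (u p))\<^sup>2 + p $ i * (2 * Re (?d p * cnj (u p))))"
    using integrable_Re[OF 0(2)] unfolding ph Re_complex_of_real .
  note iu = integrable_norm_squared[OF u] and id = integrable_norm_squared[OF td]
  have "(LINT p|lborel. 1 / 2 * (norm (u p))\<^sup>2 - 2 * R\<^sup>2 * (norm (?d p))\<^sup>2) \<le> 0"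
    unfolding I0[symmetric] using le
    by (intro integral_mono I1 Bochner_Integration.integrable_diff integrable_mult_right iu id)
  then show ?thesis
    using iu id by simp
qed

lemma sum_of_squares_energy:
  assumes "\<And>Z i. Z \<in> set Zs \<Longrightarrow> smooth_on UNIV (\<lambda>p. Z p $ i)" "u \<in> test_functions UNIV"
  shows "(LINT p|lborel. u p * cnj (sum_of_squares Zs u p)) =
    (\<Sum>Z\<leftarrow>Zs. of_real (LINT p|lborel. (norm (vf_apply Z u p))\<^sup>2))"
  using assms
proof (induction Zs)
  case Nil
  then show ?case by (simp add: sum_of_squares_def)
next
  case (Cons Z Zs)
  have tZ: "vf_apply Z u \<in> test_functions UNIV"
    by (intro test_functions_vf_apply Cons.prems) auto
  have i: "integrable lborel (\<lambda>p. u p * cnj (w p))" if "w \<in> test_functions UNIV" for w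
    by (intro integrable_test_function_mult[OF Cons.prems(2)] continuous_intros test_functions_continuous_on[OF that])
  have "(LINT p|lborel. u p * cnj (sum_of_squares (Z # Zs) u p)) =
      (LINT p|lborel. u p * cnj (vf_adjoint Z (vf_apply Z u) p) + u p * cnj (sum_of_squares Zs u p))"
    by (simp add: sum_of_squares_def algebra_simps)
  also have "\<dots> = (LINT p|lborel. u p * cnj (vf_adjoint Z (vf_apply Z u) p)) +
      (LINT p|lborel. u p * cnj (sum_of_squares Zs u p))"
    by (intro Bochner_Integration.integral_add i test_functions_vf_adjoint tZ
        test_functions_sum_of_squares Cons.prems) auto
  also have "(LINT p|lborel. u p * cnj (vf_adjoint Z (vf_apply Z u) p)) =
      (LINT p|lborel. vf_apply Z u p * cnj (vf_apply Z u p))"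
    by (rule vf_adjoint_duality[symmetric]) (use Cons.prems tZ in auto)
  also have "\<dots> = of_real (LINT p|lborel. (norm (vf_apply Z u p))\<^sup>2)"
    unfolding complex_norm_square[symmetric] integral_complex_of_real ..
  finally show ?case
    using Cons by simp
qed

lemma sobolev_norm_nonneg: "sobolev_norm r u \<ge> 0"
  by (simp add: sobolev_norm_def)

text \<open>If a coordinate field \<open>\<partial>\<^sub>i\<close> is among the fields, Poincare's inequality and the energy
  identity give \<open>\<parallel>u\<parallel>\<^sup>2 \<le> 4 R\<^sup>2 \<parallel>\<partial>\<^sub>i u\<parallel>\<^sup>2 \<le> 4 R\<^sup>2 Re \<langle>u, L u\<rangle>\<close>, hence an estimate of \<open>u\<close> by \<open>L u\<close> in
  \<open>L\<^sup>2\<close>. The definition of finite loss is then met with \<open>r = q = 0\<close> and \<open>r' = -1\<close>.\<close>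

lemma loses_finitely_many_derivatives_sum_of_squares:
  assumes Zs: "\<And>Z i. Z \<in> set Zs \<Longrightarrow> smooth_on UNIV (\<lambda>p. Z p $ i)"
    and i: "(\<lambda>p. axis i 1) \<in> set Zs" and V: "bounded V"
  shows "loses_finitely_many_derivatives (sum_of_squares Zs) V"
  unfolding loses_finitely_many_derivatives_def
proof (intro allI impI)
  fix W assume W: "relatively_compact_in W V"
  obtain R where R: "R > 0" "\<And>p. p \<in> V \<Longrightarrow> norm p \<le> R"
    using V unfolding bounded_pos by auto
  have "W \<subseteq> V" using W closure_subset[of W] by (auto simp: relatively_compact_in_def)
  then have R': "\<bar>p $ i\<bar> \<le> R" if "p \<in> W" for p
    using that R(2)[of p] component_le_norm_cart[of p i] by auto
  have "sobolev_norm 0 u \<le> 4 * R\<^sup>2 * sobolev_norm 0 (sum_of_squares Zs u) + 4 * R\<^sup>2 * sobolev_norm (-1) u"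
    if u: "u \<in> test_functions W" for u
  proof -
    let ?L = "sum_of_squares Zs u" and ?d = "partial i u"
    have u': "u \<in> test_functions UNIV" using u test_functions_mono by blast
    have L: "?L \<in> test_functions UNIV" by (rule test_functions_sum_of_squares[OF Zs u'])
    have d: "vf_apply (\<lambda>p. axis i 1) u = ?d"
      by (simp add: fun_eq_iff vf_apply_def axis_def if_distrib[of "\<lambda>x. x * _"] cong: if_cong)
    have planch: "(sobolev_norm 0 f)\<^sup>2 = (LINT p|lborel. (norm (f p))\<^sup>2)" if "f \<in> test_functions UNIV" for f
      by (rule plancherel[of _ "support f"])
        (use that not_in_support in \<open>auto simp: test_functions_def intro: smooth_on_continuous_on\<close>)
    have Lu: "integrable lborel (\<lambda>p. u p * cnj (?L p))"
      by (intro integrable_test_function_mult[OF u] continuous_intros test_functions_continuous_on[OF L])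
    have "(LINT p|lborel. (norm (?d p))\<^sup>2) \<le> (\<Sum>Z\<leftarrow>Zs. LINT p|lborel. (norm (vf_apply Z u p))\<^sup>2)"
      unfolding d[symmetric] by (rule member_le_sum_list) (use i in \<open>auto intro: image_eqI[OF refl]\<close>)
    also have "\<dots> = Re (\<Sum>Z\<leftarrow>Zs. of_real (LINT p|lborel. (norm (vf_apply Z u p))\<^sup>2))"
      by (induction Zs) auto
    also have "\<dots> = Re (LINT p|lborel. u p * cnj (?L p))"
      by (simp only: sum_of_squares_energy[OF Zs u'])
    also have "\<dots> = (LINT p|lborel. Re (u p * cnj (?L p)))"
      by (rule integral_Re[OF Lu, symmetric])
    finally have "4 * R\<^sup>2 * (LINT p|lborel. (norm (?d p))\<^sup>2) \<le>
        4 * R\<^sup>2 * (LINT p|lborel. Re (u p * cnj (?L p)))"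
      by (rule mult_left_mono) simp
    with poincare[OF u R'] have "(LINT p|lborel. (norm (u p))\<^sup>2) \<le>
        4 * R\<^sup>2 * (LINT p|lborel. Re (u p * cnj (?L p)))"
      by (rule order.trans)
    also have "\<dots> = (LINT p|lborel. 4 * R\<^sup>2 * Re (u p * cnj (?L p)))"
      by simp
    also have "\<dots> \<le> (LINT p|lborel. 1 / 2 * (norm (u p))\<^sup>2 + 1 / 2 * (4 * R\<^sup>2)\<^sup>2 * (norm (?L p))\<^sup>2)"
    proof (rule integral_mono)
      show "integrable lborel (\<lambda>p. 4 * R\<^sup>2 * Re (u p * cnj (?L p)))"
        by (intro integrable_mult_right integrable_Re Lu)
      show "integrable lborel (\<lambda>p. 1 / 2 * (norm (u p))\<^sup>2 + 1 / 2 * (4 * R\<^sup>2)\<^sup>2 * (norm (?L p))\<^sup>2)"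
        by (intro Bochner_Integration.integrable_add integrable_mult_right integrable_norm_squared[OF u'] integrable_norm_squared[OF L])
      show "4 * R\<^sup>2 * Re (u p * cnj (?L p)) \<le> 1 / 2 * (norm (u p))\<^sup>2 + 1 / 2 * (4 * R\<^sup>2)\<^sup>2 * (norm (?L p))\<^sup>2" for p
      proof -
        have "4 * R\<^sup>2 * Re (u p * cnj (?L p)) \<le> 4 * R\<^sup>2 * (norm (u p) * norm (?L p))"
          using complex_Re_le_cmod[of "u p * cnj (?L p)"] by (intro mult_left_mono) (auto simp: norm_mult)
        also have "\<dots> \<le> 1 / 2 * (norm (u p))\<^sup>2 + 1 / 2 * (4 * R\<^sup>2)\<^sup>2 * (norm (?L p))\<^sup>2"
          using zero_le_power2[of "norm (u p) - 4 * R\<^sup>2 * norm (?L p)"]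
          by (simp add: power2_eq_square algebra_simps)
        finally show ?thesis .
      qed
    qed
    also have "\<dots> = 1 / 2 * (LINT p|lborel. (norm (u p))\<^sup>2) + 1 / 2 * (4 * R\<^sup>2)\<^sup>2 * (LINT p|lborel. (norm (?L p))\<^sup>2)"
      using integrable_norm_squared[OF u'] integrable_norm_squared[OF L] by simp
    finally have "(sobolev_norm 0 u)\<^sup>2 \<le> (4 * R\<^sup>2 * sobolev_norm 0 ?L)\<^sup>2"
      unfolding planch[OF u', symmetric] planch[OF L, symmetric] by (simp add: power_mult_distrib)
    then have "sobolev_norm 0 u \<le> 4 * R\<^sup>2 * sobolev_norm 0 ?L"
      by (rule power2_le_imp_le) (simp add: sobolev_norm_nonneg)
    moreover have "4 * R\<^sup>2 * sobolev_norm (-1) u \<ge> 0"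
      by (simp add: sobolev_norm_nonneg)
    ultimately show ?thesis by linarith
  qed
  then show "\<exists>r q r' C. r' < r \<and> (\<forall>u\<in>test_functions W.
      sobolev_norm r u \<le> C * sobolev_norm q (sum_of_squares Zs u) + C * sobolev_norm r' u)"
    by (intro exI[of _ 0] exI[of _ "-1"] exI[of _ "4 * R\<^sup>2"]) auto
qed

lemma smooth_on_vector:
  assumes "smooth_on UNIV a" "smooth_on UNIV b" "smooth_on UNIV c"
  shows "smooth_on UNIV (\<lambda>p. vector [a p, b p, c p] $ (i::3))"
  using exhaust_3[of i] assms by auto

lemma smooth_on_Z: "Z \<in> set [Z1, Z2 k, Z3] \<Longrightarrow> smooth_on UNIV (\<lambda>p. Z p $ i)"
proof -
  have "Z2 k p = vector [of_real (p $ 1) ^ k, of_real (p $ 1) ^ k * (\<i> * of_real (p $ 1)), 0]" for p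
    by (simp add: Z2_def vec_eq_iff forall_3)
  then show "smooth_on UNIV (\<lambda>p. Z p $ i)" if "Z \<in> set [Z1, Z2 k, Z3]"
    using that unfolding Z1_def[abs_def] Z3_def[abs_def]
    by (auto intro!: smooth_on_vector smooth_on_minus smooth_on_mult smooth_on_power smooth_on_coordinate)
qed


section \<open>Ordinary differential equations\<close>

lemma integral_has_vector_derivative_half_line:
  fixes g :: "real \<Rightarrow> 'a::banach"
  assumes g: "continuous_on {0..} g" and x: "x \<ge> 0"
  shows "((\<lambda>x. integral {0..x} g) has_vector_derivative g x) (at x within {0..})"
proof -
  have "((\<lambda>x. integral {0..x} g) has_vector_derivative g x) (at x within {0..x + 1})"
    by (rule integral_has_vector_derivative) (use x in \<open>auto intro: continuous_on_subset[OF g]\<close>)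
  moreover have "at x within {0..x + 1} = at x within {0..}"
    by (rule at_within_nhd[of x "{..<x + 1}"]) auto
  ultimately show ?thesis by simp
qed

text \<open>The successive approximations converge uniformly on every \<open>[0, b]\<close> by the usual factorial
  estimate. They do not depend on \<open>b\<close>, so their limit is a solution on the whole half line.\<close>

lemma picard_lindelof_half_line:
  fixes F :: "real \<Rightarrow> 'a::banach \<Rightarrow> 'a"
  assumes cont: "\<And>y. continuous_on {0..} y \<Longrightarrow> continuous_on {0..} (\<lambda>x. F x (y x))"
    and lip: "\<And>b. \<exists>K. \<forall>x\<in>{0..b}. \<forall>v w. norm (F x v - F x w) \<le> K * norm (v - w)"
  shows "\<exists>y. y 0 = y0 \<and> (\<forall>x\<ge>0. (y has_vector_derivative F x (y x)) (at x within {0..}))"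
proof -
  define Y where "Y = rec_nat (\<lambda>x. y0) (\<lambda>n y x. y0 + integral {0..x} (\<lambda>z. F z (y z)))"
  have Y0: "Y 0 x = y0" and Y1: "Y (Suc n) x = y0 + integral {0..x} (\<lambda>z. F z (Y n z))" for n x
    by (simp_all add: Y_def)
  have cY: "continuous_on {0..} (Y n)" for n
  proof (induction n)
    case 0
    show ?case by (simp add: Y_def)
  next
    case (Suc n)
    have "continuous_on {0..} (\<lambda>x. integral {0..x} (\<lambda>z. F z (Y n z)))"
      using integral_has_vector_derivative_half_line[OF cont[OF Suc]]
        has_vector_derivative_continuous by (force simp: continuous_on_eq_continuous_within)
    then have "continuous_on {0..} (\<lambda>x. y0 + integral {0..x} (\<lambda>z. F z (Y n z)))"
      by (intro continuous_intros)
    then show ?case by (simp add: Y1[abs_def])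
  qed
  note cF = cont[OF cY]
  define y where "y x = y0 + (\<Sum>n. Y (Suc n) x - Y n x)" for x
  have unif: "uniform_limit {0..b} Y y sequentially" if b: "b \<ge> 0" for b
  proof -
    obtain K' where K': "\<And>x v w. x \<in> {0..b} \<Longrightarrow> norm (F x v - F x w) \<le> K' * norm (v - w)"
      using lip[of b] by blast
    define K where "K = max K' 1"
    have K: "K > 0" "norm (F x v - F x w) \<le> K * norm (v - w)" if "x \<in> {0..b}" for x v w
    proof -
      have "K' * norm (v - w) \<le> K * norm (v - w)" by (intro mult_right_mono) (auto simp: K_def)
      then show "norm (F x v - F x w) \<le> K * norm (v - w)" using K'[OF that, of v w] by linarith
    qed (simp add: K_def)
    have K0: "K > 0" by (simp add: K_def)
    have "bounded ((\<lambda>x. Y 1 x - Y 0 x) ` {0..b})"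
      by (intro compact_imp_bounded compact_continuous_image continuous_intros continuous_on_subset[OF cY]) auto
    then obtain C where C: "C > 0" "\<And>x. x \<in> {0..b} \<Longrightarrow> norm (Y 1 x - Y 0 x) \<le> C"
      unfolding bounded_pos by auto
    have est: "norm (Y (Suc n) x - Y n x) \<le> C * ((K * x) ^ n / fact n)" if "x \<in> {0..b}" for n x
      using that
    proof (induction n arbitrary: x)
      case 0
      then show ?case using C by simp
    next
      case (Suc n)
      have x: "0 \<le> x" "x \<le> b" using Suc.prems by auto
      have i: "(\<lambda>z. F z (Y m z)) integrable_on {0..x}" for m
        by (intro integrable_continuous_real continuous_on_subset[OF cF]) auto
      have "((\<lambda>z. C * ((K * z) ^ Suc n / fact (Suc n))) has_vector_derivative K * (C * ((K * z) ^ n / fact n)))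
          (at z within {0..x})" for z
      proof -
        have "((\<lambda>z. K * z) has_real_derivative K) (at z within {0..x})"
          by (auto intro!: derivative_eq_intros)
        from DERIV_power_Suc[OF this, of n]
        have "((\<lambda>z. (K * z) ^ Suc n) has_real_derivative real (Suc n) * (K * z) ^ n * K) (at z within {0..x})"
          by (simp only: of_nat_Suc mult.commute mult.left_commute)
        then have "((\<lambda>z. C * ((K * z) ^ Suc n / fact (Suc n))) has_real_derivative
            C * (real (Suc n) * (K * z) ^ n * K / fact (Suc n))) (at z within {0..x})"
          by (intro DERIV_cmult DERIV_cdivide)
        moreover have "C * (real (Suc n) * (K * z) ^ n * K / fact (Suc n)) = K * (C * ((K * z) ^ n / fact n))"
          by (simp add: field_simps del: of_nat_Suc)
        ultimately show ?thesis
          by (simp only: has_real_derivative_iff_has_vector_derivative)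
      qed
      then have I: "((\<lambda>z. K * (C * ((K * z) ^ n / fact n))) has_integral
          C * ((K * x) ^ Suc n / fact (Suc n)) - C * ((K * 0) ^ Suc n / fact (Suc n))) {0..x}"
        using x by (intro fundamental_theorem_of_calculus)
      have "Y (Suc (Suc n)) x - Y (Suc n) x = integral {0..x} (\<lambda>z. F z (Y (Suc n) z) - F z (Y n z))"
        unfolding Y1[of "Suc n"] Y1[of n x] by (simp add: integral_diff i)
      also have "norm \<dots> \<le> integral {0..x} (\<lambda>z. K * (C * ((K * z) ^ n / fact n)))"
      proof (rule integral_norm_bound_integral)
        fix z assume "z \<in> {0..x}"
        then have z: "z \<in> {0..b}" using x by auto
        have "norm (F z (Y (Suc n) z) - F z (Y n z)) \<le> K * norm (Y (Suc n) z - Y n z)"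
          by (rule K(2)[OF z])
        also have "\<dots> \<le> K * (C * ((K * z) ^ n / fact n))"
          using K0 by (intro mult_left_mono Suc.IH z) auto
        finally show "norm (F z (Y (Suc n) z) - F z (Y n z)) \<le> K * (C * ((K * z) ^ n / fact n))" .
      qed (use I i in \<open>auto intro: integrable_diff\<close>)
      also have "\<dots> = C * ((K * x) ^ Suc n / fact (Suc n))"
        using integral_unique[OF I] by simp
      finally show ?case .
    qed
    have "summable (\<lambda>n. C * ((K * b) ^ n / fact n))"
      using summable_exp[of "K * b"] by (intro summable_mult) (simp add: field_simps)
    moreover have "norm (Y (Suc n) x - Y n x) \<le> C * ((K * b) ^ n / fact n)" if "x \<in> {0..b}" for n x
    proof -
      have "C * ((K * x) ^ n / fact n) \<le> C * ((K * b) ^ n / fact n)"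
        using that C K0 by (intro mult_left_mono divide_right_mono power_mono) auto
      then show ?thesis using est[OF that, of n] by linarith
    qed
    ultimately have "uniform_limit {0..b} (\<lambda>n x. \<Sum>i<n. Y (Suc i) x - Y i x) (\<lambda>x. \<Sum>i. Y (Suc i) x - Y i x) sequentially"
      by (intro Weierstrass_m_test)
    then have "uniform_limit {0..b} (\<lambda>n x. y0 + (\<Sum>i<n. Y (Suc i) x - Y i x)) (\<lambda>x. y0 + (\<Sum>i. Y (Suc i) x - Y i x)) sequentially"
      by (intro uniform_limit_intros)
    moreover have "y0 + (\<Sum>i<n. Y (Suc i) x - Y i x) = Y n x" for n x
      using sum_lessThan_telescope[of "\<lambda>i. Y i x" n] by (simp add: Y0)
    ultimately show ?thesis by (simp add: y_def[abs_def])
  qed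
  have cy: "continuous_on {0..} y"
    unfolding continuous_on_eq_continuous_within
  proof
    fix x :: real assume x: "x \<in> {0..}"
    then have "uniform_limit {0..x + 1} Y y sequentially" by (intro unif) simp
    then have "continuous_on {0..x + 1} y"
      by (rule uniform_limit_theorem[rotated])
        (auto intro!: always_eventually continuous_on_subset[OF cY])
    then have "continuous (at x within {0..x + 1}) y"
      using x by (simp add: continuous_on_eq_continuous_within)
    moreover have "at x within {0..x + 1} = at x within {0..}"
      by (rule at_within_nhd[of x "{..<x + 1}"]) auto
    ultimately show "continuous (at x within {0..}) y" by simp
  qed
  have eq: "y x = y0 + integral {0..x} (\<lambda>z. F z (y z))" if x: "x \<ge> 0" for x
  proof -
    obtain K where K: "\<And>z v w. z \<in> {0..x} \<Longrightarrow> norm (F z v - F z w) \<le> K * norm (v - w)"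
      using lip[of x] by blast
    have "uniform_limit {0..x} (\<lambda>n z. F z (Y n z)) (\<lambda>z. F z (y z)) sequentially"
    proof (rule uniform_limitI)
      fix e :: real assume e: "e > 0"
      define d where "d = e / (\<bar>K\<bar> + 1)"
      have d: "d > 0" using e by (simp add: d_def add_nonneg_pos)
      have "\<forall>\<^sub>F n in sequentially. \<forall>z\<in>{0..x}. dist (Y n z) (y z) < d"
        using uniform_limitD[OF unif[OF x] d] .
      then show "\<forall>\<^sub>F n in sequentially. \<forall>z\<in>{0..x}. dist (F z (Y n z)) (F z (y z)) < e"
      proof eventually_elim
        case (elim n)
        show ?case
        proof
          fix z assume z: "z \<in> {0..x}"
          have "dist (F z (Y n z)) (F z (y z)) \<le> K * dist (Y n z) (y z)"
            using K[OF z] by (simp add: dist_norm)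
          also have "\<dots> \<le> (\<bar>K\<bar> + 1) * dist (Y n z) (y z)"
            by (intro mult_right_mono) auto
          also have "\<dots> < (\<bar>K\<bar> + 1) * d"
            using elim z by (intro mult_strict_left_mono) auto
          also have "\<dots> = e" by (simp add: d_def)
          finally show "dist (F z (Y n z)) (F z (y z)) < e" .
        qed
      qed
    qed
    then obtain I J where IJ: "\<And>n. ((\<lambda>z. F z (Y n z)) has_integral I n) {0..x}"
      "((\<lambda>z. F z (y z)) has_integral J) {0..x}" "(I \<longlongrightarrow> J) sequentially"
      by (rule uniform_limit_integral) (auto intro: continuous_on_subset[OF cF])
    then have "(\<lambda>n. y0 + I n) \<longlonglongrightarrow> y0 + J" by (intro tendsto_intros)
    moreover have "y0 + I n = Y (Suc n) x" for n
      using integral_unique[OF IJ(1)] by (simp add: Y1)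
    moreover have "(\<lambda>n. Y (Suc n) x) \<longlonglongrightarrow> y x"
      by (rule LIMSEQ_Suc) (use tendsto_uniform_limitI[OF unif[OF x], of x] x in simp)
    ultimately have "y x = y0 + J"
      using LIMSEQ_unique by simp
    then show ?thesis using integral_unique[OF IJ(2)] by simp
  qed
  have "(y has_vector_derivative F x (y x)) (at x within {0..})" if x: "x \<ge> 0" for x
  proof -
    have "((\<lambda>x. integral {0..x} (\<lambda>z. F z (y z))) has_vector_derivative F x (y x)) (at x within {0..})"
      using cont[OF cy] x by (rule integral_has_vector_derivative_half_line)
    then have "((\<lambda>x. y0 + integral {0..x} (\<lambda>z. F z (y z))) has_vector_derivative F x (y x)) (at x within {0..})"
      using has_vector_derivative_add[OF has_vector_derivative_const[of y0]] by fastforce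
    then show ?thesis
      by (rule has_vector_derivative_transform[rotated 2]) (use x eq in auto)
  qed
  moreover have "y 0 = y0" using eq[of 0] by simp
  ultimately show ?thesis by blast
qed

text \<open>This is the initial value problem \<open>(p f')' = w f\<close>, \<open>f 0 = 1\<close>, \<open>f' 0 = 0\<close>, written as a first
  order system for \<open>f\<close> and \<open>q = p f'\<close>.\<close>

definition sturm_solution :: "(real \<Rightarrow> real) \<Rightarrow> (real \<Rightarrow> real) \<Rightarrow> (real \<Rightarrow> real) \<Rightarrow> (real \<Rightarrow> real) \<Rightarrow> bool"
  where "sturm_solution p w f q \<longleftrightarrow> f 0 = 1 \<and> q 0 = 0 \<and> (\<forall>x\<ge>0.
    (f has_real_derivative q x / p x) (at x within {0..}) \<and>
    (q has_real_derivative w x * f x) (at x within {0..}))"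

lemma sturm_solution_exists:
  assumes p: "continuous_on {0..} p" "\<And>x. x \<ge> 0 \<Longrightarrow> p x \<ge> 1" and w: "continuous_on {0..} w"
  shows "\<exists>f q. sturm_solution p w f q"
proof -
  define F where "F x v = (snd v / p x, w x * fst v)" for x and v :: "real \<times> real"
  have le: "\<bar>fst z\<bar> \<le> norm z" "\<bar>snd z\<bar> \<le> norm z" for z :: "real \<times> real"
    using norm_fst_le[of "fst z" "snd z"] norm_snd_le[of "snd z" "fst z"] by simp_all
  have "\<exists>y. y 0 = (1, 0) \<and> (\<forall>x\<ge>0. (y has_vector_derivative F x (y x)) (at x within {0..}))"
  proof (rule picard_lindelof_half_line)
    show "continuous_on {0..} (\<lambda>x. F x (y x))" if "continuous_on {0..} y" for y
      unfolding F_def using p(2) by (intro continuous_intros p w that) (metis atLeast_iff not_one_le_zero)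
    show "\<exists>K. \<forall>x\<in>{0..b}. \<forall>u v. norm (F x u - F x v) \<le> K * norm (u - v)" for b
    proof -
      have "bounded (w ` {0..b})"
        by (intro compact_imp_bounded compact_continuous_image continuous_on_subset[OF w]) auto
      then obtain M where "\<forall>y\<in>w ` {0..b}. norm y \<le> M"
        unfolding bounded_iff by blast
      then have M: "\<And>x. x \<in> {0..b} \<Longrightarrow> \<bar>w x\<bar> \<le> M" by simp
      have "norm (F x u - F x v) \<le> (1 + M) * norm (u - v)" if x: "x \<in> {0..b}" for x u v
      proof -
        have "F x u - F x v = (snd (u - v) / p x, w x * fst (u - v))"
          by (simp add: F_def diff_divide_distrib right_diff_distrib)
        then have "norm (F x u - F x v) \<le> \<bar>snd (u - v) / p x\<bar> + \<bar>w x * fst (u - v)\<bar>"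
          using norm_Pair_le[of "snd (u - v) / p x" "w x * fst (u - v)"] by simp
        also have "\<bar>snd (u - v) / p x\<bar> \<le> norm (u - v)"
        proof -
          have "\<bar>snd (u - v) / p x\<bar> \<le> \<bar>snd (u - v)\<bar> / 1"
            unfolding abs_divide using p(2)[of x] x by (intro divide_left_mono) auto
          also have "\<dots> \<le> norm (u - v)" using le(2)[of "u - v"] by (simp only: div_by_1)
          finally show ?thesis .
        qed
        also have "\<bar>w x * fst (u - v)\<bar> \<le> M * norm (u - v)"
          unfolding abs_mult using M[OF x] abs_ge_zero[of "w x"] by (intro mult_mono le(1)) linarith+
        finally show ?thesis by (simp add: algebra_simps)
      qed
      then show ?thesis by blast
    qed
  qed
  then obtain y where y: "y 0 = (1, 0)"
    "\<And>x. x \<ge> 0 \<Longrightarrow> (y has_vector_derivative F x (y x)) (at x within {0..})"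
    by blast
  have "((\<lambda>x. fst (y x)) has_real_derivative snd (y x) / p x) (at x within {0..})"
    "((\<lambda>x. snd (y x)) has_real_derivative w x * fst (y x)) (at x within {0..})" if "x \<ge> 0" for x
    using bounded_linear.has_vector_derivative[OF bounded_linear_fst y(2)[OF that]]
      bounded_linear.has_vector_derivative[OF bounded_linear_snd y(2)[OF that]]
    by (simp_all add: has_real_derivative_iff_has_vector_derivative F_def)
  with y(1) show ?thesis
    unfolding sturm_solution_def by (intro exI[of _ "\<lambda>x. fst (y x)"] exI[of _ "\<lambda>x. snd (y x)"]) simp
qed

lemma nonincreasing_if_derivative_nonpos:
  fixes f :: "real \<Rightarrow> real"
  assumes der: "\<And>x. a \<le> x \<Longrightarrow> x \<le> b \<Longrightarrow> (f has_real_derivative f' x) (at x within S)"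
    and S: "{a..b} \<subseteq> S" and "a \<le> b" and le: "\<And>x. a < x \<Longrightarrow> x < b \<Longrightarrow> f' x \<le> 0"
  shows "f b \<le> f a"
proof (rule DERIV_nonpos_imp_decreasing_open[OF \<open>a \<le> b\<close>])
  fix x assume x: "a < x" "x < b"
  then have "x \<in> interior S"
    using interior_mono[OF S] by auto
  then have "at x within S = at x" by (rule at_within_interior)
  then show "\<exists>y. (f has_real_derivative y) (at x) \<and> y \<le> 0"
    using der[of x] x le[OF x] by (intro exI[of _ "f' x"]) simp
next
  show "continuous_on {a..b} f"
    unfolding continuous_on_eq_continuous_within
  proof
    fix x assume "x \<in> {a..b}"
    then have "continuous (at x within S) f" using DERIV_continuous[OF der[of x]] by simp
    then show "continuous (at x within {a..b}) f" using S by (rule continuous_within_subset)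
  qed
qed

lemma gronwall:
  fixes g :: "real \<Rightarrow> real"
  assumes der: "\<And>x. 0 \<le> x \<Longrightarrow> x \<le> b \<Longrightarrow> (g has_real_derivative g' x) (at x within {0..})"
    and le: "\<And>x. 0 \<le> x \<Longrightarrow> x \<le> b \<Longrightarrow> g' x \<le> c * g x + d" and c: "c \<noteq> 0" and b: "0 \<le> b"
  shows "g b \<le> (g 0 + d / c) * exp (c * b) - d / c"
proof -
  have "(g b + d / c) * exp (- (c * b)) \<le> (g 0 + d / c) * exp (- (c * 0))"
  proof (rule nonincreasing_if_derivative_nonpos[where S = "{0..}" and a = 0 and b = b
        and f = "\<lambda>x. (g x + d / c) * exp (- (c * x))"
        and f' = "\<lambda>x. (g' x - c * g x - d) * exp (- (c * x))"])
    fix x assume x: "0 \<le> x" "x \<le> b"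
    show "((\<lambda>x. (g x + d / c) * exp (- (c * x))) has_real_derivative
        (g' x - c * g x - d) * exp (- (c * x))) (at x within {0..})"
      using der[OF x] c by (auto intro!: derivative_eq_intros simp: field_simps)
  next
    show "(g' x - c * g x - d) * exp (- (c * x)) \<le> 0" if "0 < x" "x < b" for x
      using le[of x] that by (intro mult_nonpos_nonneg) auto
  qed (use b in auto)
  then have "(g b + d / c) * exp (- (c * b)) * exp (c * b) \<le> (g 0 + d / c) * exp (- (c * 0)) * exp (c * b)"
    by (rule mult_right_mono) simp
  then show ?thesis
    by (simp add: mult.assoc exp_minus del: add_divide_eq_iff)
qed

text \<open>The inhomogeneous term \<open>r\<close> serves to compare solutions for different spectral parameters:
  their difference solves such an equation with zero initial data.\<close>

lemma sturm_energy_upper: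
  assumes p: "\<And>x. 0 \<le> x \<Longrightarrow> p x \<ge> 1" and w: "\<And>x. 0 \<le> x \<Longrightarrow> x \<le> b \<Longrightarrow> \<bar>w x\<bar> \<le> M"
    and f: "\<And>x. 0 \<le> x \<Longrightarrow> (f has_real_derivative q x / p x) (at x within {0..})"
    and q: "\<And>x. 0 \<le> x \<Longrightarrow> (q has_real_derivative w x * f x + r x) (at x within {0..})"
    and r: "\<And>x. 0 \<le> x \<Longrightarrow> x \<le> b \<Longrightarrow> (r x)\<^sup>2 \<le> d" and M: "M \<ge> 0" and b: "0 \<le> b" and d: "0 \<le> d"
  shows "(f b)\<^sup>2 + (q b)\<^sup>2 \<le> ((f 0)\<^sup>2 + (q 0)\<^sup>2 + d) * exp ((2 + M) * b)"
proof -
  let ?E = "\<lambda>x. (f x)\<^sup>2 + (q x)\<^sup>2"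
  have "?E b \<le> (?E 0 + d / (2 + M)) * exp ((2 + M) * b) - d / (2 + M)"
  proof (rule gronwall)
    fix x assume x: "0 \<le> x" "x \<le> b"
    show "(?E has_real_derivative 2 * f x * (q x / p x) + 2 * q x * (w x * f x + r x)) (at x within {0..})"
      using f[OF x(1)] q[OF x(1)] by (auto intro!: derivative_eq_intros)
    have am: "2 * \<bar>f x\<bar> * \<bar>q x\<bar> \<le> ?E x"
      using zero_le_power2[of "\<bar>f x\<bar> - \<bar>q x\<bar>"] by (simp add: power2_eq_square algebra_simps)
    have "2 * f x * (q x / p x) \<le> 2 * \<bar>f x\<bar> * \<bar>q x\<bar>"
    proof -
      have "2 * f x * (q x / p x) \<le> \<bar>2 * f x * q x\<bar> / p x"
        using p[OF x(1)] by (simp add: divide_right_mono)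
      also have "\<dots> \<le> \<bar>2 * f x * q x\<bar> / 1"
        using p[OF x(1)] by (intro divide_left_mono) auto
      finally show ?thesis by (simp add: abs_mult)
    qed
    moreover have "2 * q x * (w x * f x) \<le> M * (2 * \<bar>f x\<bar> * \<bar>q x\<bar>)"
    proof -
      have "2 * q x * (w x * f x) \<le> \<bar>w x\<bar> * (2 * \<bar>f x\<bar> * \<bar>q x\<bar>)"
        using abs_ge_self[of "2 * q x * (w x * f x)"] by (simp add: abs_mult mult_ac)
      also have "\<dots> \<le> M * (2 * \<bar>f x\<bar> * \<bar>q x\<bar>)"
        using w[OF x] by (intro mult_right_mono) auto
      finally show ?thesis .
    qed
    moreover have "M * (2 * \<bar>f x\<bar> * \<bar>q x\<bar>) \<le> M * ?E x"
      using am M by (intro mult_left_mono)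
    moreover have "2 * q x * r x \<le> (q x)\<^sup>2 + (r x)\<^sup>2"
      using zero_le_power2[of "q x - r x"] by (simp add: power2_eq_square algebra_simps)
    ultimately have "2 * f x * (q x / p x) + (2 * q x * (w x * f x) + 2 * q x * r x) \<le>
        ?E x + (M * ?E x + ((q x)\<^sup>2 + (r x)\<^sup>2))"
      using am by (intro add_mono) (auto elim: order.trans)
    also have "\<dots> \<le> (2 + M) * ?E x + d"
      using r[OF x] by (simp add: algebra_simps add_increasing2)
    finally show "2 * f x * (q x / p x) + 2 * q x * (w x * f x + r x) \<le> (2 + M) * ?E x + d"
      by (simp only: distrib_left)
  qed (use M b in auto)
  also have "\<dots> \<le> (?E 0 + d) * exp ((2 + M) * b)"
  proof -
    have "d / (2 + M) \<le> d / 1" using M d by (intro divide_left_mono) auto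
    moreover have "d / (2 + M) \<ge> 0" using M d by simp
    ultimately have "(?E 0 + d / (2 + M)) * exp ((2 + M) * b) \<le> (?E 0 + d) * exp ((2 + M) * b)"
      by (intro mult_right_mono) auto
    with \<open>d / (2 + M) \<ge> 0\<close> show ?thesis by linarith
  qed
  finally show ?thesis .
qed

text \<open>Since \<open>f\<^sup>2 + q\<^sup>2\<close> decays at most exponentially, a solution with \<open>f 0 = 1\<close> has no
  double zero; this is the form in which uniqueness enters the shooting argument.\<close>

lemma sturm_energy_pos:
  assumes p: "\<And>x. 0 \<le> x \<Longrightarrow> p x \<ge> 1" and w: "\<And>x. 0 \<le> x \<Longrightarrow> x \<le> b \<Longrightarrow> \<bar>w x\<bar> \<le> M"
    and S: "sturm_solution p w f q" and M: "M \<ge> 0" and b: "0 \<le> b"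
  shows "(f b)\<^sup>2 + (q b)\<^sup>2 > 0"
proof -
  let ?E = "\<lambda>x. (f x)\<^sup>2 + (q x)\<^sup>2"
  have "- ?E b \<le> (- ?E 0 + 0 / (- (1 + M))) * exp (- (1 + M) * b) - 0 / (- (1 + M))"
  proof (rule gronwall)
    fix x assume x: "0 \<le> x" "x \<le> b"
    have f: "(f has_real_derivative q x / p x) (at x within {0..})"
      and q: "(q has_real_derivative w x * f x) (at x within {0..})"
      using S x by (auto simp: sturm_solution_def)
    show "((\<lambda>x. - ?E x) has_real_derivative - (2 * f x * (q x / p x) + 2 * q x * (w x * f x))) (at x within {0..})"
      using f q by (auto intro!: derivative_eq_intros)
    have am: "2 * \<bar>f x\<bar> * \<bar>q x\<bar> \<le> ?E x"
      using zero_le_power2[of "\<bar>f x\<bar> - \<bar>q x\<bar>"] by (simp add: power2_eq_square algebra_simps)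
    have "- (2 * f x * (q x / p x)) \<le> 2 * \<bar>f x\<bar> * \<bar>q x\<bar>"
    proof -
      have "- (2 * f x * (q x / p x)) \<le> \<bar>2 * f x * q x\<bar> / p x"
        using p[OF x(1)] abs_ge_minus_self[of "2 * f x * (q x / p x)"] by (simp add: abs_mult)
      also have "\<dots> \<le> \<bar>2 * f x * q x\<bar> / 1"
        using p[OF x(1)] by (intro divide_left_mono) auto
      finally show ?thesis by (simp add: abs_mult)
    qed
    moreover have "- (2 * q x * (w x * f x)) \<le> M * (2 * \<bar>f x\<bar> * \<bar>q x\<bar>)"
    proof -
      have "- (2 * q x * (w x * f x)) \<le> \<bar>w x\<bar> * (2 * \<bar>f x\<bar> * \<bar>q x\<bar>)"
        using abs_ge_minus_self[of "2 * q x * (w x * f x)"] by (simp add: abs_mult mult_ac)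
      also have "\<dots> \<le> M * (2 * \<bar>f x\<bar> * \<bar>q x\<bar>)"
        using w[OF x] by (intro mult_right_mono) auto
      finally show ?thesis .
    qed
    moreover have "M * (2 * \<bar>f x\<bar> * \<bar>q x\<bar>) \<le> M * ?E x"
      using am M by (intro mult_left_mono)
    moreover have "- (1 + M) * (- ?E x) = ?E x + M * ?E x"
      by (simp add: algebra_simps)
    ultimately show "- (2 * f x * (q x / p x) + 2 * q x * (w x * f x)) \<le> - (1 + M) * (- ?E x) + 0"
      using am by linarith
  qed (use M b in auto)
  then have "?E b \<ge> exp (- (1 + M) * b)"
    using S by (simp add: sturm_solution_def)
  then show ?thesis
    using exp_gt_zero[of "- (1 + M) * b"] by linarith
qed


section \<open>The ground state by shooting\<close>

text \<open>On functions \<open>exp (\<i> \<tau> t) f(x)\<close> the operator \<open>Z1\<^sup>* Z1 + Z2\<^sup>* Z2\<close> acts on the profile as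
  \<open>f \<mapsto> - (weight f')' + potential f\<close>. Without the contribution of \<open>Z2\<close> this is the harmonic
  oscillator \<open>- f'' + (\<tau>\<^sup>2 x\<^sup>2 - \<tau>) f\<close>, which annihilates \<open>exp (- \<tau> x\<^sup>2 / 2)\<close>.\<close>

definition weight :: "nat \<Rightarrow> real \<Rightarrow> real"
  where "weight k x = 1 + x ^ (2 * k)"

definition potential :: "nat \<Rightarrow> real \<Rightarrow> real \<Rightarrow> real"
  where "potential k \<tau> x = weight k x * \<tau>\<^sup>2 * x\<^sup>2 + \<tau> * ((2 * real k + 1) * x ^ (2 * k) - 1)"

lemma weight_ge_1: "weight k x \<ge> 1"
  by (simp add: weight_def power_mult)

lemma continuous_on_weight: "continuous_on S (weight k)"
  and continuous_on_potential: "continuous_on S (potential k \<tau>)"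
  unfolding weight_def[abs_def] potential_def[abs_def] by (intro continuous_intros)+

lemma potential_mono:
  assumes "0 \<le> x" "x \<le> y" "\<tau> \<ge> 0"
  shows "potential k \<tau> x \<le> potential k \<tau> y"
proof -
  have p: "x ^ n \<le> y ^ n" for n using assms by (intro power_mono)
  have "weight k x * \<tau>\<^sup>2 * x\<^sup>2 \<le> weight k y * \<tau>\<^sup>2 * y\<^sup>2"
    using p[of "2 * k"] p[of 2] weight_ge_1[of k x] weight_ge_1[of k y]
    by (intro mult_mono) (auto simp: weight_def)
  moreover have "\<tau> * ((2 * real k + 1) * x ^ (2 * k) - 1) \<le> \<tau> * ((2 * real k + 1) * y ^ (2 * k) - 1)"
    using assms(3) p[of "2 * k"] by (intro mult_left_mono diff_right_mono) auto
  ultimately show ?thesis unfolding potential_def by linarith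
qed

lemma potential_bounds:
  assumes "0 \<le> x" "x \<le> 1" "\<tau> \<ge> 0"
  shows "- \<tau> \<le> potential k \<tau> x" "potential k \<tau> x \<le> 2 * \<tau>\<^sup>2 + 2 * real k * \<tau>"
proof -
  have "potential k \<tau> 0 \<ge> - \<tau>" using assms by (cases k) (simp_all add: potential_def)
  then show "- \<tau> \<le> potential k \<tau> x"
    using potential_mono[of 0 x \<tau> k] assms by linarith
  have "potential k \<tau> 1 = 2 * \<tau>\<^sup>2 + 2 * real k * \<tau>"
    by (simp add: potential_def weight_def)
  then show "potential k \<tau> x \<le> 2 * \<tau>\<^sup>2 + 2 * real k * \<tau>"
    using potential_mono[of x 1 \<tau> k] assms by linarith
qed

text \<open>A positive solution bounds \<open>\<Lambda>\<close> by the Rayleigh quotient of every trial function \<open>g\<close> that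
  vanishes at \<open>1\<close>. Take \<open>g = exp (- \<tau> x\<^sup>2 / 2) (1 - x\<^sup>2)\<close>: its first factor is annihilated by
  \<open>d/dx + \<tau> x\<close> and concentrated where \<open>\<bar>x\<bar>\<close> is at most of order \<open>\<tau> powr (- 1 / 2)\<close>, so that
  \<open>x\<^sup>k (d/dx - \<tau> x) g\<close> stays of the size of \<open>g\<close> in the mean, because \<open>k \<ge> 1\<close>. With
  \<open>v = q / f\<close>, which solves a Riccati equation, the comparison of the integrals amounts to the
  monotonicity of one function \<open>\<Psi>\<close>, which would have to decrease from \<open>0\<close> to a positive
  value.\<close>

lemma positive_solution_bound:
  assumes k: "k \<ge> 1" and \<tau>: "\<tau> \<ge> 2"
    and S: "sturm_solution (weight k) (\<lambda>x. potential k \<tau> x - \<Lambda>) f q"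
    and pos: "\<And>x. 0 \<le> x \<Longrightarrow> x \<le> 1 \<Longrightarrow> f x > 0"
  shows "\<Lambda> \<le> 28"
proof (rule ccontr)
  assume "\<not> \<Lambda> \<le> 28"
  then have \<Lambda>: "\<Lambda> > 28" by simp
  define E where "E x = exp (- (\<tau> * x\<^sup>2))" for x
  define G where "G x = E x * (1 - x\<^sup>2)\<^sup>2" for x
  \<comment> \<open>The derivative of \<open>B E\<close> does the work of integration by parts against the Gaussian \<open>E\<close>: the cubic
    term removes the quartic error \<open>16 \<tau>\<^sup>2 x\<^sup>4\<close>, the linear term the quadratic ones, at the price
    of the constant \<open>27\<close>, which \<open>- \<Lambda>\<close> outweighs.\<close>
  define B where "B x = 8 * \<tau> * x ^ 3 + 27 * x" for x
  define v where "v x = q x / f x" for x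
  define \<Psi> where "\<Psi> x = (v x + \<tau> * (x - x ^ (2 * k + 1))) * G x + B x * E x" for x
  let ?p = "weight k" and ?P = "\<lambda>x. x ^ (2 * k)"
  define v' where "v' x = (potential k \<tau> x - \<Lambda>) - (v x)\<^sup>2 / ?p x" for x
  define s where "s x = - \<tau> * x * (1 - x\<^sup>2) - 2 * x" for x
  define D where "D x = (v' x + \<tau> * (1 - (2 * real k + 1) * ?P x)) * G x +
      (v x + \<tau> * (x - x ^ (2 * k + 1))) * (2 * E x * (1 - x\<^sup>2) * s x) +
      (24 * \<tau> * x\<^sup>2 + 27 - 2 * \<tau> * x * B x) * E x" for x
  have der: "(\<Psi> has_real_derivative D x) (at x within {0..})" if x: "0 \<le> x" "x \<le> 1" for x
  proof -
    have f: "(f has_real_derivative q x / ?p x) (at x within {0..})"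
      and q: "(q has_real_derivative (potential k \<tau> x - \<Lambda>) * f x) (at x within {0..})"
      using S x(1) by (auto simp: sturm_solution_def)
    have fx: "f x \<noteq> 0" using pos[OF x] by simp
    have px: "?p x \<noteq> 0" using weight_ge_1[of k x] by linarith
    have v: "(v has_real_derivative v' x) (at x within {0..})"
    proof -
      have "(v has_real_derivative ((potential k \<tau> x - \<Lambda>) * f x * f x - q x * (q x / ?p x)) / (f x * f x)) (at x within {0..})"
        unfolding v_def[abs_def] by (rule DERIV_divide[OF q f fx])
      moreover have "((potential k \<tau> x - \<Lambda>) * f x * f x - q x * (q x / ?p x)) / (f x * f x) = v' x"
        using fx px by (simp add: v'_def v_def power2_eq_square field_simps)
      ultimately show ?thesis by simp
    qed
    have E: "(E has_real_derivative - 2 * \<tau> * x * E x) (at x within {0..})"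
      unfolding E_def[abs_def] by (auto intro!: derivative_eq_intros)
    have h: "((\<lambda>x. (1 - x\<^sup>2)\<^sup>2) has_real_derivative - 4 * x * (1 - x\<^sup>2)) (at x within {0..})"
      by (auto intro!: derivative_eq_intros)
    have G: "(G has_real_derivative 2 * E x * (1 - x\<^sup>2) * s x) (at x within {0..})"
    proof -
      have "(G has_real_derivative - 2 * \<tau> * x * E x * (1 - x\<^sup>2)\<^sup>2 + - 4 * x * (1 - x\<^sup>2) * E x) (at x within {0..})"
        unfolding G_def[abs_def] by (rule DERIV_mult[OF E h])
      moreover have "- 2 * \<tau> * x * E x * (1 - x\<^sup>2)\<^sup>2 + - 4 * x * (1 - x\<^sup>2) * E x = 2 * E x * (1 - x\<^sup>2) * s x"
        by (simp add: s_def power2_eq_square algebra_simps)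
      ultimately show ?thesis by simp
    qed
    have P: "((\<lambda>x. \<tau> * (x - x ^ (2 * k + 1))) has_real_derivative \<tau> * (1 - (2 * real k + 1) * ?P x)) (at x within {0..})"
    proof -
      have "((\<lambda>x. x ^ (2 * k + 1)) has_real_derivative (2 * real k + 1) * ?P x) (at x within {0..})"
        using DERIV_pow[of "2 * k + 1" x "{0..}"] by (simp add: add.commute)
      then show ?thesis
        by (intro DERIV_cmult DERIV_diff DERIV_ident)
    qed
    have B: "(B has_real_derivative 24 * \<tau> * x\<^sup>2 + 27) (at x within {0..})"
      unfolding B_def[abs_def] by (auto intro!: derivative_eq_intros simp: power2_eq_square)
    have "(\<Psi> has_real_derivative
        (v' x + \<tau> * (1 - (2 * real k + 1) * ?P x)) * G x +
        2 * E x * (1 - x\<^sup>2) * s x * (v x + \<tau> * (x - x ^ (2 * k + 1))) +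
        ((24 * \<tau> * x\<^sup>2 + 27) * E x + - 2 * \<tau> * x * E x * B x)) (at x within {0..})"
      unfolding \<Psi>_def[abs_def]
      by (intro DERIV_add[OF DERIV_mult[OF DERIV_add[OF v P] G] DERIV_mult[OF B E]])
    then show ?thesis
      by (rule DERIV_cong) (simp add: D_def algebra_simps)
  qed
  have le: "D x \<le> 0" if x: "0 < x" "x < 1" for x
  proof -
    let ?h = "1 - x\<^sup>2" and ?V = "v x"
    have x2: "x\<^sup>2 \<le> 1" using x by (simp add: power_le_one)
    have px: "?p x > 0" using weight_ge_1[of k x] by linarith
    have Ppos: "?P x \<ge> 0" using x by simp
    have Ple: "?P x \<le> x\<^sup>2" using x k by (intro power_decreasing) auto
    have p: "?p x = 1 + ?P x" by (simp add: weight_def)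
    have odd: "x ^ (2 * k + 1) = x * ?P x" by simp
    define X where "X = v' x * ?h\<^sup>2 + \<tau> * (1 - (2 * real k + 1) * ?P x) * ?h\<^sup>2 +
        2 * (?V + \<tau> * x * (1 - ?P x)) * ?h * s x + (24 * \<tau> * x\<^sup>2 + 27 - 2 * \<tau> * x * B x)"
    have DX: "D x = E x * X"
      unfolding D_def X_def G_def odd by (simp add: algebra_simps)
    \<comment> \<open>Completing the square eliminates \<open>v\<close> and leaves the quadratic form of the trial function.\<close>
    have "2 * ?V * ?h * s x - (?V * ?h)\<^sup>2 / ?p x \<le> ?p x * (s x)\<^sup>2"
    proof -
      have "(?V * ?h)\<^sup>2 / ?p x - 2 * ?V * ?h * s x + ?p x * (s x)\<^sup>2 = (?V * ?h - ?p x * s x)\<^sup>2 / ?p x"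
        using px by (simp add: power2_eq_square field_simps)
      also have "\<dots> \<ge> 0" using px by simp
      finally show ?thesis by linarith
    qed
    moreover have "X = ?p x * \<tau>\<^sup>2 * x\<^sup>2 * ?h\<^sup>2 - \<Lambda> * ?h\<^sup>2 + (2 * ?V * ?h * s x - (?V * ?h)\<^sup>2 / ?p x) +
        2 * \<tau> * x * (1 - ?P x) * ?h * s x + (24 * \<tau> * x\<^sup>2 + 27 - 2 * \<tau> * x * B x)"
      unfolding X_def v'_def potential_def
      unfolding power_mult_distrib by (simp add: algebra_simps)
    ultimately have "X \<le> ?p x * \<tau>\<^sup>2 * x\<^sup>2 * ?h\<^sup>2 - \<Lambda> * ?h\<^sup>2 + ?p x * (s x)\<^sup>2 +
        2 * \<tau> * x * (1 - ?P x) * ?h * s x + (24 * \<tau> * x\<^sup>2 + 27 - 2 * \<tau> * x * B x)"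
      by linarith
    also have "\<dots> = 4 * x\<^sup>2 + ?P x * (4 * x\<^sup>2 * (1 + \<tau> * ?h)\<^sup>2) - \<Lambda> * ?h\<^sup>2 +
        (24 * \<tau> * x\<^sup>2 + 27 - 2 * \<tau> * x * B x)"
      unfolding p s_def by (simp add: algebra_simps power2_eq_square)
    finally have X: "X \<le> 4 * x\<^sup>2 + ?P x * (4 * x\<^sup>2 * (1 + \<tau> * ?h)\<^sup>2) - \<Lambda> * ?h\<^sup>2 +
        (24 * \<tau> * x\<^sup>2 + 27 - 2 * \<tau> * x * B x)" .
    have "?P x * (4 * x\<^sup>2 * (1 + \<tau> * ?h)\<^sup>2) \<le> x\<^sup>2 * (4 * x\<^sup>2 * (2 * \<tau>)\<^sup>2)"
    proof (intro mult_mono Ple)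
      have "\<tau> * ?h \<le> \<tau> * 1" using \<tau> by (intro mult_left_mono) auto
      then have "1 + \<tau> * ?h \<le> 2 * \<tau>" using \<tau> by linarith
      moreover have "\<tau> * ?h \<ge> 0" using \<tau> x2 by simp
      ultimately show "(1 + \<tau> * ?h)\<^sup>2 \<le> (2 * \<tau>)\<^sup>2"
        using \<tau> by (intro power_mono) auto
    qed auto
    moreover have "\<Lambda> * ?h\<^sup>2 \<ge> 28 * (1 - 2 * x\<^sup>2)"
    proof -
      have "28 * (1 - 2 * x\<^sup>2) \<le> 28 * ?h\<^sup>2"
        using zero_le_square[of "x * x"] by (simp add: power2_eq_square algebra_simps)
      also have "\<dots> \<le> \<Lambda> * ?h\<^sup>2" using \<Lambda> by (intro mult_right_mono) auto
      finally show ?thesis .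
    qed
    ultimately have "X \<le> 4 * x\<^sup>2 + x\<^sup>2 * (4 * x\<^sup>2 * (2 * \<tau>)\<^sup>2) - 28 * (1 - 2 * x\<^sup>2) +
        (24 * \<tau> * x\<^sup>2 + 27 - 2 * \<tau> * x * B x)"
      using X by linarith
    also have "\<dots> = (60 - 30 * \<tau>) * x\<^sup>2 - 1"
      unfolding B_def by (simp add: algebra_simps power2_eq_square power3_eq_cube)
    also have "\<dots> \<le> 0"
      using \<tau> mult_nonpos_nonneg[of "60 - 30 * \<tau>" "x\<^sup>2"] by simp
    finally show ?thesis
      unfolding DX using mult_nonneg_nonpos[of "E x" X] by (simp add: E_def)
  qed
  have "\<Psi> 1 \<le> \<Psi> 0"
    by (rule nonincreasing_if_derivative_nonpos[OF der _ _ le]) auto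
  moreover have "\<Psi> 0 = 0"
    using S by (simp add: \<Psi>_def v_def B_def sturm_solution_def)
  moreover have "\<Psi> 1 > 0"
    using \<tau> by (simp add: \<Psi>_def G_def B_def E_def)
  ultimately show False by linarith
qed

text \<open>For \<open>w \<ge> 0\<close> first \<open>f q\<close> and then \<open>f\<^sup>2\<close> is nondecreasing.\<close>

lemma solution_positive:
  assumes S: "sturm_solution p w f q" and p: "\<And>x. 0 \<le> x \<Longrightarrow> p x \<ge> 1"
    and w: "\<And>x. 0 \<le> x \<Longrightarrow> x \<le> 1 \<Longrightarrow> w x \<ge> 0" and x: "0 \<le> x" "x \<le> 1"
  shows "f x > 0"
proof -
  have f: "(f has_real_derivative q x / p x) (at x within {0..})"
    and q: "(q has_real_derivative w x * f x) (at x within {0..})" if "0 \<le> x" for x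
    using S that by (auto simp: sturm_solution_def)
  have 0: "f 0 = 1" "q 0 = 0" using S by (auto simp: sturm_solution_def)
  have fq: "f x * q x \<ge> 0" if x: "0 \<le> x" "x \<le> 1" for x
  proof -
    have "- (f x * q x) \<le> - (f 0 * q 0)"
    proof (rule nonincreasing_if_derivative_nonpos[where S = "{0..}" and f = "\<lambda>x. - (f x * q x)"
          and f' = "\<lambda>x. - (q x / p x * q x + w x * f x * f x)"])
      show "((\<lambda>x. - (f x * q x)) has_real_derivative - (q y / p y * q y + w y * f y * f y)) (at y within {0..})"
        if "0 \<le> y" for y
        by (intro DERIV_minus DERIV_mult f q that)
      show "- (q y / p y * q y + w y * f y * f y) \<le> 0" if y: "0 < y" "y < x" for y
      proof -
        have "q y / p y * q y = (q y)\<^sup>2 / p y" by (simp add: power2_eq_square)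
        moreover have "(q y)\<^sup>2 / p y \<ge> 0" using p[of y] y by simp
        moreover have "w y * f y * f y \<ge> 0"
          using w[of y] y x by (simp add: mult.assoc)
        ultimately show ?thesis by linarith
      qed
    qed (use x in auto)
    then show ?thesis using 0 by simp
  qed
  have f2: "(f x)\<^sup>2 \<ge> 1" if x: "0 \<le> x" "x \<le> 1" for x
  proof -
    have "- (f x)\<^sup>2 \<le> - (f 0)\<^sup>2"
    proof (rule nonincreasing_if_derivative_nonpos[where S = "{0..}" and f = "\<lambda>x. - (f x)\<^sup>2"
          and f' = "\<lambda>x. - (2 * (f x * q x) / p x)"])
      show "((\<lambda>x. - (f x)\<^sup>2) has_real_derivative - (2 * (f y * q y) / p y)) (at y within {0..})"
        if "0 \<le> y" for y
        using f[OF that] by (auto intro!: derivative_eq_intros)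
      show "- (2 * (f y * q y) / p y) \<le> 0" if y: "0 < y" "y < x" for y
        using fq[of y] p[of y] y x by simp
    qed (use x in auto)
    then show ?thesis using 0 by simp
  qed
  show ?thesis
  proof (rule ccontr)
    assume "\<not> f x > 0"
    then have "f x \<le> 0" by simp
    moreover have "continuous_on {0..x} f"
      unfolding continuous_on_eq_continuous_within
      using DERIV_continuous[OF f] continuous_within_subset[of _ "{0..}" f "{0..x}"] by simp
    ultimately obtain y where "0 \<le> y" "y \<le> x" "f y = 0"
      using IVT2'[of f x 0 0] 0 x by auto
    then show False using f2[of y] x by simp
  qed
qed

text \<open>Shooting: the parameter is raised until the solution is about to lose its positivity on
  \<open>[0, 1]\<close>. The critical solution is non-negative and, having no double zero, vanishes only at the
  end point. Since the potential increases, \<open>q\<close> first decreases from \<open>0\<close> and then increases to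
  \<open>q 1 \<le> 0\<close>; so it is never positive, and \<open>f\<close> decreases from \<open>1\<close> to \<open>0\<close>. The bound \<open>f \<le> 1\<close>
  is what prevents exponential growth in \<open>\<tau>\<close>.\<close>

lemma bounded_ground_state:
  assumes k: "k \<ge> 1" and \<tau>: "\<tau> \<ge> 2"
  obtains \<Lambda> f q where "\<Lambda> \<le> 28"
    "sturm_solution (weight k) (\<lambda>x. potential k \<tau> x - \<Lambda>) f q"
    "\<And>x. 0 \<le> x \<Longrightarrow> x \<le> 1 \<Longrightarrow> 0 \<le> f x \<and> f x \<le> 1"
proof -
  let ?p = "weight k" and ?w = "\<lambda>L x. potential k \<tau> x - L"
  have "\<exists>f q. sturm_solution ?p (?w L) f q" for L
    by (intro sturm_solution_exists continuous_on_weight weight_ge_1 continuous_intros continuous_on_potential)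
  then obtain f q where S: "\<And>L. sturm_solution ?p (?w L) (f L) (q L)"
    by metis
  have f: "(f L has_real_derivative q L x / ?p x) (at x within {0..})"
    and q: "(q L has_real_derivative ?w L x * f L x) (at x within {0..})" if "0 \<le> x" for L x
    using S[of L] that by (auto simp: sturm_solution_def)
  have 0: "f L 0 = 1" "q L 0 = 0" for L
    using S[of L] by (auto simp: sturm_solution_def)
  have cf: "continuous_on {0..1} (f L)" for L
    unfolding continuous_on_eq_continuous_within
    using DERIV_continuous[OF f] continuous_within_subset[of _ "{0..}" "f L" "{0..1}"] by simp
  define M where "M = 2 * \<tau>\<^sup>2 + 2 * real k * \<tau> + \<tau> + 29"
  have M0: "M \<ge> 0" using \<tau> by (simp add: M_def)
  have wM: "\<bar>?w L x\<bar> \<le> M" if "0 \<le> x" "x \<le> 1" "- \<tau> \<le> L" "L \<le> 29" for L x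
  proof -
    have *: "0 \<le> \<tau>\<^sup>2" "0 \<le> 2 * real k * \<tau>" "0 \<le> \<tau>" using \<tau> by simp_all
    show ?thesis
      unfolding M_def abs_le_iff using potential_bounds[OF that(1,2) *(3), of k] that(3,4) *
      by (intro conjI) linarith+
  qed
  define C where "C = exp (2 + M)"
  have C: "C > 0" by (simp add: C_def)
  have bound: "(f L x)\<^sup>2 \<le> C" if "0 \<le> x" "x \<le> 1" "- \<tau> \<le> L" "L \<le> 29" for L x
  proof -
    have "(f L x)\<^sup>2 + (q L x)\<^sup>2 \<le> ((f L 0)\<^sup>2 + (q L 0)\<^sup>2 + 0) * exp ((2 + M) * x)"
      by (rule sturm_energy_upper[where p = ?p and w = "?w L" and r = "\<lambda>_. 0"])
        (use that M0 wM f q weight_ge_1 in auto)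
    also have "\<dots> \<le> C"
      using that M0 mult_left_mono[of x 1 "2 + M"] by (simp add: 0 C_def)
    finally show ?thesis using zero_le_power2[of "q L x"] by linarith
  qed
  have lip: "\<bar>f L x - f L' x\<bar> \<le> \<bar>L - L'\<bar> * C"
    if x: "0 \<le> x" "x \<le> 1" and L: "- \<tau> \<le> L" "L \<le> 29" and L': "- \<tau> \<le> L'" "L' \<le> 29" for L L' x
  proof -
    have "(f L x - f L' x)\<^sup>2 + (q L x - q L' x)\<^sup>2 \<le>
        ((f L 0 - f L' 0)\<^sup>2 + (q L 0 - q L' 0)\<^sup>2 + (L - L')\<^sup>2 * C) * exp ((2 + M) * x)"
    proof (rule sturm_energy_upper[where p = ?p and w = "?w L" and r = "\<lambda>x. (L' - L) * f L' x"
          and f = "\<lambda>x. f L x - f L' x" and q = "\<lambda>x. q L x - q L' x"])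
      show "((\<lambda>x. f L x - f L' x) has_real_derivative (q L x - q L' x) / ?p x) (at x within {0..})"
        if "0 \<le> x" for x
        using DERIV_diff[OF f[OF that, of L] f[OF that, of L']] by (simp add: diff_divide_distrib)
      show "((\<lambda>x. q L x - q L' x) has_real_derivative
          ?w L x * (f L x - f L' x) + (L' - L) * f L' x) (at x within {0..})" if "0 \<le> x" for x
        using DERIV_diff[OF q[OF that, of L] q[OF that, of L']] by (simp add: algebra_simps)
      show "((L' - L) * f L' y)\<^sup>2 \<le> (L - L')\<^sup>2 * C" if "0 \<le> y" "y \<le> x" for y
        unfolding power_mult_distrib power2_commute[of L'] using bound[of y L'] that x L'
        by (intro mult_left_mono) auto
    qed (use x L M0 C wM weight_ge_1 in auto)
    also have "\<dots> \<le> ((L - L')\<^sup>2 * C) * C"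
      unfolding 0 using C x M0 mult_left_mono[of x 1 "2 + M"]
      by (auto simp: C_def intro!: mult_left_mono)
    also have "\<dots> = ((L - L') * C)\<^sup>2" by (simp add: power2_eq_square)
    finally have "(f L x - f L' x)\<^sup>2 \<le> ((L - L') * C)\<^sup>2"
      using zero_le_power2[of "q L x - q L' x"] by linarith
    then have "\<bar>f L x - f L' x\<bar> \<le> \<bar>(L - L') * C\<bar>"
      by (simp only: abs_le_square_iff)
    then show ?thesis using C by (simp add: abs_mult)
  qed
  define P where "P = {L. \<forall>x. 0 \<le> x \<longrightarrow> x \<le> 1 \<longrightarrow> f L x > 0}"
  have P28: "L \<le> 28" if "L \<in> P" for L
    using that by (intro positive_solution_bound[OF k \<tau> S[of L]]) (auto simp: P_def)
  \<comment> \<open>At \<open>- \<tau>\<close>, the minimum of the potential, the equation does not oscillate.\<close>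
  have P\<tau>: "- \<tau> \<in> P"
  proof -
    have w: "?w (- \<tau>) x \<ge> 0" if "0 \<le> x" "x \<le> 1" for x
      using potential_bounds(1)[OF that, of \<tau> k] \<tau> by linarith
    have "f (- \<tau>) x > 0" if "0 \<le> x" "x \<le> 1" for x
      by (rule solution_positive[OF S weight_ge_1 w that])
    then show ?thesis by (simp add: P_def)
  qed
  have bdd: "bdd_above P" by (rule bdd_aboveI[OF P28])
  define \<Lambda> where "\<Lambda> = Sup P"
  have \<Lambda>: "- \<tau> \<le> \<Lambda>" "\<Lambda> \<le> 28"
    unfolding \<Lambda>_def using P\<tau> P28 bdd by (auto intro: cSup_upper cSup_least)
  have \<Lambda>29: "\<Lambda> \<le> 29" using \<Lambda> by simp
  have nonneg: "f \<Lambda> x \<ge> 0" if x: "0 \<le> x" "x \<le> 1" for x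
  proof (rule field_le_epsilon)
    fix e :: real assume e: "e > 0"
    then have "Sup P - e / C < Sup P" using C by simp
    then obtain L where L: "L \<in> P" "\<Lambda> - e / C < L"
      unfolding \<Lambda>_def using P\<tau> less_cSup_iff[OF _ bdd] by blast
    define L' where "L' = max L (- \<tau>)"
    have L': "L' \<in> P" "\<Lambda> - e / C < L'" "- \<tau> \<le> L'"
      using L P\<tau> by (auto simp: L'_def max_def)
    have L\<Lambda>: "L' \<le> \<Lambda>" unfolding \<Lambda>_def by (intro cSup_upper L' bdd)
    have "\<bar>f L' x - f \<Lambda> x\<bar> \<le> \<bar>L' - \<Lambda>\<bar> * C"
      using L' L\<Lambda> \<Lambda> \<Lambda>29 by (intro lip x) auto
    also have "\<dots> \<le> (e / C) * C"
      using L' L\<Lambda> C by (intro mult_right_mono) auto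
    also have "\<dots> = e" using C by simp
    finally have "f L' x \<le> f \<Lambda> x + e" by linarith
    moreover have "f L' x > 0" using L' x by (auto simp: P_def)
    ultimately show "0 \<le> f \<Lambda> x + e" by linarith
  qed
  have "\<exists>x. 0 \<le> x \<and> x \<le> 1 \<and> f \<Lambda> x = 0"
  proof (rule ccontr)
    assume "\<not> ?thesis"
    then have pos: "f \<Lambda> x > 0" if "0 \<le> x" "x \<le> 1" for x
      using nonneg[OF that] that by (metis order_le_less)
    obtain m where m: "m \<in> {0..1}" "\<And>x. x \<in> {0..1} \<Longrightarrow> f \<Lambda> m \<le> f \<Lambda> x"
      using continuous_attains_inf[OF _ _ cf] by (metis atLeastAtMost_iff compact_Icc empty_iff order_refl zero_le_one)
    define e where "e = min 1 (f \<Lambda> m / (2 * C))"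
    have e: "e > 0" "e \<le> 1" "e * C < f \<Lambda> m"
    proof -
      show "e > 0" "e \<le> 1" using pos[of m] m C by (auto simp: e_def)
      have "e * C \<le> f \<Lambda> m / (2 * C) * C" using C by (intro mult_right_mono) (auto simp: e_def)
      also have "\<dots> < f \<Lambda> m" using pos[of m] m C by simp
      finally show "e * C < f \<Lambda> m" .
    qed
    have "\<Lambda> + e \<in> P"
      unfolding P_def
    proof (intro CollectI allI impI)
      fix x :: real assume x: "0 \<le> x" "x \<le> 1"
      have "\<bar>f (\<Lambda> + e) x - f \<Lambda> x\<bar> \<le> \<bar>\<Lambda> + e - \<Lambda>\<bar> * C"
        using e \<Lambda> by (intro lip x) auto
      then show "f (\<Lambda> + e) x > 0" using e m(2)[of x] x by auto
    qed
    then have "\<Lambda> + e \<le> \<Lambda>"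
      unfolding \<Lambda>_def by (intro cSup_upper bdd)
    with e show False by simp
  qed
  then obtain z where z: "0 \<le> z" "z \<le> 1" "f \<Lambda> z = 0" by blast
  have z0: "z > 0" using z 0[of \<Lambda>] by (cases "z = 0") auto
  have z1: "z = 1"
  proof (rule ccontr)
    assume "z \<noteq> 1"
    then have zi: "0 < z" "z < 1" using z z0 by auto
    have "at z within {0..} = at z" using zi by (intro at_within_interior) simp
    then have "(f \<Lambda> has_real_derivative q \<Lambda> z / ?p z) (at z)"
      using f[OF z(1), of \<Lambda>] by simp
    then have "q \<Lambda> z / ?p z = 0"
      by (rule DERIV_local_min[where d = "min z (1 - z)"]) (use zi z nonneg in auto)
    then have "q \<Lambda> z = 0" using weight_ge_1[of k z] by simp
    then show False
      using sturm_energy_pos[of ?p z "?w \<Lambda>" M "f \<Lambda>" "q \<Lambda>"] S[of \<Lambda>] M0 wM weight_ge_1 z \<Lambda> \<Lambda>29 by simp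
  qed
  have q1: "q \<Lambda> 1 \<le> 0"
  proof (rule ccontr)
    assume "\<not> q \<Lambda> 1 \<le> 0"
    then have "q \<Lambda> 1 / ?p 1 > 0" using weight_ge_1[of k 1] by simp
    moreover have "(f \<Lambda> has_real_derivative q \<Lambda> 1 / ?p 1) (at 1)"
    proof -
      have "at (1::real) within {0..} = at 1" by (intro at_within_interior) simp
      then show ?thesis using f[of 1 \<Lambda>] by simp
    qed
    ultimately obtain d where d: "d > 0" "\<And>h. 0 < h \<Longrightarrow> h < d \<Longrightarrow> f \<Lambda> (1 - h) < f \<Lambda> 1"
      using DERIV_pos_inc_left by blast
    define h where "h = min (d / 2) 1"
    have "f \<Lambda> (1 - h) < f \<Lambda> 1" using d by (intro d(2)) (auto simp: h_def min_def)
    moreover have "f \<Lambda> (1 - h) \<ge> 0" using d by (intro nonneg) (auto simp: h_def)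
    ultimately show False using z z1 by simp
  qed
  have qneg: "q \<Lambda> x \<le> 0" if x: "0 < x" "x < 1" for x
  proof (rule ccontr)
    assume qx: "\<not> q \<Lambda> x \<le> 0"
    have "\<exists>y. 0 < y \<and> y < x \<and> ?w \<Lambda> y > 0"
    proof (rule ccontr)
      assume "\<not> ?thesis"
      then have "?w \<Lambda> y \<le> 0" if "0 < y" "y < x" for y using that by force
      then have "q \<Lambda> x \<le> q \<Lambda> 0"
        using x nonneg by (intro nonincreasing_if_derivative_nonpos[OF q]) (auto intro!: mult_nonpos_nonneg)
      with qx 0 show False by simp
    qed
    then obtain y where y: "0 < y" "y < x" "?w \<Lambda> y > 0" by blast
    have "- q \<Lambda> 1 \<le> - q \<Lambda> x"
    proof (rule nonincreasing_if_derivative_nonpos[where S = "{0..}" and f = "\<lambda>x. - q \<Lambda> x"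
          and f' = "\<lambda>z. - (?w \<Lambda> z * f \<Lambda> z)"])
      show "((\<lambda>x. - q \<Lambda> x) has_real_derivative - (?w \<Lambda> z * f \<Lambda> z)) (at z within {0..})"
        if "x \<le> z" for z
        using that x by (intro DERIV_minus q) simp
      show "- (?w \<Lambda> z * f \<Lambda> z) \<le> 0" if z: "x < z" "z < 1" for z
        using potential_mono[of y z \<tau> k] y z \<tau> nonneg[of z] by simp
    qed (use x in auto)
    with q1 qx show False by simp
  qed
  have le1: "f \<Lambda> x \<le> 1" if x: "0 \<le> x" "x \<le> 1" for x
  proof -
    have "f \<Lambda> x \<le> f \<Lambda> 0"
    proof (rule nonincreasing_if_derivative_nonpos[OF f])
      show "q \<Lambda> y / ?p y \<le> 0" if "0 < y" "y < x" for y
        using qneg[of y] that x weight_ge_1[of k y] by (simp add: divide_nonpos_pos)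
    qed (use x in auto)
    then show ?thesis by (simp add: 0)
  qed
  show ?thesis
    using that[OF \<Lambda>(2) S] nonneg le1 by blast
qed


section \<open>Reflection of solutions\<close>

lemma has_real_derivative_glue:
  assumes "x \<ge> 0 \<Longrightarrow> (g has_real_derivative d) (at x within {0..})"
    and "x \<le> 0 \<Longrightarrow> (g has_real_derivative d) (at x within {..0})"
  shows "(g has_real_derivative d) (at x)"
proof -
  consider "x > 0" | "x < 0" | "x = 0" by linarith
  then show ?thesis
  proof cases
    case 1
    then have "at x within {0..} = at x" by (intro at_within_interior) simp
    then show ?thesis using assms(1) 1 by simp
  next
    case 2
    then have "at x within {..0} = at x" by (intro at_within_interior) simp
    then show ?thesis using assms(2) 2 by simp
  next
    case 3
    then have "(g has_real_derivative d) (at x within {0..} \<union> {..0})"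
      using assms unfolding has_field_derivative_iff Lim_within_Un by simp
    moreover have "{0..} \<union> {..0} = (UNIV :: real set)" by auto
    ultimately show ?thesis by simp
  qed
qed

text \<open>The odd extension of \<open>q\<close> is differentiable at the origin because \<open>q 0 = 0\<close>.\<close>

lemma sturm_solution_even_extension:
  assumes S: "sturm_solution p w f q" and p: "\<And>x. p (- x) = p x" and w: "\<And>x. w (- x) = w x"
  obtains F Q where "\<And>x. (F has_real_derivative Q x / p x) (at x)"
    "\<And>x. (Q has_real_derivative w x * F x) (at x)" "\<And>x. F x = f \<bar>x\<bar>"
proof -
  define F where "F x = f \<bar>x\<bar>" for x
  define Q where "Q x = sgn x * q \<bar>x\<bar>" for x
  have f: "(f has_real_derivative q x / p x) (at x within {0..})"
    and q: "(q has_real_derivative w x * f x) (at x within {0..})" if "0 \<le> x" for x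
    using S that by (auto simp: sturm_solution_def)
  have q0: "q 0 = 0" using S by (simp add: sturm_solution_def)
  have Qpos: "Q x = q x" if "x \<ge> 0" for x using that q0 by (cases "x = 0") (auto simp: Q_def)
  have Qneg: "Q x = - q (- x)" if "x \<le> 0" for x using that q0 by (cases "x = 0") (auto simp: Q_def)
  have refl: "((\<lambda>x. g (- x)) has_real_derivative - d) (at x within {..0})"
    if "(g has_real_derivative d) (at (- x) within {0..})" for g :: "real \<Rightarrow> real" and d x
  proof -
    have "uminus ` {..0} = {0::real..}" by force
    then have "(g \<circ> uminus has_real_derivative d * (- 1)) (at x within {..0})"
      using that by (intro DERIV_image_chain) (auto intro!: derivative_eq_intros)
    then show ?thesis by (simp add: o_def)
  qed
  have tr: "(g has_real_derivative d) (at x within T)"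
    if "(h has_real_derivative d) (at x within T)" "x \<in> T" "\<And>y. y \<in> T \<Longrightarrow> g y = h y"
    for g h :: "real \<Rightarrow> real" and d x T
    using that unfolding has_field_derivative_def by (blast intro: has_derivative_transform)
  show ?thesis
  proof (rule that[of F Q])
    fix x :: real
    show "F x = f \<bar>x\<bar>" by (simp add: F_def)
    show "(F has_real_derivative Q x / p x) (at x)"
    proof (rule has_real_derivative_glue)
      assume x: "x \<ge> 0"
      show "(F has_real_derivative Q x / p x) (at x within {0..})"
        unfolding Qpos[OF x] by (rule tr[OF f[OF x]]) (use x in \<open>auto simp: F_def\<close>)
    next
      assume x: "x \<le> 0"
      have "((\<lambda>x. f (- x)) has_real_derivative - (q (- x) / p (- x))) (at x within {..0})"
        by (rule refl[OF f]) (use x in simp)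
      then have "((\<lambda>x. f (- x)) has_real_derivative Q x / p x) (at x within {..0})"
        by (simp add: Qneg[OF x] p)
      then show "(F has_real_derivative Q x / p x) (at x within {..0})"
        by (rule tr) (use x in \<open>auto simp: F_def\<close>)
    qed
    show "(Q has_real_derivative w x * F x) (at x)"
    proof (rule has_real_derivative_glue)
      assume x: "x \<ge> 0"
      have "(q has_real_derivative w x * F x) (at x within {0..})"
        using q[OF x] x by (simp add: F_def)
      then show "(Q has_real_derivative w x * F x) (at x within {0..})"
        by (rule tr) (use x Qpos in auto)
    next
      assume x: "x \<le> 0"
      have "((\<lambda>x. q (- x)) has_real_derivative - (w (- x) * f (- x))) (at x within {..0})"
        by (rule refl[OF q]) (use x in simp)
      then have "((\<lambda>x. - q (- x)) has_real_derivative - (- (w (- x) * f (- x)))) (at x within {..0})"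
        by (rule DERIV_minus)
      then have "((\<lambda>x. - q (- x)) has_real_derivative w x * F x) (at x within {..0})"
        using x by (simp add: w F_def)
      then show "(Q has_real_derivative w x * F x) (at x within {..0})"
        by (rule tr) (use x Qneg in auto)
    qed
  qed
qed


section \<open>Classical solutions are distribution solutions\<close>

definition C1 :: "(real^'n::finite \<Rightarrow> complex) \<Rightarrow> bool"
  where "C1 g \<longleftrightarrow> (\<forall>p. g differentiable (at p)) \<and> (\<forall>i. continuous_on UNIV (partial i g))"

lemma C1_continuous_on: "C1 g \<Longrightarrow> continuous_on UNIV g"
  unfolding C1_def
  by (meson continuous_at_imp_continuous_on differentiable_imp_continuous_within)

lemma smooth_on_C1: "smooth_on UNIV g \<Longrightarrow> C1 g"
  unfolding C1_def by (auto dest: smooth_on_imp intro: smooth_on_continuous_on smooth_on_partial)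

lemma C1_mult:
  assumes "C1 f" "C1 g"
  shows "C1 (\<lambda>p. f p * g p)"
proof -
  have "partial i (\<lambda>p. f p * g p) = (\<lambda>p. f p * partial i g p + partial i f p * g p)" for i
    using assms by (auto simp: partial_mult C1_def)
  then show ?thesis
    using assms C1_continuous_on[OF assms(1)] C1_continuous_on[OF assms(2)]
    unfolding C1_def by (auto intro!: continuous_intros differentiable_mult)
qed

lemma C1_add:
  assumes "C1 f" "C1 g"
  shows "C1 (\<lambda>p. f p + g p)"
proof -
  have "partial i (\<lambda>p. f p + g p) = (\<lambda>p. partial i f p + partial i g p)" for i
    using assms by (auto simp: partial_add C1_def)
  then show ?thesis
    using assms unfolding C1_def by (auto intro!: continuous_intros)
qed

lemma C1_sum: "(\<And>i. i \<in> I \<Longrightarrow> C1 (f i)) \<Longrightarrow> C1 (\<lambda>p. \<Sum>i\<in>I. f i p)"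
  by (induction I rule: infinite_finite_induct) (auto intro: C1_add smooth_on_C1)

lemma C1_vf_apply:
  assumes "\<And>i. smooth_on UNIV (\<lambda>p. Z p $ i)" "\<And>i. C1 (partial i U)"
  shows "C1 (vf_apply Z U)"
  unfolding vf_apply_def[abs_def] by (intro C1_sum C1_mult smooth_on_C1 assms)

lemma dist_of_sum:
  assumes "\<And>i. i \<in> I \<Longrightarrow> continuous_on UNIV (f i)" "\<psi> \<in> test_functions V"
  shows "dist_of (\<lambda>p. \<Sum>i\<in>I. f i p) \<psi> = (\<Sum>i\<in>I. dist_of (f i) \<psi>)"
  unfolding dist_of_def sum_distrib_right
  by (intro Bochner_Integration.integral_sum assms(1)
      integrable_mult_test_function[OF continuous_on_subset[OF _ subset_UNIV] assms(2)])

lemma dist_mult_dist_of: "dist_mult a (dist_of g) \<psi> = dist_of (\<lambda>p. a p * g p) \<psi>"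
  by (simp add: dist_mult_def dist_of_def mult_ac)

lemma dist_partial_dist_of:
  assumes g: "C1 g" and \<psi>: "\<psi> \<in> test_functions V"
  shows "dist_partial i (dist_of g) \<psi> = dist_of (partial i g) \<psi>"
proof -
  have s: "smooth_on UNIV \<psi>" "compact (support \<psi>)" using \<psi> by (auto simp: test_functions_def)
  have c: "C1 (\<lambda>p. g p * \<psi> p)" by (intro C1_mult g smooth_on_C1 s)
  have e: "partial i (\<lambda>p. g p * \<psi> p) = (\<lambda>p. g p * partial i \<psi> p + partial i g p * \<psi> p)"
    using g smooth_on_C1[OF s(1)] by (auto simp: partial_mult C1_def)
  have "(LINT p|lborel. partial i (\<lambda>p. g p * \<psi> p) p) = 0"
    by (rule integral_partial[of _ i "support \<psi>"]) (use c s not_in_support[of _ \<psi>] in \<open>auto simp: C1_def\<close>)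
  then have "dist_of g (partial i \<psi>) + dist_of (partial i g) \<psi> = 0"
    unfolding e dist_of_def using g
    by (subst (asm) Bochner_Integration.integral_add)
      (auto simp: C1_def C1_continuous_on
        intro!: integrable_mult_test_function[OF continuous_on_subset[OF _ subset_UNIV] \<psi>]
          integrable_mult_test_function[OF continuous_on_subset[OF _ subset_UNIV] test_functions_partial[OF \<psi>]])
  then show ?thesis
    by (simp add: dist_partial_def neg_eq_iff_add_eq_0)
qed

lemma dist_vf_apply_dist_of:
  assumes Z: "\<And>i. smooth_on UNIV (\<lambda>p. Z p $ i)" and U: "C1 U" and \<psi>: "\<psi> \<in> test_functions V"
  shows "dist_vf_apply Z (dist_of U) \<psi> = dist_of (vf_apply Z U) \<psi>"
proof -
  have "dist_vf_apply Z (dist_of U) \<psi> = (\<Sum>i\<in>UNIV. dist_of (partial i U) (\<lambda>p. Z p $ i * \<psi> p))"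
    unfolding dist_vf_apply_def dist_mult_def
    by (intro sum.cong refl dist_partial_dist_of[OF U, where V = V] test_functions_mult[OF \<psi>] Z)
  also have "\<dots> = (\<Sum>i\<in>UNIV. dist_of (\<lambda>p. Z p $ i * partial i U p) \<psi>)"
    by (simp add: dist_of_def mult_ac)
  also have "\<dots> = dist_of (vf_apply Z U) \<psi>"
    unfolding vf_apply_def[abs_def]
    by (intro dist_of_sum[symmetric, OF _ \<psi>] continuous_on_mult smooth_on_continuous_on[OF Z])
       (use U in \<open>simp add: C1_def\<close>)
  finally show ?thesis .
qed

text \<open>Two continuous derivatives of \<open>U\<close> suffice for the integrations by parts, so that profiles
  obtained from the differential equation can be used directly.\<close>

lemma dist_sum_of_squares_dist_of:
  assumes Z: "\<And>Z i. Z \<in> set Zs \<Longrightarrow> smooth_on UNIV (\<lambda>p. Z p $ i)"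
    and U: "C1 U" "\<And>i. C1 (partial i U)" and \<phi>: "\<phi> \<in> test_functions V"
  shows "dist_sum_of_squares Zs (dist_of U) \<phi> = dist_of (sum_of_squares Zs U) \<phi>"
proof -
  have adj: "dist_vf_adjoint Z (dist_vf_apply Z (dist_of U)) \<phi> = dist_of (vf_adjoint Z (vf_apply Z U)) \<phi>"
    "continuous_on UNIV (vf_adjoint Z (vf_apply Z U))" if "Z \<in> set Zs" for Z
  proof -
    note Zs = Z[OF that]
    have c: "C1 (\<lambda>p. cnj (Z p $ i) * vf_apply Z U p)" for i
      by (intro C1_mult C1_vf_apply smooth_on_C1[OF smooth_on_cnj] Zs U)
    have "dist_partial i (dist_mult (\<lambda>q. cnj (Z q $ i)) (dist_vf_apply Z (dist_of U))) \<phi> =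
        dist_of (partial i (\<lambda>p. cnj (Z p $ i) * vf_apply Z U p)) \<phi>" for i
    proof -
      have "dist_partial i (dist_mult (\<lambda>q. cnj (Z q $ i)) (dist_vf_apply Z (dist_of U))) \<phi> =
          dist_partial i (dist_of (\<lambda>p. cnj (Z p $ i) * vf_apply Z U p)) \<phi>"
        unfolding dist_partial_def dist_mult_dist_of[symmetric] unfolding dist_mult_def
        by (intro arg_cong[of _ _ uminus] dist_vf_apply_dist_of[OF Zs U(1), where V = V] test_functions_mult
            test_functions_partial[OF \<phi>] smooth_on_cnj Zs)
      then show ?thesis by (simp only: dist_partial_dist_of[OF c \<phi>])
    qed
    then have "dist_vf_adjoint Z (dist_vf_apply Z (dist_of U)) \<phi> =
        - (\<Sum>i\<in>UNIV. dist_of (partial i (\<lambda>p. cnj (Z p $ i) * vf_apply Z U p)) \<phi>)"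
      by (simp only: dist_vf_adjoint_def)
    also have "\<dots> = - dist_of (\<lambda>p. \<Sum>i\<in>UNIV. partial i (\<lambda>p. cnj (Z p $ i) * vf_apply Z U p) p) \<phi>"
      using c by (subst dist_of_sum[OF _ \<phi>]) (auto simp: C1_def)
    also have "\<dots> = dist_of (vf_adjoint Z (vf_apply Z U)) \<phi>"
      by (simp add: dist_of_def vf_adjoint_def)
    finally show "dist_vf_adjoint Z (dist_vf_apply Z (dist_of U)) \<phi> = dist_of (vf_adjoint Z (vf_apply Z U)) \<phi>" .
    show "continuous_on UNIV (vf_adjoint Z (vf_apply Z U))"
      unfolding vf_adjoint_def[abs_def] using c by (intro continuous_intros) (simp add: C1_def)
  qed
  have "sum_list (map (\<lambda>Z. dist_vf_adjoint Z (dist_vf_apply Z (dist_of U)) \<phi>) Zs) =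
      (\<Sum>j<length Zs. dist_of (vf_adjoint (Zs ! j) (vf_apply (Zs ! j) U)) \<phi>)"
    by (simp add: sum_list_sum_nth lessThan_atLeast0 adj)
  also have "\<dots> = dist_of (\<lambda>p. \<Sum>j<length Zs. vf_adjoint (Zs ! j) (vf_apply (Zs ! j) U) p) \<phi>"
    using adj(2) by (intro dist_of_sum[symmetric, OF _ \<phi>]) simp
  also have "\<dots> = dist_of (sum_of_squares Zs U) \<phi>"
    by (simp add: sum_of_squares_def[abs_def] sum_list_sum_nth lessThan_atLeast0)
  finally show ?thesis by (simp only: dist_sum_of_squares_def)
qed


section \<open>Separated solutions\<close>

definition wave :: "real \<Rightarrow> complex \<Rightarrow> (real \<Rightarrow> complex) \<Rightarrow> real^3 \<Rightarrow> complex"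
  where "wave \<tau> \<mu> a p = a (p $ 1) * (exp (\<i> * of_real \<tau> * of_real (p $ 2)) * exp (\<mu> * of_real (p $ 3)))"

lemma exp_mult_has_vector_derivative:
  "((\<lambda>x. exp (c * complex_of_real x)) has_vector_derivative c * exp (c * of_real x)) (at x)"
proof -
  have "((\<lambda>z. exp (c * z)) has_field_derivative c * exp (c * of_real x)) (at (of_real x))"
    by (auto intro!: derivative_eq_intros)
  then show ?thesis by (rule has_vector_derivative_real_field)
qed

lemma wave_derivatives:
  assumes a: "(a has_vector_derivative a') (at (p $ 1))"
  shows "partial 1 (wave \<tau> \<mu> a) p = wave \<tau> \<mu> (\<lambda>_. a') p"
    "partial 2 (wave \<tau> \<mu> a) p = \<i> * of_real \<tau> * wave \<tau> \<mu> a p"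
    "partial 3 (wave \<tau> \<mu> a) p = \<mu> * wave \<tau> \<mu> a p"
    "wave \<tau> \<mu> a differentiable (at p)"
proof -
  note dx = partial_coordinate[OF a]
  note dt = partial_coordinate[OF exp_mult_has_vector_derivative[of "\<i> * of_real \<tau>" "p $ 2"]]
  note ds = partial_coordinate[OF exp_mult_has_vector_derivative[of \<mu> "p $ 3"]]
  note dts = differentiable_mult[OF dt(2) ds(2)]
  have w: "wave \<tau> \<mu> a = (\<lambda>p. a (p $ 1) * (exp (\<i> * of_real \<tau> * of_real (p $ 2)) * exp (\<mu> * of_real (p $ 3))))"
    by (simp add: fun_eq_iff wave_def)
  note e = w partial_mult[OF dx(2) dts] partial_mult[OF dt(2) ds(2)] dx(1) dt(1) ds(1)
  show "partial 1 (wave \<tau> \<mu> a) p = wave \<tau> \<mu> (\<lambda>_. a') p"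
    unfolding e by (simp add: wave_def)
  show "partial 2 (wave \<tau> \<mu> a) p = \<i> * of_real \<tau> * wave \<tau> \<mu> a p"
    unfolding e by simp
  show "partial 3 (wave \<tau> \<mu> a) p = \<mu> * wave \<tau> \<mu> a p"
    unfolding e by simp
  show "wave \<tau> \<mu> a differentiable (at p)"
    unfolding w by (intro differentiable_mult dx(2) dts)
qed

lemma continuous_on_wave:
  assumes "continuous_on UNIV a"
  shows "continuous_on UNIV (wave \<tau> \<mu> a)"
  unfolding wave_def[abs_def]
  by (intro continuous_intros continuous_on_compose2[OF assms]) auto

lemma partial_wave:
  assumes "\<And>x. (a has_vector_derivative a' x) (at x)"
  shows "partial i (wave \<tau> \<mu> a) =
    (if i = 1 then wave \<tau> \<mu> a' else if i = 2 then wave \<tau> \<mu> (\<lambda>x. \<i> * of_real \<tau> * a x) else wave \<tau> \<mu> (\<lambda>x. \<mu> * a x))"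
  using exhaust_3[of i] wave_derivatives(1-3)[OF assms]
  by (auto simp: fun_eq_iff) (simp_all add: wave_def)

lemma C1_wave:
  assumes a: "\<And>x. (a has_vector_derivative a' x) (at x)" and c: "continuous_on UNIV a'"
  shows "C1 (wave \<tau> \<mu> a)"
proof -
  have "continuous_on UNIV a"
    using a by (meson continuous_at_imp_continuous_on has_vector_derivative_continuous)
  then have "continuous_on UNIV (partial i (wave \<tau> \<mu> a))" for i
    unfolding partial_wave[OF a] using c by (auto intro!: continuous_on_wave continuous_intros)
  then show ?thesis
    using wave_derivatives(4)[OF a] by (simp add: C1_def)
qed

text \<open>Conjugating by \<open>exp (\<i> \<tau> t)\<close> turns \<open>Z1\<close> and \<open>Z2\<close> into \<open>d/dx + \<tau> x\<close> and
  \<open>x\<^sup>k (d/dx - \<tau> x)\<close>.\<close>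

lemma sum_of_squares_wave:
  fixes a a' a'' :: "real \<Rightarrow> complex"
  assumes a: "\<And>x. (a has_vector_derivative a' x) (at x)"
    and a': "\<And>x. (a' has_vector_derivative a'' x) (at x)"
    and eq: "\<And>x. of_real (weight k x) * a'' x + of_real (2 * real k * x ^ (2 * k - 1)) * a' x =
      (of_real (potential k \<tau> x) - \<mu>\<^sup>2) * a x"
    and k: "k \<ge> 1"
  shows "sum_of_squares [Z1, Z2 k, Z3] (wave \<tau> \<mu> a) p = 0"
proof -
  let ?x = "\<lambda>x. complex_of_real x" and ?t = "complex_of_real \<tau>"
  let ?W = "wave \<tau> \<mu>"
  have sq: "vf_adjoint Z (?W b) p = - (partial 1 (?W (\<lambda>x. c1 x * b x)) p + partial 2 (?W (\<lambda>x. c2 x * b x)) p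
      + partial 3 (?W (\<lambda>x. c3 x * b x)) p)"
    if "\<And>p. cnj (Z p $ 1) = c1 (p $ 1)" "\<And>p. cnj (Z p $ 2) = c2 (p $ 1)" "\<And>p. cnj (Z p $ 3) = c3 (p $ 1)"
    for Z b c1 c2 c3
    unfolding vf_adjoint_def sum_3 that wave_def[abs_def] by (simp add: mult.assoc)
  have dx: "(?x has_vector_derivative 1) (at x)" for x
    by (auto intro!: derivative_eq_intros)
  have dxk: "((\<lambda>x. ?x x ^ n) has_vector_derivative of_nat n * ?x x ^ (n - 1)) (at x)" for n x
  proof -
    have "((\<lambda>z::complex. z ^ n) has_field_derivative of_nat n * ?x x ^ (n - 1)) (at (?x x))"
      by (auto intro!: derivative_eq_intros)
    then show ?thesis by (rule has_vector_derivative_real_field)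
  qed
  note vm = has_vector_derivative_mult and va = has_vector_derivative_add and vd = has_vector_derivative_diff
  have vc: "((\<lambda>x. c * g x) has_vector_derivative c * g') (at x)"
    if "(g has_vector_derivative g') (at x)" for c g' :: complex and g and x :: real
    using has_vector_derivative_mult_right[OF that] .
  have z1: "vf_apply Z1 (?W a) = ?W (\<lambda>x. a' x + ?t * (?x x * a x))"
    unfolding vf_apply_def[abs_def] sum_3 partial_wave[OF a] Z1_def
    by (simp add: fun_eq_iff wave_def algebra_simps)
  have z2: "vf_apply (Z2 k) (?W a) = ?W (\<lambda>x. ?x x ^ k * (a' x - ?t * (?x x * a x)))"
    unfolding vf_apply_def[abs_def] sum_3 partial_wave[OF a] Z2_def
    by (simp add: fun_eq_iff wave_def algebra_simps)
  have z3: "vf_apply Z3 (?W a) = ?W (\<lambda>x. \<mu> * a x)"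
    unfolding vf_apply_def[abs_def] sum_3 partial_wave[OF a] Z3_def
    by (simp add: fun_eq_iff wave_def algebra_simps)
  let ?X = "p $ 1"
  let ?A = "a ?X" and ?A' = "a' ?X" and ?A'' = "a'' ?X"
  define e where "e = exp (\<i> * ?t * ?x (p $ 2)) * exp (\<mu> * ?x (p $ 3))"
  have We: "?W b p = b ?X * e" for b by (simp add: wave_def e_def)
  note dxa = vc[OF vm[OF dx a], of ?t]
  have b1: "((\<lambda>x. a' x + ?t * (?x x * a x)) has_vector_derivative
      a'' x + ?t * (?x x * a' x + 1 * a x)) (at x)" for x
    by (rule va[OF a' dxa])
  have b2: "((\<lambda>x. a' x - ?t * (?x x * a x)) has_vector_derivative
      a'' x - ?t * (?x x * a' x + 1 * a x)) (at x)" for x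
    by (rule vd[OF a' dxa])
  have zero: "((\<lambda>x. 0 :: complex) has_vector_derivative 0) (at x)" for x :: real by simp
  have e1: "vf_adjoint Z1 (vf_apply Z1 (?W a)) p =
     (- (?A'' + ?t * (?x ?X * ?A' + ?A)) + ?t * ?x ?X * (?A' + ?t * (?x ?X * ?A))) * e"
  proof -
    have d2: "((\<lambda>x. \<i> * ?x x * (a' x + ?t * (?x x * a x))) has_vector_derivative
        \<i> * ?x x * (a'' x + ?t * (?x x * a' x + 1 * a x)) + \<i> * 1 * (a' x + ?t * (?x x * a x))) (at x)" for x
      by (rule vm[OF vc[OF dx] b1])
    have "vf_adjoint Z1 (vf_apply Z1 (?W a)) p =
      - (partial 1 (?W (\<lambda>x. 1 * (a' x + ?t * (?x x * a x)))) p +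
         partial 2 (?W (\<lambda>x. \<i> * ?x x * (a' x + ?t * (?x x * a x)))) p +
         partial 3 (?W (\<lambda>x. 0 * (a' x + ?t * (?x x * a x)))) p)"
      unfolding z1 by (rule sq) (simp_all add: Z1_def)
    also have "\<dots> = - ((?A'' + ?t * (?x ?X * ?A' + 1 * ?A)) * e +
         \<i> * ?t * (\<i> * ?x ?X * (?A' + ?t * (?x ?X * ?A)) * e) + \<mu> * (0 * e))"
      unfolding mult_1_left mult_zero_left wave_derivatives(1)[OF b1[simplified]] wave_derivatives(2)[OF d2]
        wave_derivatives(3)[OF zero] We by simp
    also have "\<dots> = (- (?A'' + ?t * (?x ?X * ?A' + ?A)) + ?t * ?x ?X * (?A' + ?t * (?x ?X * ?A))) * e"
      by (simp add: algebra_simps)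
    finally show ?thesis .
  qed
  define P where "P = ?x ?X ^ (2 * k)"
  define R where "R = of_nat (2 * k) * ?x ?X ^ (2 * k - 1)"
  let ?B = "?A' - ?t * (?x ?X * ?A)" and ?B' = "?A'' - ?t * (?x ?X * ?A' + 1 * ?A)"
  have e2: "vf_adjoint (Z2 k) (vf_apply (Z2 k) (?W a)) p =
     (- (P * ?B' + R * ?B) - ?t * ?x ?X * P * ?B) * e"
  proof -
    have d1: "((\<lambda>x. ?x x ^ (2 * k) * (a' x - ?t * (?x x * a x))) has_vector_derivative
        ?x x ^ (2 * k) * (a'' x - ?t * (?x x * a' x + 1 * a x)) +
        of_nat (2 * k) * ?x x ^ (2 * k - 1) * (a' x - ?t * (?x x * a x))) (at x)" for x
      by (rule vm[OF dxk b2])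
    have d2: "((\<lambda>x. (- \<i> * ?x x) * (?x x ^ (2 * k) * (a' x - ?t * (?x x * a x)))) has_vector_derivative
        (- \<i> * ?x x) * (?x x ^ (2 * k) * (a'' x - ?t * (?x x * a' x + 1 * a x)) +
        of_nat (2 * k) * ?x x ^ (2 * k - 1) * (a' x - ?t * (?x x * a x))) +
        (- \<i> * 1) * (?x x ^ (2 * k) * (a' x - ?t * (?x x * a x)))) (at x)" for x
      by (rule vm[OF vc[OF dx] d1])
    have pk: "z ^ k * (z ^ k * y) = z ^ (2 * k) * y" for y z :: complex
      by (simp add: mult_2 power_add mult.assoc)
    have "vf_adjoint (Z2 k) (vf_apply (Z2 k) (?W a)) p =
      - (partial 1 (?W (\<lambda>x. ?x x ^ k * (?x x ^ k * (a' x - ?t * (?x x * a x))))) p +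
         partial 2 (?W (\<lambda>x. (- \<i> * ?x x * ?x x ^ k) * (?x x ^ k * (a' x - ?t * (?x x * a x))))) p +
         partial 3 (?W (\<lambda>x. 0 * (?x x ^ k * (a' x - ?t * (?x x * a x))))) p)"
      unfolding z2 by (rule sq) (simp_all add: Z2_def)
    also have "\<dots> = - (partial 1 (?W (\<lambda>x. ?x x ^ (2 * k) * (a' x - ?t * (?x x * a x)))) p +
         partial 2 (?W (\<lambda>x. (- \<i> * ?x x) * (?x x ^ (2 * k) * (a' x - ?t * (?x x * a x))))) p +
         partial 3 (?W (\<lambda>x. 0)) p)"
    proof -
      have *: "- \<i> * z * z ^ k * (z ^ k * y) = - \<i> * z * (z ^ (2 * k) * y)" for y z :: complex
        unfolding pk[symmetric] by (rule mult.assoc)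
      show ?thesis unfolding * unfolding pk mult_zero_left ..
    qed
    also have "\<dots> = - ((P * ?B' + R * ?B) * e + \<i> * ?t * (- \<i> * ?x ?X * (P * ?B) * e) + \<mu> * (0 * e))"
      unfolding wave_derivatives(1)[OF d1] wave_derivatives(2)[OF d2] wave_derivatives(3)[OF zero]
      by (simp only: We P_def R_def)
    also have "\<dots> = (- (P * ?B' + R * ?B) - ?t * ?x ?X * P * ?B) * e"
    proof -
      have "- ((P * b' + R * b) * e + \<i> * ?t * (- \<i> * ?x ?X * (P * b) * e) + \<mu> * (0 * e)) =
          (- (P * b' + R * b) - ?t * ?x ?X * P * b) * e" for b b' :: complex
        by (simp add: algebra_simps)
      then show ?thesis .
    qed
    finally show ?thesis .
  qed
  have e3: "vf_adjoint Z3 (vf_apply Z3 (?W a)) p = - \<mu>\<^sup>2 * ?A * e"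
    unfolding z3
    by (subst sq[where ?c1.0 = "\<lambda>_. 0" and ?c2.0 = "\<lambda>_. 0" and ?c3.0 = "\<lambda>_. 1"])
      (simp_all add: Z3_def wave_derivatives(1)[OF zero] wave_derivatives(2)[OF zero]
        wave_derivatives(3)[OF vc[OF a]] We power2_eq_square)
  have xR: "?x ?X * R = 2 * of_nat k * P"
    using k power_Suc[of "?x ?X" "2 * k - 1"] by (simp add: R_def P_def)
  have E: "(1 + P) * ?A'' + R * ?A' =
      ((1 + P) * ?t\<^sup>2 * (?x ?X)\<^sup>2 + ?t * ((2 * of_nat k + 1) * P - 1) - \<mu>\<^sup>2) * ?A"
    using eq[of ?X] by (simp add: weight_def potential_def P_def R_def)
  have "sum_of_squares [Z1, Z2 k, Z3] (?W a) p =
    (- ((1 + P) * ?A'' + R * ?A') + ((1 + P) * ?t\<^sup>2 * (?x ?X)\<^sup>2 + ?t * (P - 1) + ?t * (?x ?X * R) - \<mu>\<^sup>2) * ?A) * e"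
    unfolding sum_of_squares_def by (simp add: e1 e2 e3) (simp add: algebra_simps power2_eq_square)
  also have "\<dots> = 0"
    unfolding E xR by (simp add: algebra_simps)
  finally show ?thesis .
qed


section \<open>Superposition of separated solutions\<close>

text \<open>The profile is the even ground state, and \<open>\<mu>\<^sup>2 = \<Lambda>\<close> compensates the eigenvalue in the \<open>s\<close>
  variable. The parameter \<open>\<Lambda>\<close> may be negative, but then \<open>\<mu>\<close> is imaginary; in both cases
  \<open>\<bar>Re \<mu>\<bar> \<le> 6\<close> follows from \<open>\<Lambda> \<le> 28\<close>, uniformly in \<open>\<tau>\<close>.\<close>

lemma separated_solution_exists:
  assumes k: "k \<ge> 1" and \<tau>: "\<tau> \<ge> 2" and A: "A \<ge> 0"
  obtains U where "C1 U" "\<And>i. C1 (partial i U)"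
    "\<And>p. sum_of_squares [Z1, Z2 k, Z3] U p = 0"
    "\<And>p. norm p \<le> 1 \<Longrightarrow> norm (U p) \<le> A * exp 6"
    "\<And>h. U (h *\<^sub>R axis 2 1) = of_real A * exp (\<i> * of_real \<tau> * of_real h)"
proof -
  let ?p = "weight k"
  obtain \<Lambda> f q where \<Lambda>: "\<Lambda> \<le> 28"
    and S: "sturm_solution ?p (\<lambda>x. potential k \<tau> x - \<Lambda>) f q"
    and f1: "\<And>x. 0 \<le> x \<Longrightarrow> x \<le> 1 \<Longrightarrow> 0 \<le> f x \<and> f x \<le> 1"
    using bounded_ground_state[OF k \<tau>] by blast
  let ?w = "\<lambda>x. potential k \<tau> x - \<Lambda>"
  have even: "?p (- x) = ?p x" "?w (- x) = ?w x" for x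
    by (simp_all add: weight_def potential_def)
  obtain F0 Q0 where F0: "\<And>x. (F0 has_real_derivative Q0 x / ?p x) (at x)"
    and Q0: "\<And>x. (Q0 has_real_derivative ?w x * F0 x) (at x)" and F0f: "\<And>x. F0 x = f \<bar>x\<bar>"
    using sturm_solution_even_extension[OF S even] by blast
  define F where "F x = A * F0 x" for x
  define Q where "Q x = A * Q0 x" for x
  have F: "(F has_real_derivative Q x / ?p x) (at x)" for x
    unfolding F_def[abs_def] Q_def using DERIV_cmult[OF F0, of A] by simp
  have Q: "(Q has_real_derivative ?w x * F x) (at x)" for x
    unfolding F_def Q_def[abs_def] using DERIV_cmult[OF Q0, of A] by (simp add: mult_ac)
  have px: "?p x \<noteq> 0" for x using weight_ge_1[of k x] by linarith
  let ?p' = "\<lambda>x. 2 * real k * x ^ (2 * k - 1)"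
  let ?F' = "\<lambda>x. Q x / ?p x" and ?F'' = "\<lambda>x. (?w x * F x * ?p x - Q x * ?p' x) / (?p x * ?p x)"
  have p': "(?p has_real_derivative ?p' x) (at x)" for x
    unfolding weight_def[abs_def] using DERIV_add[OF DERIV_const[of 1] DERIV_pow[of "2 * k" x]] by simp
  have F': "(?F' has_real_derivative ?F'' x) (at x)" for x
    by (rule DERIV_divide[OF Q p' px])
  have cont: "continuous_on UNIV F" "continuous_on UNIV Q"
    using DERIV_isCont[OF F] DERIV_isCont[OF Q] by (auto intro: continuous_at_imp_continuous_on)
  let ?c = "\<lambda>g x. complex_of_real (g x)"
  have d: "((\<lambda>x. complex_of_real (g x)) has_vector_derivative of_real g') (at x)"
    if "(g has_real_derivative g') (at x)" for g g' x
    using has_vector_derivative_of_real that has_real_derivative_iff_has_vector_derivative by blast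
  define \<mu> where "\<mu> = csqrt (of_real \<Lambda>)"
  have \<mu>2: "\<mu>\<^sup>2 = of_real \<Lambda>" by (simp add: \<mu>_def)
  have Re\<mu>: "\<bar>Re \<mu>\<bar> \<le> 6"
  proof -
    have "Re (\<mu>\<^sup>2) = \<Lambda>" "Im (\<mu>\<^sup>2) = 0" unfolding \<mu>2 by simp_all
    then have "(Re \<mu>)\<^sup>2 - (Im \<mu>)\<^sup>2 = \<Lambda>" "Re \<mu> = 0 \<or> Im \<mu> = 0"
      by (simp_all add: Re_power2 Im_power2)
    then have "(Re \<mu>)\<^sup>2 \<le> 6\<^sup>2" using \<Lambda> by auto
    then show ?thesis using abs_le_square_iff[of "Re \<mu>" 6] by simp
  qed
  define U where "U = wave \<tau> \<mu> (?c F)"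
  have cF': "continuous_on UNIV (?c ?F')" and cF'': "continuous_on UNIV (?c ?F'')"
    by (intro continuous_intros continuous_on_weight continuous_on_potential cont px; simp add: px)+
  have cc: "((\<lambda>x. c * ?c F x) has_vector_derivative c * ?c ?F' x) (at x)" for c x
    by (rule has_vector_derivative_mult_right[OF d[OF F]])
  show ?thesis
  proof (rule that[of U])
    show "C1 U"
      unfolding U_def by (rule C1_wave[OF d[OF F] cF'])
    show "C1 (partial i U)" for i
      unfolding U_def partial_wave[OF d[OF F]]
      using C1_wave[OF d[OF F'] cF''] C1_wave[OF cc continuous_on_mult[OF continuous_on_const cF']]
      by simp
    show "sum_of_squares [Z1, Z2 k, Z3] U p = 0" for p
      unfolding U_def
    proof (rule sum_of_squares_wave[OF d[OF F] d[OF F'] _ k])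
      fix x
      have "?p x * ?F'' x + ?p' x * ?F' x = ?w x * F x"
        using px[of x] by (simp add: field_simps)
      then have "complex_of_real (?p x * ?F'' x + ?p' x * ?F' x) = complex_of_real (?w x * F x)"
        by (simp only:)
      then show "of_real (weight k x) * ?c ?F'' x + of_real (?p' x) * ?c ?F' x =
          (of_real (potential k \<tau> x) - \<mu>\<^sup>2) * ?c F x"
        unfolding \<mu>2 by (simp only: of_real_add of_real_mult of_real_diff)
    qed
    show "norm (U p) \<le> A * exp 6" if p: "norm p \<le> 1" for p
    proof -
      have c: "\<bar>p $ i\<bar> \<le> 1" for i using component_le_norm_cart[of p i] p by simp
      have "norm (U p) = \<bar>F (p $ 1)\<bar> * exp (Re \<mu> * p $ 3)"
        by (simp add: U_def wave_def norm_mult norm_exp_eq_Re)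
      also have "\<dots> \<le> A * exp 6"
      proof (intro mult_mono)
        have "\<bar>f \<bar>p $ 1\<bar>\<bar> \<le> 1" using f1[of "\<bar>p $ 1\<bar>"] c[of 1] by simp
        then show "\<bar>F (p $ 1)\<bar> \<le> A"
          using A mult_left_le[of "\<bar>f \<bar>p $ 1\<bar>\<bar>" A] by (simp add: F_def F0f abs_mult)
        have "Re \<mu> * p $ 3 \<le> \<bar>Re \<mu>\<bar> * \<bar>p $ 3\<bar>" unfolding abs_mult[symmetric] by (rule abs_ge_self)
        also have "\<dots> \<le> 6 * 1" using Re\<mu> c[of 3] by (intro mult_mono) auto
        finally show "exp (Re \<mu> * p $ 3) \<le> exp 6" by simp
      qed (use A in auto)
      finally show ?thesis .
    qed
    show "U (h *\<^sub>R axis 2 1) = of_real A * exp (\<i> * of_real \<tau> * of_real h)" for h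
      using S by (simp add: U_def wave_def F_def F0f sturm_solution_def axis_def)
  qed
qed

definition dist_sums ::
  "(real^'n::finite) set \<Rightarrow> (nat \<Rightarrow> (real^'n \<Rightarrow> complex) \<Rightarrow> complex) \<Rightarrow> ((real^'n \<Rightarrow> complex) \<Rightarrow> complex) \<Rightarrow> bool"
  where "dist_sums V us u \<longleftrightarrow> (\<forall>\<phi>\<in>test_functions V. (\<lambda>j. us j \<phi>) sums u \<phi>)"

lemma dist_sums_partial:
  "dist_sums V us u \<Longrightarrow> dist_sums V (\<lambda>j. dist_partial i (us j)) (dist_partial i u)"
  by (auto simp: dist_sums_def dist_partial_def intro!: sums_minus test_functions_partial)

lemma dist_sums_mult:
  "dist_sums V us u \<Longrightarrow> smooth_on UNIV a \<Longrightarrow> dist_sums V (\<lambda>j. dist_mult a (us j)) (dist_mult a u)"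
  by (auto simp: dist_sums_def dist_mult_def intro!: test_functions_mult)

lemma dist_sums_sum_of_squares:
  assumes Z: "\<And>Z i. Z \<in> set Zs \<Longrightarrow> smooth_on UNIV (\<lambda>p. Z p $ i)" and u: "dist_sums V us u"
  shows "dist_sums V (\<lambda>j. dist_sum_of_squares Zs (us j)) (dist_sum_of_squares Zs u)"
proof -
  have ap: "dist_sums V (\<lambda>j. dist_vf_apply Z (us j)) (dist_vf_apply Z u)"
    if "Z \<in> set Zs" for Z
    using dist_sums_mult[OF dist_sums_partial[OF u] Z[OF that]]
    unfolding dist_sums_def dist_vf_apply_def by (auto intro!: sums_sum)
  have ad: "dist_sums V (\<lambda>j. dist_vf_adjoint Z (dist_vf_apply Z (us j))) (dist_vf_adjoint Z (dist_vf_apply Z u))"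
    if "Z \<in> set Zs" for Z
    using dist_sums_partial[OF dist_sums_mult[OF ap[OF that] smooth_on_cnj[OF Z[OF that]]]]
    unfolding dist_sums_def dist_vf_adjoint_def by (auto intro!: sums_minus sums_sum)
  then show ?thesis
    unfolding dist_sums_def dist_sum_of_squares_def sum_list_sum_nth length_map
    by (auto intro!: sums_sum)
qed

lemma test_function_bounded:
  assumes "\<phi> \<in> test_functions V"
  shows "bdd_above (range (\<lambda>p. norm (\<phi> p)))"
proof -
  have K: "compact (support \<phi>)" using assms by (simp add: test_functions_def)
  have "bounded (\<phi> ` support \<phi>)"
    by (intro compact_imp_bounded compact_continuous_image K test_functions_continuous_on[OF assms])
  then obtain B where B: "B > 0" "\<And>p. p \<in> support \<phi> \<Longrightarrow> norm (\<phi> p) \<le> B"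
    unfolding bounded_pos by auto
  have "norm (\<phi> p) \<le> B" for p
    using B not_in_support[of p \<phi>] by (cases "p \<in> support \<phi>") auto
  then show ?thesis by (intro bdd_aboveI[where M = B]) auto
qed

lemma distribution_dist_of:
  assumes "continuous_on V g"
  shows "distribution V (dist_of g)"
  unfolding distribution_def
proof (intro conjI ballI allI impI)
  note i = integrable_mult_test_function[OF assms]
  show "dist_of g (\<lambda>p. \<phi> p + \<psi> p) = dist_of g \<phi> + dist_of g \<psi>"
    if "\<phi> \<in> test_functions V" "\<psi> \<in> test_functions V" for \<phi> \<psi>
    using i[OF that(1)] i[OF that(2)] by (simp add: dist_of_def distrib_left)
  show "dist_of g (\<lambda>p. c * \<phi> p) = c * dist_of g \<phi>" for c \<phi>
    unfolding dist_of_def by (simp add: mult.left_commute[of _ c])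
  fix K assume K: "compact K \<and> K \<subseteq> V"
  have "bounded (g ` K)"
    using K by (intro compact_imp_bounded compact_continuous_image continuous_on_subset[OF assms]) auto
  then obtain B where B: "B > 0" "\<And>p. p \<in> K \<Longrightarrow> norm (g p) \<le> B"
    unfolding bounded_pos by auto
  have "norm (dist_of g \<phi>) \<le> (B * measure lborel K) * (\<Sum>is | length is \<le> 0. SUP p. norm (partials is \<phi> p))"
    if \<phi>: "\<phi> \<in> test_functions V" "support \<phi> \<subseteq> K" for \<phi>
  proof -
    let ?S = "SUP p. norm (\<phi> p)"
    have le: "norm (g p * \<phi> p) \<le> indicator K p * (B * ?S)" for p
    proof (cases "p \<in> K")
      case True
      have "norm (\<phi> p) \<le> ?S" by (intro cSUP_upper test_function_bounded[OF \<phi>(1)]) simp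
      then show ?thesis using B True by (auto simp: norm_mult intro!: mult_mono)
    next
      case False
      then show ?thesis using \<phi>(2) not_in_support[of p \<phi>] by auto
    qed
    have iK: "integrable lborel (\<lambda>p. indicator K p * (B * ?S))"
      using borel_integrable_compact[of K "\<lambda>_. B * ?S"] K by simp
    have "norm (dist_of g \<phi>) \<le> (LINT p|lborel. indicator K p * (B * ?S))"
      unfolding dist_of_def
      by (rule order.trans[OF integral_norm_bound integral_mono'[OF iK le]]) (rule order.trans[OF norm_ge_zero le])
    also have "\<dots> = (B * measure lborel K) * ?S"
      using K by (simp add: mult_ac)
    also have "?S = (\<Sum>is | length is \<le> 0. SUP p. norm (partials is \<phi> p))"
      by simp
    finally show ?thesis .
  qed
  then show "\<exists>C N. \<forall>\<phi>\<in>test_functions V. support \<phi> \<subseteq> K \<longrightarrow>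
      norm (dist_of g \<phi>) \<le> C * (\<Sum>is | length is \<le> N. SUP p. norm (partials is \<phi> p))"
    by blast
qed

lemma dist_sums_dist_of:
  fixes U :: "nat \<Rightarrow> real^'n::finite \<Rightarrow> complex"
  assumes U: "\<And>j. continuous_on V (U j)" and c: "summable c"
    and le: "\<And>j p. p \<in> V \<Longrightarrow> norm (U j p) \<le> c j"
  shows "continuous_on V (\<lambda>p. \<Sum>j. U j p)"
    "dist_sums V (\<lambda>j. dist_of (U j)) (dist_of (\<lambda>p. \<Sum>j. U j p))"
proof -
  have "uniform_limit V (\<lambda>n p. \<Sum>j<n. U j p) (\<lambda>p. \<Sum>j. U j p) sequentially"
    by (rule Weierstrass_m_test[OF le c])
  then show "continuous_on V (\<lambda>p. \<Sum>j. U j p)"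
    by (rule uniform_limit_theorem[rotated]) (auto intro!: always_eventually continuous_on_sum U)
  show "dist_sums V (\<lambda>j. dist_of (U j)) (dist_of (\<lambda>p. \<Sum>j. U j p))"
    unfolding dist_sums_def
  proof
    fix \<phi> assume \<phi>: "\<phi> \<in> test_functions V"
    have i: "integrable lborel (\<lambda>p. U j p * \<phi> p)" for j
      by (rule integrable_mult_test_function[OF U \<phi>])
    have n: "norm (U j p * \<phi> p) \<le> c j * norm (\<phi> p)" for j p
    proof (cases "p \<in> V")
      case True
      then show ?thesis using le by (auto simp: norm_mult intro!: mult_right_mono)
    next
      case False
      then have "\<phi> p = 0" using \<phi> not_in_support[of p \<phi>] by (auto simp: test_functions_def)
      then show ?thesis by simp
    qed
    have i\<phi>: "integrable lborel (\<lambda>p. norm (\<phi> p))"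
      using integrable_test_function_mult[OF \<phi>, of "\<lambda>_. 1"] by (intro integrable_norm) simp
    have s: "summable (\<lambda>j. norm (U j p * \<phi> p))" for p
      by (rule summable_comparison_test'[OF summable_mult2[OF c, of "norm (\<phi> p)"]]) (use n in auto)
    have "(\<lambda>j. LINT p|lborel. U j p * \<phi> p) sums (LINT p|lborel. (\<Sum>j. U j p * \<phi> p))"
    proof (rule sums_integral[OF i])
      show "AE p in lborel. summable (\<lambda>j. norm (U j p * \<phi> p))" using s by simp
      have "norm (LINT p|lborel. norm (U j p * \<phi> p)) \<le> c j * (LINT p|lborel. norm (\<phi> p))" for j
      proof -
        have "(LINT p|lborel. norm (U j p * \<phi> p)) \<le> (LINT p|lborel. c j * norm (\<phi> p))"
          by (intro integral_mono integrable_norm i integrable_mult_right i\<phi> n)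
        then show ?thesis by simp
      qed
      then show "summable (\<lambda>j. LINT p|lborel. norm (U j p * \<phi> p))"
        by (intro summable_comparison_test'[OF summable_mult2[OF c]])
    qed
    moreover have "(\<Sum>j. U j p * \<phi> p) = (\<Sum>j. U j p) * \<phi> p" for p
    proof (cases "p \<in> V")
      case True
      have "summable (\<lambda>j. U j p)"
        using le[OF True] by (intro summable_comparison_test'[OF c]) auto
      then show ?thesis by (rule suminf_mult2[symmetric])
    next
      case False
      then have "\<phi> p = 0" using \<phi> not_in_support[of p \<phi>] by (auto simp: test_functions_def)
      then show ?thesis by simp
    qed
    ultimately show "(\<lambda>j. dist_of (U j) \<phi>) sums dist_of (\<lambda>p. \<Sum>j. U j p) \<phi>"
      by (simp add: dist_of_def)
  qed
qed

text \<open>All terms of the series for \<open>Re (W 0 - W t)\<close> are non-negative. For \<open>t = \<pi> / 4\<^sup>m\<^sup>+\<^sup>1\<close> the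
  term with \<open>j = m\<close> equals \<open>2 / 2\<^sup>m\<close> and alone makes the difference quotient at \<open>0\<close> at least a
  constant times \<open>2\<^sup>m\<close>.\<close>

lemma weierstrass_not_differentiable:
  fixes W :: "real \<Rightarrow> complex"
  assumes W: "\<And>t. (\<lambda>j. (1 / 2) ^ j * exp (\<i> * of_real (4 ^ Suc j) * of_real t)) sums W t"
  shows "\<not> (W has_vector_derivative D) (at 0)"
proof
  assume D: "(W has_vector_derivative D) (at 0)"
  define t where "t m = pi / 4 ^ Suc m" for m :: nat
  have t: "t m > 0" for m by (simp add: t_def)
  have t0: "filterlim t (at 0) sequentially"
  proof -
    have "(\<lambda>m. pi * (1 / 4) ^ Suc m) \<longlonglongrightarrow> pi * 0"
      by (intro tendsto_intros LIMSEQ_Suc LIMSEQ_power_zero) simp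
    moreover have "t = (\<lambda>m. pi * (1 / 4) ^ Suc m)"
      by (simp add: t_def fun_eq_iff power_divide)
    ultimately show ?thesis
      using t by (auto simp: filterlim_at intro!: always_eventually less_imp_neq[THEN not_sym])
  qed
  have "((\<lambda>t. Re (W t)) has_real_derivative Re D) (at 0)"
    using bounded_linear.has_vector_derivative[OF bounded_linear_Re D]
    by (simp add: has_real_derivative_iff_has_vector_derivative)
  then have "((\<lambda>h. (Re (W h) - Re (W 0)) / (h - 0)) \<longlongrightarrow> Re D) (at 0)"
    by (simp only: has_field_derivative_iff)
  from tendsto_minus[OF filterlim_compose[OF this t0]]
  have lim: "(\<lambda>m. Re (W 0 - W (t m)) / t m) \<longlonglongrightarrow> - Re D"
    by (simp add: minus_divide_left)
  have low: "8 / pi * 2 ^ m \<le> Re (W 0 - W (t m)) / t m" for m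
  proof -
    let ?r = "\<lambda>j. (1 / 2) ^ j * (1 - cos (4 ^ Suc j * t m))"
    have "(\<lambda>j. (1 / 2) ^ j * exp (\<i> * of_real (4 ^ Suc j) * of_real 0) - (1 / 2) ^ j * exp (\<i> * of_real (4 ^ Suc j) * of_real (t m)))
        sums (W 0 - W (t m))"
      by (intro sums_diff W)
    then have "(\<lambda>j. Re ((1 / 2) ^ j * exp (\<i> * of_real (4 ^ Suc j) * of_real 0) - (1 / 2) ^ j * exp (\<i> * of_real (4 ^ Suc j) * of_real (t m))))
        sums Re (W 0 - W (t m))"
      by (rule sums_Re)
    moreover have "Re ((1 / 2) ^ j * exp (\<i> * of_real (4 ^ Suc j) * of_real 0) - (1 / 2) ^ j * exp (\<i> * of_real (4 ^ Suc j) * of_real (t m))) = ?r j" for j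
    proof -
      have e: "exp (\<i> * of_real (4 ^ Suc j) * of_real (t m)) = cis (4 ^ Suc j * t m)"
        by (simp add: cis_conv_exp mult.assoc)
      have h: "(1 / 2 :: complex) ^ j = of_real ((1 / 2) ^ j)" by simp
      show ?thesis unfolding e h by (simp only: minus_complex.sel Re_complex_of_real) (simp add: algebra_simps)
    qed
    ultimately have r: "?r sums Re (W 0 - W (t m))" by (simp only:)
    have "?r m = 2 * (1 / 2) ^ m" by (simp add: t_def)
    moreover have "?r m \<le> (\<Sum>j. ?r j)"
    proof -
      have "sum ?r {m} \<le> (\<Sum>j. ?r j)"
        using r by (intro sum_le_suminf) (auto simp: sums_iff)
      then show ?thesis by simp
    qed
    moreover have "(\<Sum>j. ?r j) = Re (W 0 - W (t m))"
      using r by (simp only: sums_iff)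
    ultimately have "2 * (1 / 2) ^ m / t m \<le> Re (W 0 - W (t m)) / t m"
      using t[of m] by (intro divide_right_mono) auto
    moreover have "2 * (1 / 2) ^ m / t m = 8 / pi * 2 ^ m"
    proof -
      have "(4 :: real) ^ m = 2 ^ m * 2 ^ m" by (simp flip: power_mult_distrib)
      then show ?thesis by (simp add: t_def power_divide field_simps)
    qed
    ultimately show ?thesis by simp
  qed
  obtain K where K: "\<And>m. \<bar>Re (W 0 - W (t m)) / t m\<bar> \<le> K"
    using convergent_imp_Bseq[OF convergentI[OF lim]] unfolding Bseq_def real_norm_def by blast
  obtain m where "K * pi / 8 < 2 ^ m"
    using real_arch_pow[of 2 "K * pi / 8"] by auto
  then have "K < 8 / pi * 2 ^ m" by (simp add: field_simps)
  with low[of m] K[of m] show False by linarith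
qed

text \<open>Superposing separated solutions of frequencies \<open>\<tau> = 4\<^sup>j\<^sup>+\<^sup>1\<close> with amplitudes \<open>2\<^sup>-\<^sup>j\<close> gives a
  continuous solution whose restriction to the \<open>t\<close>-axis is a Weierstrass function.\<close>

lemma not_hypoelliptic:
  assumes k: "k \<ge> 1" and \<Omega>: "open \<Omega>" "0 \<in> \<Omega>"
  shows "\<not> hypoelliptic (dist_sum_of_squares [Z1, Z2 k, Z3]) \<Omega>"
proof
  assume hyp: "hypoelliptic (dist_sum_of_squares [Z1, Z2 k, Z3]) \<Omega>"
  let ?Zs = "[Z1, Z2 k, Z3]"
  define V where "V = \<Omega> \<inter> ball (0 :: real^3) 1"
  have V: "open V" "V \<subseteq> \<Omega>" "0 \<in> V" "\<And>p. p \<in> V \<Longrightarrow> norm p \<le> 1"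
    using \<Omega> by (auto simp: V_def)
  have "\<exists>U. C1 U \<and> (\<forall>i. C1 (partial i U)) \<and> (\<forall>p. sum_of_squares ?Zs U p = 0) \<and>
      (\<forall>p. norm p \<le> 1 \<longrightarrow> norm (U p) \<le> (1 / 2) ^ j * exp 6) \<and>
      (\<forall>h. U (h *\<^sub>R axis 2 1) = of_real ((1 / 2) ^ j) * exp (\<i> * of_real (4 ^ Suc j) * of_real h))" for j
  proof -
    have \<tau>: "(4 :: real) ^ Suc j \<ge> 2"
      using power_increasing[of 1 "Suc j" "4 :: real"] by (simp del: power_Suc)
    have A: "(1 / 2 :: real) ^ j \<ge> 0" by simp
    show ?thesis by (rule separated_solution_exists[OF k \<tau> A]) blast
  qed
  then obtain U where U: "\<And>j. C1 (U j)" "\<And>j i. C1 (partial i (U j))"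
    "\<And>j p. sum_of_squares ?Zs (U j) p = 0" "\<And>j p. norm p \<le> 1 \<Longrightarrow> norm (U j p) \<le> (1 / 2) ^ j * exp 6"
    "\<And>j h. U j (h *\<^sub>R axis 2 1) = of_real ((1 / 2) ^ j) * exp (\<i> * of_real (4 ^ Suc j) * of_real h)"
    by metis
  define u where "u p = (\<Sum>j. U j p)" for p
  have Ule: "norm (U j p) \<le> (1 / 2) ^ j * exp 6" if "p \<in> V" for j p
    by (rule U(4)[OF V(4)[OF that]])
  have sm: "summable (\<lambda>j. (1 / 2) ^ j * exp (6 :: real))"
    by (intro summable_mult2 summable_geometric) simp
  have cU: "continuous_on V (U j)" for j
    by (rule continuous_on_subset[OF C1_continuous_on[OF U(1)]]) simp
  have cu: "continuous_on V u" and su: "dist_sums V (\<lambda>j. dist_of (U j)) (dist_of u)"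
    unfolding u_def[abs_def] by (rule dist_sums_dist_of[OF cU sm Ule]; assumption)+
  have L: "dist_sums V (\<lambda>j. dist_sum_of_squares ?Zs (dist_of (U j))) (dist_sum_of_squares ?Zs (dist_of u))"
    by (rule dist_sums_sum_of_squares[OF smooth_on_Z su])
  have "dist_sum_of_squares ?Zs (dist_of u) \<phi> = dist_of (\<lambda>_. 0) \<phi>" if \<phi>: "\<phi> \<in> test_functions V" for \<phi>
  proof -
    have "dist_sum_of_squares ?Zs (dist_of (U j)) \<phi> = 0" for j
    proof -
      have "dist_sum_of_squares ?Zs (dist_of (U j)) \<phi> = dist_of (sum_of_squares ?Zs (U j)) \<phi>"
        by (rule dist_sum_of_squares_dist_of[OF smooth_on_Z U(1,2) \<phi>])
      also have "\<dots> = 0" by (simp add: dist_of_def U(3))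
      finally show ?thesis .
    qed
    then have "(\<lambda>j. 0) sums dist_sum_of_squares ?Zs (dist_of u) \<phi>"
      using bspec[OF L[unfolded dist_sums_def] \<phi>] by simp
    then show ?thesis
      using sums_unique2[OF sums_zero] by (simp add: dist_of_def)
  qed
  then have "smooth_distribution V (dist_sum_of_squares ?Zs (dist_of u))"
    unfolding smooth_distribution_def
    by (intro exI[of _ "\<lambda>_. 0"]) (use smooth_on_const[of 0] in \<open>auto simp: smooth_on_def\<close>)
  with hyp V distribution_dist_of[OF cu] have "smooth_distribution V (dist_of u)"
    unfolding hypoelliptic_def by blast
  then obtain f where f: "smooth_on V f" "\<And>\<phi>. \<phi> \<in> test_functions V \<Longrightarrow> dist_of u \<phi> = dist_of f \<phi>"
    unfolding smooth_distribution_def by blast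
  have uf: "u p = f p" if "p \<in> V" for p
    by (rule fundamental_lemma[OF V(1) cu smooth_on_continuous_on[OF f(1)] f(2) that])
  let ?W = "\<lambda>t. \<Sum>j. (1 / 2) ^ j * exp (\<i> * complex_of_real (4 ^ Suc j) * of_real t)"
  have W: "(\<lambda>j. (1 / 2) ^ j * exp (\<i> * complex_of_real (4 ^ Suc j) * of_real t)) sums ?W t" for t
  proof (rule summable_sums, rule summable_comparison_test'[where N = 0])
    show "summable (\<lambda>j. (1 / 2 :: real) ^ j)" by (intro summable_geometric) simp
    show "norm ((1 / 2) ^ j * exp (\<i> * complex_of_real (4 ^ Suc j) * of_real t)) \<le> (1 / 2) ^ j" for j
      by (simp add: norm_mult norm_power norm_divide norm_exp_eq_Re)
  qed
  have uW: "u (t *\<^sub>R axis 2 1) = ?W t" for t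
    by (simp add: u_def U(5) power_divide)
  have "((\<lambda>t. f (0 + t *\<^sub>R axis 2 1)) has_vector_derivative partial 2 f (0 + 0 *\<^sub>R axis 2 1)) (at 0)"
    by (rule differentiable_along_line) (use smooth_on_imp[OF f(1) V(3)] in simp)
  then have "(?W has_vector_derivative partial 2 f (0 + 0 *\<^sub>R axis 2 1)) (at 0)"
  proof (rule has_vector_derivative_transform_within_open)
    show "open ((\<lambda>t. t *\<^sub>R axis 2 1) -` V)"
      by (intro open_vimage V continuous_intros)
    show "0 \<in> (\<lambda>t. t *\<^sub>R axis 2 1) -` V" using V by simp
    show "f (0 + t *\<^sub>R axis 2 1) = ?W t" if "t \<in> (\<lambda>t. t *\<^sub>R axis 2 1) -` V" for t
      using uf[of "t *\<^sub>R axis 2 1"] that uW[of t] by simp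
  qed
  with weierstrass_not_differentiable[OF W] show False by blast
qed

theorem proposition1p2:
  fixes k :: nat
  assumes "k \<ge> 1"
  shows "(\<forall>p. bracket_condition {Z1, Z2 k, Z3} p) \<and>
    (\<forall>V. open V \<and> bounded V \<longrightarrow>
      loses_finitely_many_derivatives (sum_of_squares [Z1, Z2 k, Z3]) V) \<and>
    (\<forall>U. open U \<and> 0 \<in> U \<longrightarrow> \<not> hypoelliptic (dist_sum_of_squares [Z1, Z2 k, Z3]) U)"
proof (intro conjI allI impI)
  show "bracket_condition {Z1, Z2 k, Z3} p" for p
    by (rule bracket_condition_Z)
  show "loses_finitely_many_derivatives (sum_of_squares [Z1, Z2 k, Z3]) V"
    if "open V \<and> bounded V" for V
  proof (rule loses_finitely_many_derivatives_sum_of_squares[where i = 3])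
    have "(\<lambda>p. axis 3 1) = Z3"
      by (simp add: fun_eq_iff Z3_def vec_eq_iff forall_3 axis_def)
    then show "(\<lambda>p. axis 3 1) \<in> set [Z1, Z2 k, Z3]" by simp
  qed (use that smooth_on_Z in auto)
  show "\<not> hypoelliptic (dist_sum_of_squares [Z1, Z2 k, Z3]) U" if "open U \<and> 0 \<in> U" for U
    using not_hypoelliptic[OF assms] that by blast
qed

end
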